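(* Let $q$ be a group-by aggregate query with aggregate $agg\in\{COUNT,SUM,AVG\}$, and let a user question $(\alpha_i,\alpha_j,>)$ comparing two aggregate values in the noisy answers of $q$ be given (it may be chosen by the user after seeing the Phase-1 output). Then the DPXPlain framework (the composition of Phases 1, 2 and 3 described in the context, with privacy parameters $\rho_q,\rho_{Topk},\rho_{Influ},\rho_{Rank}>0$) satisfies $(\rho_q+\rho_{Topk}+\rho_{Influ}+\rho_{Rank})$-zCDP.
   Context: **Databases and privacy.** A database $D$ is a finite bag of tuples over attributes $A_1,\dots,A_m$ with domains $\mathrm{dom}(A_i)$. $D\approx D'$ (neighboring) if $D'$ is obtained from $D$ by adding or removing one tuple. A randomized mechanism $\mathcal M$ is $\rho$-zCDP if $D_\alpha(\mathcal M(D)\,\|\,\mathcal M(D'))\le\rho\alpha$ for all $D\approx D'$ and all $\alpha\in(1,\infty)$, where $D_\alpha$ is the Rényi divergence of order $\alpha$. **Query.** $q$ = SELECT $A_{gb}$, $agg(A_{agg})$ FROM $D$ WHERE $\phi$ GROUP BY $A_{gb}$, where $\phi$ is a predicate on tuples. For $\alpha_i\in \mathrm{dom}(A_{gb})$ (a finite, data-independent set) let $g_i(D)$ be the bag of tuples of $D$ satisfying $\phi\wedge(A_{gb}=\alpha_i)$ and $o_i=agg(g_i(D))$, the aggregate of the $A_{agg}$-values in $g_i(D)$. $A_{agg}^{max}=\max\{|a|: a\in\mathrm{dom}(A_{agg})\}<\infty$. **Phase 1.** For COUNT or SUM release $\hat o_i=o_i+N(0,\sigma^2)$ for every $\alpha_i\in\mathrm{dom}(A_{gb})$,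 independently, with $\sigma=\Delta_q/\sqrt{2\rho_q}$, $\Delta_q=1$ for COUNT and $\Delta_q=A_{agg}^{max}$ for SUM. For AVG, answer the SUM query and the COUNT query in this way, each with budget $\rho_q/2$, obtaining $\hat o_i^S,\hat o_i^C$ (stored), and release $\hat o_i=\hat o_i^S/\hat o_i^C$. **Phase 2.** For the user question $(\alpha_i,\alpha_j,>)$ ("why $\hat o_i>\hat o_j$?") output a confidence interval for $o_i-o_j$ computed only from the Phase-1 noisy values. **Influence.** $\mathcal P$ is a finite data-independent set of predicates on tuples. For $p\in\mathcal P$, $\neg p(D)$ denotes the bag of tuples of $D$ not satisfying $p$. With $\Delta(p)=\big(agg(g_i(D))-agg(g_j(D))\big)-\big(agg(g_i(\neg p(D)))-agg(g_j(\neg p(D)))\big)$, define $\mathrm{Inf}(p)=\Delta(p)\cdot\frac{\min(|g_i(\neg p(D))|,|g_j(\neg p(D))|)}{\max(|g_i(D)|,|g_j(D)|)+1}$ for COUNT and SUM, and $\mathrm{Inf}(p)=\Delta(p)\cdot\min(|g_i(\neg p(D))|,|g_j(\neg p(D))|)$ for AVG (with $AVG(\emptyset)=0$). Put $\Delta_{\mathrm{Inf}}=4$ for COUNT, $4A_{agg}^{max}$ for SUM, $16A_{agg}^{max}$ for AVG. **Phase 3.** Parameters: integer $1\le k\le|\mathcal P|$, confidence level $\gamma\in(0,1)$, $\eta\in(0,1)$. All noise draws are independent. (i) *Top-k:* add independent Gumbel noise of scale $2\Delta_{\mathrm{Inf}}\sqrt{k/(8\rho_{Topk})}$ (CDF $\exp(-\exp(-z/\text{scale}))$)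 to $\mathrm{Inf}(p)$ for every $p\in\mathcal P$; output the $k$ predicates $p_1,\dots,p_k$ with largest noisy influences, in descending order. (ii) *Influence intervals:* for each $p_u$ release $\widehat{\mathrm{Inf}}_u=\mathrm{Inf}(p_u)+N(0,\sigma^2)$ with $\sigma=\Delta_{\mathrm{Inf}}/\sqrt{2\rho_{Influ}/k}$, and the interval $\widehat{\mathrm{Inf}}_u\pm\sqrt2\,\sigma\,\mathrm{erf}^{-1}(\gamma)$, rescaled by dividing by $|\hat o_i-\hat o_j|$ (COUNT, SUM) or $|\hat o_i-\hat o_j|\cdot|\min(\hat o_i^C,\hat o_j^C)|$ (AVG). (iii) *Rank intervals:* let $\mathrm{rank}^{-1}(t)$ be the predicate with the $t$-th largest influence in $\mathcal P$ (ties broken by a fixed order). With $\rho=\rho_{Rank}/k$ and $\beta=(\gamma+1)/2$, output for each $p_u$ the pair $(\mathrm{RankBound}(p_u,\eta\rho,\beta,-1),\ \mathrm{RankBound}(p_u,(1-\eta)\rho,\beta,+1))$. Here $\mathrm{RankBound}(p,\rho,\beta,dir)$ is: $N=\lceil\log_2|\mathcal P|\rceil$, $\sigma=2\Delta_{\mathrm{Inf}}/\sqrt{2(\rho/N)}$, $\xi=\sigma\sqrt{2\ln(N/(1-\beta))}\cdot dir$; initialize $t_{low}=1,t_{high}=|\mathcal P|$; while $t_{high}>t_{low}$: set $t=\lfloor(t_{low}+t_{high})/2\rfloor$ and draw $\hat s=\mathrm{Inf}(p)-\mathrm{Inf}(\mathrm{rank}^{-1}(t))+N(0,\sigma^2)$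 with fresh noise; if $\hat s\ge\xi$ set $t_{high}=\max\{t-1,1\}$, else set $t_{low}=\min\{t+1,|\mathcal P|\}$. Return $t_{high}$. (If $|\mathcal P|=1$ no iteration is performed.) The output of Phase 3 is the table of the $k$ predicates with these intervals, sorted using only the released values. *)

theory Defs
  imports "HOL-Probability.Probability"
begin

section \<open>Renyi divergence and zCDP\<close>

text \<open>The divergence is infinite unless \<open>P\<close> is absolutely continuous with respect to \<open>Q\<close>.
  For probability measures with finite \<open>I\<close> one has \<open>I \<ge> 1\<close>, so the real logarithm is the
  right one.\<close>

definition renyi_divergence :: "real \<Rightarrow> 'o measure \<Rightarrow> 'o measure \<Rightarrow> ereal" where
  "renyi_divergence \<alpha> P Q =
    (let I = (\<integral>\<^sup>+ x. ennreal (enn2real (RN_deriv Q P x) powr \<alpha>) \<partial>Q) in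
     if sets P = sets Q \<and> absolutely_continuous Q P \<and> I < \<infinity>
     then ereal (1 / (\<alpha> - 1) * ln (enn2real I)) else \<infinity>)"

definition neighboring :: "'t multiset \<Rightarrow> 't multiset \<Rightarrow> bool" where
  "neighboring D D' \<longleftrightarrow> (\<exists>t. D' = add_mset t D \<or> D = add_mset t D')"

definition randomized_mechanism ::
  "'t multiset set \<Rightarrow> 'o measure \<Rightarrow> ('t multiset \<Rightarrow> 'o measure) \<Rightarrow> bool" where
  "randomized_mechanism DB Out M \<longleftrightarrow> (\<forall>D\<in>DB. prob_space (M D) \<and> sets (M D) = sets Out)"

definition zCDP ::
  "'t multiset set \<Rightarrow> 'o measure \<Rightarrow> ('t multiset \<Rightarrow> 'o measure) \<Rightarrow> real \<Rightarrow> bool" where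
  "zCDP DB Out M \<rho> \<longleftrightarrow> randomized_mechanism DB Out M \<and>
    (\<forall>D\<in>DB. \<forall>D'\<in>DB. neighboring D D' \<longrightarrow>
      (\<forall>\<alpha>>1. renyi_divergence \<alpha> (M D) (M D') \<le> ereal (\<rho> * \<alpha>)))"

section \<open>Noise distributions\<close>

text \<open>With zero standard deviation or scale, which occurs only if the maximal absolute value
  of the aggregated attribute is 0, the noise is the point mass.\<close>

definition gaussian :: "real \<Rightarrow> real \<Rightarrow> real measure" where
  "gaussian \<mu> \<sigma> = (if \<sigma> = 0 then return borel \<mu> else density lborel (normal_density \<mu> \<sigma>))"

definition gumbel :: "real \<Rightarrow> real measure" where
  "gumbel b = (if b = 0 then return borel 0 else interval_measure (\<lambda>z. exp (- exp (- z / b))))"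

definition erf :: "real \<Rightarrow> real" where
  "erf x = 2 / sqrt pi * (LBINT t=0..x. exp (- t\<^sup>2))"

definition erf_inv :: "real \<Rightarrow> real" where
  "erf_inv y = (THE x. erf x = y)"

section \<open>Databases and group-by queries\<close>

text \<open>Tuples assign to each attribute a value of its domain. The function \<open>num_of\<close> reads
  attribute values as numbers; it is used for the aggregated attribute only.\<close>

record ('a, 'v) schema =
  attrs :: "'a set"
  adom :: "'a \<Rightarrow> 'v set"
  num_of :: "'v \<Rightarrow> real"

type_synonym ('a, 'v) tup = "'a \<Rightarrow> 'v"

definition tuples :: "('a, 'v) schema \<Rightarrow> ('a, 'v) tup set" where
  "tuples S = (\<Pi>\<^sub>E a\<in>attrs S. adom S a)"

definition databases :: "('a, 'v) schema \<Rightarrow> ('a, 'v) tup multiset set" where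
  "databases S = {D. set_mset D \<subseteq> tuples S}"

datatype aggregate = COUNT_agg | SUM_agg | AVG_agg

record ('a, 'v) gb_query =
  gb_attr :: 'a
  agg_attr :: 'a
  where_cond :: "('a \<Rightarrow> 'v) \<Rightarrow> bool"

definition groups :: "('a, 'v) schema \<Rightarrow> ('a, 'v) gb_query \<Rightarrow> 'v set" where
  "groups S q = adom S (gb_attr q)"

definition group_of :: "('a, 'v) gb_query \<Rightarrow> 'v \<Rightarrow> ('a, 'v) tup multiset \<Rightarrow> ('a, 'v) tup multiset" where
  "group_of q x D = {# t \<in># D. where_cond q t \<and> t (gb_attr q) = x #}"

text \<open>\<open>AVG_agg\<close> of the empty bag is 0, since division by zero gives 0.\<close>

fun agg_bag ::
  "('a, 'v) schema \<Rightarrow> ('a, 'v) gb_query \<Rightarrow> aggregate \<Rightarrow> ('a, 'v) tup multiset \<Rightarrow> real" where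
  "agg_bag S q COUNT_agg B = real (size B)"
| "agg_bag S q SUM_agg B = (\<Sum>t\<in>#B. num_of S (t (agg_attr q)))"
| "agg_bag S q AVG_agg B = (\<Sum>t\<in>#B. num_of S (t (agg_attr q))) / real (size B)"

definition agg_max :: "('a, 'v) schema \<Rightarrow> ('a, 'v) gb_query \<Rightarrow> real" where
  "agg_max S q = Sup ((\<lambda>v. \<bar>num_of S v\<bar>) ` adom S (agg_attr q))"

text \<open>The last conjunct says that the maximum of \<open>\<bar>a\<bar>\<close> over the domain of the
  aggregated attribute exists; it is then equal to \<^const>\<open>agg_max\<close>.\<close>

definition valid_query :: "('a, 'v) schema \<Rightarrow> ('a, 'v) gb_query \<Rightarrow> bool" where
  "valid_query S q \<longleftrightarrow>
    finite (attrs S) \<and> gb_attr q \<in> attrs S \<and> agg_attr q \<in> attrs S \<and> finite (groups S q) \<and>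
    (\<exists>a\<in>adom S (agg_attr q). \<forall>b\<in>adom S (agg_attr q). \<bar>num_of S b\<bar> \<le> \<bar>num_of S a\<bar>)"

section \<open>Phase 1: noisy answers\<close>

text \<open>The system stores one noisy value for each group and each query that is answered directly
  (\<open>SUM_agg\<close> and \<open>COUNT_agg\<close> for \<open>AVG_agg\<close>, otherwise the query itself); only
  \<open>released_answers\<close> is shown to the user.\<close>

definition base_queries :: "aggregate \<Rightarrow> aggregate set" where
  "base_queries agg = (case agg of COUNT_agg \<Rightarrow> {COUNT_agg} | SUM_agg \<Rightarrow> {SUM_agg} | AVG_agg \<Rightarrow> {SUM_agg, COUNT_agg})"

definition base_budget :: "aggregate \<Rightarrow> real \<Rightarrow> real" where
  "base_budget agg \<rho> = (case agg of AVG_agg \<Rightarrow> \<rho> / 2 | _ \<Rightarrow> \<rho>)"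

definition base_sensitivity :: "('a, 'v) schema \<Rightarrow> ('a, 'v) gb_query \<Rightarrow> aggregate \<Rightarrow> real" where
  "base_sensitivity S q a = (case a of COUNT_agg \<Rightarrow> 1 | _ \<Rightarrow> agg_max S q)"

type_synonym 'v stored = "aggregate \<times> 'v \<Rightarrow> real"

definition stored_space ::
  "('a, 'v) schema \<Rightarrow> ('a, 'v) gb_query \<Rightarrow> aggregate \<Rightarrow> 'v stored measure" where
  "stored_space S q agg = (\<Pi>\<^sub>M _\<in>base_queries agg \<times> groups S q. borel)"

definition phase1 ::
  "('a, 'v) schema \<Rightarrow> ('a, 'v) gb_query \<Rightarrow> aggregate \<Rightarrow> real \<Rightarrow> ('a, 'v) tup multiset \<Rightarrow>
    'v stored measure" where
  "phase1 S q agg \<rho> D =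
    (\<Pi>\<^sub>M (a, x)\<in>base_queries agg \<times> groups S q.
       gaussian (agg_bag S q a (group_of q x D))
         (base_sensitivity S q a / sqrt (2 * base_budget agg \<rho>)))"

definition released_answers ::
  "('a, 'v) schema \<Rightarrow> ('a, 'v) gb_query \<Rightarrow> aggregate \<Rightarrow> 'v stored \<Rightarrow> 'v \<Rightarrow> real" where
  "released_answers S q agg w =
    (\<lambda>x\<in>groups S q. case agg of AVG_agg \<Rightarrow> w (SUM_agg, x) / w (COUNT_agg, x) | _ \<Rightarrow> w (agg, x))"

definition answer_space :: "('a, 'v) schema \<Rightarrow> ('a, 'v) gb_query \<Rightarrow> ('v \<Rightarrow> real) measure" where
  "answer_space S q = (\<Pi>\<^sub>M _\<in>groups S q. borel)"

section \<open>User questions and influence\<close>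

text \<open>The pair \<open>(x, y)\<close> stands for the question why the answer of group \<open>x\<close> is
  greater than that of group \<open>y\<close>.\<close>

type_synonym 'v question = "'v \<times> 'v"

definition question_space :: "('a, 'v) schema \<Rightarrow> ('a, 'v) gb_query \<Rightarrow> 'v question measure" where
  "question_space S q = count_space (groups S q \<times> groups S q)"

definition without :: "(('a, 'v) tup \<Rightarrow> bool) \<Rightarrow> ('a, 'v) tup multiset \<Rightarrow> ('a, 'v) tup multiset" where
  "without p D = {# t \<in># D. \<not> p t #}"

definition intervention_change ::
  "('a, 'v) schema \<Rightarrow> ('a, 'v) gb_query \<Rightarrow> aggregate \<Rightarrow> 'v question \<Rightarrow> ('a, 'v) tup multiset \<Rightarrow>
    (('a, 'v) tup \<Rightarrow> bool) \<Rightarrow> real" where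
  "intervention_change S q agg = (\<lambda>(x, y) D p.
     (agg_bag S q agg (group_of q x D) - agg_bag S q agg (group_of q y D)) -
     (agg_bag S q agg (group_of q x (without p D)) - agg_bag S q agg (group_of q y (without p D))))"

definition influence ::
  "('a, 'v) schema \<Rightarrow> ('a, 'v) gb_query \<Rightarrow> aggregate \<Rightarrow> 'v question \<Rightarrow> ('a, 'v) tup multiset \<Rightarrow>
    (('a, 'v) tup \<Rightarrow> bool) \<Rightarrow> real" where
  "influence S q agg = (\<lambda>(x, y) D p.
     let m = real (min (size (group_of q x (without p D))) (size (group_of q y (without p D))));
         M = real (max (size (group_of q x D)) (size (group_of q y D)))
     in intervention_change S q agg (x, y) D p * (case agg of AVG_agg \<Rightarrow> m | _ \<Rightarrow> m / (M + 1)))"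

definition influence_sensitivity ::
  "('a, 'v) schema \<Rightarrow> ('a, 'v) gb_query \<Rightarrow> aggregate \<Rightarrow> real" where
  "influence_sensitivity S q agg =
    (case agg of COUNT_agg \<Rightarrow> 4 | SUM_agg \<Rightarrow> 4 * agg_max S q | AVG_agg \<Rightarrow> 16 * agg_max S q)"

section \<open>Phase 3: explanations\<close>

text \<open>The finite set of candidate predicates is given by a distinct list, whose order is the
  fixed order that breaks ties (\<^const>\<open>sort_key\<close> is stable). The field \<open>conf\<close> is the confidence level
  \<open>\<gamma>\<close>, and \<open>split_ratio\<close> is the share \<open>\<eta>\<close> of the rank budget
  spent on the first rank bound.\<close>

record ('a, 'v) config =
  preds :: "(('a \<Rightarrow> 'v) \<Rightarrow> bool) list"
  top_size :: nat
  conf :: real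
  split_ratio :: real
  rho_q :: real
  rho_topk :: real
  rho_influ :: real
  rho_rank :: real

definition valid_config :: "('a, 'v) config \<Rightarrow> bool" where
  "valid_config C \<longleftrightarrow>
    distinct (preds C) \<and> 1 \<le> top_size C \<and> top_size C \<le> length (preds C) \<and>
    0 < conf C \<and> conf C < 1 \<and> 0 < split_ratio C \<and> split_ratio C < 1 \<and>
    rho_q C > 0 \<and> rho_topk C > 0 \<and> rho_influ C > 0 \<and> rho_rank C > 0"

definition descending :: "('p \<Rightarrow> real) \<Rightarrow> 'p list \<Rightarrow> 'p list" where
  "descending f ps = sort_key (\<lambda>p. - f p) ps"

definition topk_space :: "nat \<Rightarrow> 'p list \<Rightarrow> 'p list measure" where
  "topk_space k ps = count_space {xs. length xs = k \<and> set xs \<subseteq> set ps}"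

definition topk_mechanism ::
  "nat \<Rightarrow> 'p list \<Rightarrow> real \<Rightarrow> real \<Rightarrow> ('p \<Rightarrow> real) \<Rightarrow> 'p list measure" where
  "topk_mechanism k ps \<Delta> \<rho> score =
    distr (\<Pi>\<^sub>M _\<in>set ps. gumbel (2 * \<Delta> * sqrt (k / (8 * \<rho>)))) (topk_space k ps)
      (\<lambda>z. take k (descending (\<lambda>p. score p + z p) ps))"

text \<open>\<open>rank_inv\<close> counts ranks from 1.\<close>

definition rank_inv :: "'p list \<Rightarrow> ('p \<Rightarrow> real) \<Rightarrow> nat \<Rightarrow> 'p" where
  "rank_inv ps score t = descending score ps ! (t - 1)"

text \<open>The loop of the rank-bound search, with state \<open>(low, high)\<close>. The conditions
  \<open>1 \<le> low\<close> and \<open>high \<le> length ps\<close> are invariants of the loop started at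
  \<open>(1, length ps)\<close>; they are tested only to make the recursion terminate on all
  arguments.\<close>

function rank_loop ::
  "'p list \<Rightarrow> ('p \<Rightarrow> real) \<Rightarrow> 'p \<Rightarrow> real \<Rightarrow> real \<Rightarrow> nat \<Rightarrow> nat \<Rightarrow> nat measure" where
  "rank_loop ps score p \<sigma> \<xi> low high =
    (if low < high \<and> 1 \<le> low \<and> high \<le> length ps then
       let t = (low + high) div 2 in
       gaussian (score p - score (rank_inv ps score t)) \<sigma> \<bind>
         (\<lambda>s. if s \<ge> \<xi> then rank_loop ps score p \<sigma> \<xi> low (max (t - 1) 1)
              else rank_loop ps score p \<sigma> \<xi> (min (t + 1) (length ps)) high)
     else return (count_space UNIV) high)"
  by pat_completeness auto
termination
  by (relation "Wellfounded.measure (\<lambda>(ps, score, p, \<sigma>, \<xi>, low, high). high - low)") auto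

declare rank_loop.simps [simp del]

definition rank_bound ::
  "'p list \<Rightarrow> real \<Rightarrow> ('p \<Rightarrow> real) \<Rightarrow> 'p \<Rightarrow> real \<Rightarrow> real \<Rightarrow> real \<Rightarrow> nat measure" where
  "rank_bound ps \<Delta> score p \<rho> \<beta> dir =
    (let N = real_of_int \<lceil>log 2 (length ps)\<rceil>;
         \<sigma> = 2 * \<Delta> / sqrt (2 * (\<rho> / N));
         \<xi> = \<sigma> * sqrt (2 * ln (N / (1 - \<beta>))) * dir
     in rank_loop ps score p \<sigma> \<xi> 1 (length ps))"

definition rank_interval ::
  "'p list \<Rightarrow> real \<Rightarrow> ('p \<Rightarrow> real) \<Rightarrow> real \<Rightarrow> real \<Rightarrow> real \<Rightarrow> 'p \<Rightarrow> (nat \<times> nat) measure" where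
  "rank_interval ps \<Delta> score \<rho> \<eta> \<gamma> p =
    rank_bound ps \<Delta> score p (\<eta> * \<rho>) ((\<gamma> + 1) / 2) (- 1) \<Otimes>\<^sub>M
    rank_bound ps \<Delta> score p ((1 - \<eta>) * \<rho>) ((\<gamma> + 1) / 2) 1"

definition influ_sigma ::
  "('a, 'v) schema \<Rightarrow> ('a, 'v) gb_query \<Rightarrow> aggregate \<Rightarrow> ('a, 'v) config \<Rightarrow> real" where
  "influ_sigma S q agg C = influence_sensitivity S q agg / sqrt (2 * rho_influ C / top_size C)"

text \<open>The draws of Phase 3: the top-\<open>k\<close> predicates, their noisy influences, and
  their rank intervals. Positions in the table are \<open>0, \<dots>, k - 1\<close>.\<close>

type_synonym 'p draws = "'p list \<times> (nat \<Rightarrow> real) \<times> (nat \<Rightarrow> nat \<times> nat)"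

definition draws_space :: "nat \<Rightarrow> 'p list \<Rightarrow> 'p draws measure" where
  "draws_space k ps =
    topk_space k ps \<Otimes>\<^sub>M (\<Pi>\<^sub>M _\<in>{..<k}. borel) \<Otimes>\<^sub>M
    (\<Pi>\<^sub>M _\<in>{..<k}. count_space UNIV \<Otimes>\<^sub>M count_space UNIV)"

definition phase3_draws ::
  "('a, 'v) schema \<Rightarrow> ('a, 'v) gb_query \<Rightarrow> aggregate \<Rightarrow> ('a, 'v) config \<Rightarrow> 'v question \<Rightarrow>
    ('a, 'v) tup multiset \<Rightarrow> (('a, 'v) tup \<Rightarrow> bool) draws measure" where
  "phase3_draws S q agg C qn D =
    (let ps = preds C; k = top_size C;
         \<Delta> = influence_sensitivity S q agg;
         score = influence S q agg qn D
     in do {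
       top \<leftarrow> topk_mechanism k ps \<Delta> (rho_topk C) score;
       infs \<leftarrow> (\<Pi>\<^sub>M u\<in>{..<k}. gaussian (score (top ! u)) (influ_sigma S q agg C));
       ranks \<leftarrow> (\<Pi>\<^sub>M u\<in>{..<k}.
         rank_interval ps \<Delta> score (rho_rank C / k) (split_ratio C) (conf C) (top ! u));
       return (draws_space k ps) (top, infs, ranks)
     })"

text \<open>A row contains the predicate, its noisy influence, the rescaled influence interval and the
  rank interval.\<close>

type_synonym 'p row = "'p \<times> real \<times> (real \<times> real) \<times> (nat \<times> nat)"

definition table_space :: "nat \<Rightarrow> 'p list \<Rightarrow> (nat \<Rightarrow> 'p row) measure" where
  "table_space k ps =
    (\<Pi>\<^sub>M _\<in>{..<k}. count_space (set ps) \<Otimes>\<^sub>M borel \<Otimes>\<^sub>M (borel \<Otimes>\<^sub>M borel) \<Otimes>\<^sub>M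
      (count_space UNIV \<Otimes>\<^sub>M count_space UNIV))"

definition rescaling ::
  "('a, 'v) schema \<Rightarrow> ('a, 'v) gb_query \<Rightarrow> aggregate \<Rightarrow> 'v stored \<Rightarrow> 'v question \<Rightarrow> real" where
  "rescaling S q agg w = (\<lambda>(x, y).
     let d = \<bar>released_answers S q agg w x - released_answers S q agg w y\<bar>
     in case agg of AVG_agg \<Rightarrow> d * \<bar>min (w (COUNT_agg, x)) (w (COUNT_agg, y))\<bar> | _ \<Rightarrow> d)"

definition table_of ::
  "('a, 'v) schema \<Rightarrow> ('a, 'v) gb_query \<Rightarrow> aggregate \<Rightarrow> ('a, 'v) config \<Rightarrow> 'v stored \<Rightarrow>
    'v question \<Rightarrow> (('a, 'v) tup \<Rightarrow> bool) draws \<Rightarrow> nat \<Rightarrow> (('a, 'v) tup \<Rightarrow> bool) row" where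
  "table_of S q agg C w qn = (\<lambda>(top, infs, ranks).
     let h = sqrt 2 * influ_sigma S q agg C * erf_inv (conf C);
         r = rescaling S q agg w qn
     in (\<lambda>u\<in>{..<top_size C}. (top ! u, infs u, ((infs u - h) / r, (infs u + h) / r), ranks u)))"

section \<open>The composed framework\<close>

text \<open>What the user has seen before the table: noisy answers, question, and the Phase-2 confidence
  interval.\<close>

type_synonym 'v public = "('v \<Rightarrow> real) \<times> 'v question \<times> (real \<times> real)"

definition public_space :: "('a, 'v) schema \<Rightarrow> ('a, 'v) gb_query \<Rightarrow> 'v public measure" where
  "public_space S q = answer_space S q \<Otimes>\<^sub>M question_space S q \<Otimes>\<^sub>M (borel \<Otimes>\<^sub>M borel)"

definition output_space ::
  "('a, 'v) schema \<Rightarrow> ('a, 'v) gb_query \<Rightarrow> ('a, 'v) config \<Rightarrow>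
    ('v public \<times> (nat \<Rightarrow> (('a, 'v) tup \<Rightarrow> bool) row)) measure" where
  "output_space S q C = public_space S q \<Otimes>\<^sub>M table_space (top_size C) (preds C)"

text \<open>The user is a possibly randomized strategy that sees only the released answers; fixed and
  deterministically chosen questions are the special case of point masses.\<close>

definition user_strategy ::
  "('a, 'v) schema \<Rightarrow> ('a, 'v) gb_query \<Rightarrow> (('v \<Rightarrow> real) \<Rightarrow> 'v question measure) \<Rightarrow> bool" where
  "user_strategy S q user \<longleftrightarrow> user \<in> answer_space S q \<rightarrow>\<^sub>M prob_algebra (question_space S q)"

text \<open>Phase 2 is an arbitrary measurable function of the question and the stored Phase-1 values.\<close>

definition answer_interval ::
  "('a, 'v) schema \<Rightarrow> ('a, 'v) gb_query \<Rightarrow> aggregate \<Rightarrow>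
    ('v question \<Rightarrow> 'v stored \<Rightarrow> real \<times> real) \<Rightarrow> bool" where
  "answer_interval S q agg ci \<longleftrightarrow>
    (\<forall>qn\<in>groups S q \<times> groups S q. ci qn \<in> stored_space S q agg \<rightarrow>\<^sub>M borel \<Otimes>\<^sub>M borel)"

text \<open>Sorting the table is a rearrangement of its rows that may depend on all released values.\<close>

definition table_sorter ::
  "('a, 'v) schema \<Rightarrow> ('a, 'v) gb_query \<Rightarrow> ('a, 'v) config \<Rightarrow>
    ('v public \<Rightarrow> (nat \<Rightarrow> (('a, 'v) tup \<Rightarrow> bool) row) \<Rightarrow> nat \<Rightarrow> (('a, 'v) tup \<Rightarrow> bool) row) \<Rightarrow> bool"
  where
  "table_sorter S q C srt \<longleftrightarrow>
    case_prod srt \<in> output_space S q C \<rightarrow>\<^sub>M table_space (top_size C) (preds C) \<and>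
    (\<forall>(pub, T)\<in>space (output_space S q C).
       \<exists>\<pi>. \<pi> permutes {..<top_size C} \<and> srt pub T = (\<lambda>u\<in>{..<top_size C}. T (\<pi> u)))"

definition dpxplain ::
  "('a, 'v) schema \<Rightarrow> ('a, 'v) gb_query \<Rightarrow> aggregate \<Rightarrow> ('a, 'v) config \<Rightarrow>
    (('v \<Rightarrow> real) \<Rightarrow> 'v question measure) \<Rightarrow>
    ('v question \<Rightarrow> 'v stored \<Rightarrow> real \<times> real) \<Rightarrow>
    ('v public \<Rightarrow> (nat \<Rightarrow> (('a, 'v) tup \<Rightarrow> bool) row) \<Rightarrow> nat \<Rightarrow> (('a, 'v) tup \<Rightarrow> bool) row) \<Rightarrow>
    ('a, 'v) tup multiset \<Rightarrow>
    ('v public \<times> (nat \<Rightarrow> (('a, 'v) tup \<Rightarrow> bool) row)) measure" where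
  "dpxplain S q agg C user ci srt D = do {
     w \<leftarrow> phase1 S q agg (rho_q C) D;
     qn \<leftarrow> user (released_answers S q agg w);
     z \<leftarrow> phase3_draws S q agg C qn D;
     let pub = (released_answers S q agg w, qn, ci qn w);
     return (output_space S q C) (pub, srt pub (table_of S q agg C w qn z))
   }"

end

theory Submission
  imports Defs
begin

text \<open>The Renyi divergence bound of order \<open>\<alpha>\<close> is proved in its dual, Hoelder form: with
  \<open>\<theta> = 1 - 1 / \<alpha>\<close>, it says that
  \<open>\<integral> h\<^sup>\<theta> \<partial>P \<le> exp ((\<alpha> - 1) \<rho>) (\<integral> h \<partial>Q)\<^sup>\<theta>\<close> for all
  \<open>[0, 1]\<close>-valued measurable \<open>h\<close>. In this form adaptive composition is the substitution of one
  inequality into the other: no density of a composed mechanism is ever needed, and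
  post-processing is composition with a common kernel. It remains to bound the single steps.
  Gaussian noise is a direct computation. Gumbel noise makes the top-\<open>k\<close> selection a sequence of
  \<open>k\<close> exponential mechanisms without replacement, whose privacy losses have bounded range. The
  rank search performs at most \<open>\<lceil>log\<^sub>2 n\<rceil>\<close> Gaussian comparisons, and the \<open>t\<close>-th largest
  influence is as stable as a single influence.\<close>

section \<open>The dual form of the Renyi divergence bound\<close>

text \<open>The factor exp ((\<alpha> - 1) \<rho>) is the \<alpha>-th root of exp (\<alpha>
  (\<alpha> - 1) \<rho>), which is what the bound \<rho> \<alpha> on the divergence means for the
  \<alpha>-th moment of the density. Taking \<open>h\<close> in [0, 1] keeps all integrals finite
  and covers every bounded nonnegative function, since both sides are homogeneous of degree
  \<theta>.

  The cost of one selection round explains the Gumbel scale. An exponential mechanism with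
  sensitivity \<Delta> and scale b is differentially private with parameter \<epsilon> = 2 \<Delta>
  / b, but the standard estimate \<epsilon>^2 / 2 would give four times the budget. Its privacy
  losses lie in an interval of length \<epsilon>, not 2 \<epsilon>; this yields \<epsilon>^2 / 8,
  which times k is the budget of the selection.

  Phase 1 answers all groups at the price of one, because a tuple lies in a single group. Its budget
  covers the stored sums and counts and not just their quotients, so Phase 2 and the rescaling may
  use them freely.\<close>

definition renyi_dual :: "real \<Rightarrow> real \<Rightarrow> 'o measure \<Rightarrow> 'o measure \<Rightarrow> bool" where
  "renyi_dual \<alpha> \<rho> P Q \<longleftrightarrow> prob_space P \<and> prob_space Q \<and> sets P = sets Q \<and>
    (\<forall>h::'o \<Rightarrow> real. h \<in> borel_measurable Q \<longrightarrow> (\<forall>x\<in>space Q. 0 \<le> h x \<and> h x \<le> 1) \<longrightarrow>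
      (\<integral>x. h x powr (1 - 1 / \<alpha>) \<partial>P) \<le> exp ((\<alpha> - 1) * \<rho>) * (\<integral>x. h x \<partial>Q) powr (1 - 1 / \<alpha>))"

lemma renyi_dualD:
  assumes "renyi_dual \<alpha> \<rho> P Q"
  shows "prob_space P" "prob_space Q" "sets P = sets Q"
  using assms by (auto simp: renyi_dual_def)

lemma renyi_dual_mono:
  assumes d: "renyi_dual \<alpha> \<rho> P Q" and le: "\<rho> \<le> \<rho>'" and a: "\<alpha> > 1"
  shows "renyi_dual \<alpha> \<rho>' P Q"
  unfolding renyi_dual_def
proof (intro conjI allI impI renyi_dualD[OF d])
  fix h :: "'a \<Rightarrow> real" assume h: "h \<in> borel_measurable Q" "\<forall>x\<in>space Q. 0 \<le> h x \<and> h x \<le> 1"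
  have "(\<integral>x. h x powr (1 - 1 / \<alpha>) \<partial>P) \<le> exp ((\<alpha> - 1) * \<rho>) * (\<integral>x. h x \<partial>Q) powr (1 - 1 / \<alpha>)"
    using d h by (auto simp: renyi_dual_def)
  also have "\<dots> \<le> exp ((\<alpha> - 1) * \<rho>') * (\<integral>x. h x \<partial>Q) powr (1 - 1 / \<alpha>)"
    using le a by (intro mult_right_mono) auto
  finally show "(\<integral>x. h x powr (1 - 1 / \<alpha>) \<partial>P) \<le> exp ((\<alpha> - 1) * \<rho>') * (\<integral>x. h x \<partial>Q) powr (1 - 1 / \<alpha>)" .
qed

section \<open>Hoelder's inequality: from a moment of the density to the dual form\<close>

lemma Young_powr:
  fixes u v \<theta> :: real
  assumes "0 < \<theta>" "\<theta> < 1" "u \<ge> 0" "v \<ge> 0"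
  shows "u powr \<theta> * v \<le> \<theta> * u + (1 - \<theta>) * v powr (1 / (1 - \<theta>))"
  using Youngs_inequality[of "1/\<theta>" "1/(1-\<theta>)" "u powr \<theta>" v] assms
  by (simp add: powr_powr field_simps)

lemma (in prob_space) integrable_unit_interval:
  fixes h :: "'a \<Rightarrow> real"
  assumes "h \<in> borel_measurable M" "\<And>x. x \<in> space M \<Longrightarrow> 0 \<le> h x \<and> h x \<le> 1"
  shows "integrable M h"
  by (rule integrable_const_bound[where B = 1]) (use assms in auto)

lemma (in prob_space) expectation_unit_interval:
  fixes h :: "'a \<Rightarrow> real"
  assumes "\<And>x. x \<in> space M \<Longrightarrow> 0 \<le> h x \<and> h x \<le> 1"
  shows "expectation h \<ge> 0" "expectation h \<le> 1"
proof -
  show "expectation h \<ge> 0"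
    using assms by (intro Bochner_Integration.integral_nonneg) auto
  show "expectation h \<le> 1"
  proof (cases "integrable M h")
    case True
    have "expectation h \<le> expectation (\<lambda>_. 1)"
      using assms True by (intro integral_mono) auto
    then show ?thesis by (simp add: prob_space)
  qed (simp add: not_integrable_integral_eq)
qed

text \<open>Hoelder's inequality for the density \<open>f\<close> and
  \<open>h powr \<theta>\<close>, with conjugate exponents \<alpha> and 1 / \<theta>, obtained by
  integrating a pointwise Young inequality. The single steps with an explicit likelihood ratio enter
  the dual form here.\<close>

lemma renyi_dualI_nn_integral:
  fixes f :: "'o \<Rightarrow> real"
  assumes a: "\<alpha> > 1" and Q: "prob_space Q" and P: "prob_space P"
    and f [measurable]: "f \<in> borel_measurable Q" and f0: "\<And>x. x \<in> space Q \<Longrightarrow> f x \<ge> 0"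
    and dens: "P = density Q (\<lambda>x. ennreal (f x))"
    and I: "(\<integral>\<^sup>+x. ennreal (f x powr \<alpha>) \<partial>Q) \<le> ennreal (exp (\<alpha> * (\<alpha> - 1) * \<rho>))"
  shows "renyi_dual \<alpha> \<rho> P Q"
proof -
  interpret Q: prob_space Q by fact
  interpret P: prob_space P by fact
  define \<theta> where "\<theta> = 1 - 1 / \<alpha>"
  have t: "0 < \<theta>" "\<theta> < 1" "1 / (1 - \<theta>) = \<alpha>" "1 - \<theta> = 1 / \<alpha>"
    using a by (auto simp: \<theta>_def field_simps)
  define b where "b = exp ((\<alpha> - 1) * \<rho>)"
  have b: "b > 0" "b powr \<alpha> = exp (\<alpha> * (\<alpha> - 1) * \<rho>)"
    by (auto simp: b_def powr_def ac_simps)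
  have s: "sets P = sets Q" by (simp add: dens)
  have sp: "space P = space Q" using s by (rule sets_eq_imp_space_eq)
  have fi: "integrable Q (\<lambda>x. f x powr \<alpha>)" "(\<integral>x. f x powr \<alpha> \<partial>Q) \<le> b powr \<alpha>"
  proof -
    show i: "integrable Q (\<lambda>x. f x powr \<alpha>)"
      using I by (intro integrableI_bounded) (auto intro: le_less_trans)
    show "(\<integral>x. f x powr \<alpha> \<partial>Q) \<le> b powr \<alpha>"
      using I unfolding b(2) by (subst (asm) nn_integral_eq_integral[OF i]) auto
  qed
  have fint: "integrable Q f"
  proof (rule integrableI_bounded)
    have "(\<integral>\<^sup>+x. ennreal (norm (f x)) \<partial>Q) = (\<integral>\<^sup>+x. ennreal (f x) \<partial>Q)"
      using f0 by (intro nn_integral_cong) auto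
    also have "\<dots> = emeasure P (space P)"
      unfolding sp unfolding dens by (subst emeasure_density) (auto intro!: nn_integral_cong)
    also have "\<dots> < \<infinity>" by (simp add: P.emeasure_space_1)
    finally show "(\<integral>\<^sup>+x. ennreal (norm (f x)) \<partial>Q) < \<infinity>" .
  qed simp
  have key: "(\<integral>x. h x powr \<theta> \<partial>P) \<le> b * (\<integral>x. h x \<partial>Q) powr \<theta>"
    if h [measurable]: "h \<in> borel_measurable Q" and h1: "\<And>x. x \<in> space Q \<Longrightarrow> 0 \<le> h x \<and> h x \<le> 1" for h
  proof -
    define H where "H = (\<integral>x. h x \<partial>Q)"
    have hp1: "h x powr \<theta> \<le> 1" if "x \<in> space Q" for x
      using h1[OF that] t by (metis powr_mono2 less_imp_le powr_one_eq_one)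
    have hint: "integrable Q h" by (rule Q.integrable_unit_interval) (use h1 in auto)
    have eqP: "(\<integral>x. h x powr \<theta> \<partial>P) = (\<integral>x. f x * h x powr \<theta> \<partial>Q)"
      unfolding dens by (subst integral_density) (use f0 in auto)
    have fhi: "integrable Q (\<lambda>x. f x * h x powr \<theta>)"
      by (rule Bochner_Integration.integrable_bound[OF fint])
         (use f0 hp1 in \<open>auto intro!: AE_I2 mult_left_le\<close>)
    have H0: "H \<ge> 0" "H \<le> 1" unfolding H_def using Q.expectation_unit_interval h1 by auto
    show ?thesis
    \<comment> \<open>Normalising by \<open>H\<close> is impossible if it vanishes; then
      \<open>h\<close> is zero \<open>Q\<close>-almost everywhere, and so is the integrand weighted
      with the density.\<close>
    proof (cases "H = 0")
      case True
      then have "AE x in Q. h x = 0"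
        using integral_nonneg_eq_0_iff_AE[OF hint] h1 by (auto simp: H_def)
      then have "(\<integral>x. f x * h x powr \<theta> \<partial>Q) = (\<integral>x. 0 \<partial>Q)"
        by (intro integral_cong_AE) auto
      then show ?thesis unfolding eqP using b by simp
    next
      case False
      then have Hp: "H > 0" using H0 by simp
      \<comment> \<open>Young's inequality for \<open>h / H\<close> and \<open>f / b\<close>: the
        integral of \<open>h / H\<close> is 1 and that of \<open>(f / b) powr \<alpha>\<close> is at
        most 1, so the weights \<theta> and 1 - \<theta> add up to 1 after integration.\<close>
      have "f x * h x powr \<theta> \<le> b * H powr \<theta> * (\<theta> * (h x / H) + (1 - \<theta>) * (f x powr \<alpha> / b powr \<alpha>))"
        if x: "x \<in> space Q" for x
      proof -
        have "(h x / H) powr \<theta> * (f x / b) \<le> \<theta> * (h x / H) + (1 - \<theta>) * (f x / b) powr (1 / (1 - \<theta>))"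
          using t Hp b f0[OF x] h1[OF x] by (intro Young_powr) auto
        then have "(h x / H) powr \<theta> * (f x / b) \<le> \<theta> * (h x / H) + (1 - \<theta>) * (f x powr \<alpha> / b powr \<alpha>)"
          unfolding t(3) using b f0[OF x] by (simp add: powr_divide)
        then have "b * H powr \<theta> * ((h x / H) powr \<theta> * (f x / b)) \<le>
            b * H powr \<theta> * (\<theta> * (h x / H) + (1 - \<theta>) * (f x powr \<alpha> / b powr \<alpha>))"
          using b by (intro mult_left_mono) auto
        moreover have "b * H powr \<theta> * ((h x / H) powr \<theta> * (f x / b)) = f x * h x powr \<theta>"
          using b Hp h1[OF x] by (simp add: powr_divide)
        ultimately show ?thesis by simp
      qed
      then have "(\<integral>x. f x * h x powr \<theta> \<partial>Q) \<le>
          (\<integral>x. b * H powr \<theta> * (\<theta> * (h x / H) + (1 - \<theta>) * (f x powr \<alpha> / b powr \<alpha>)) \<partial>Q)"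
        using fhi hint fi by (intro integral_mono) auto
      also have "\<dots> = b * H powr \<theta> * (\<theta> * (H / H) + (1 - \<theta>) * ((\<integral>x. f x powr \<alpha> \<partial>Q) / b powr \<alpha>))"
        using hint fi by (simp add: H_def)
      also have "\<dots> \<le> b * H powr \<theta> * (\<theta> * 1 + (1 - \<theta>) * 1)"
        using b Hp t fi(2) by (intro mult_left_mono add_mono) (auto simp: divide_simps)
      finally show ?thesis unfolding eqP H_def by simp
    qed
  qed
  show ?thesis
    unfolding renyi_dual_def using P Q s key unfolding b_def \<theta>_def by auto
qed

text \<open>For the density 1 the Hoelder bound is Jensen's inequality for the concave power
  \<theta>. Budget 0 makes every kernel shared by both databases free.\<close>

lemma renyi_dual_refl:
  assumes a: "\<alpha> > 1" and "prob_space P"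
  shows "renyi_dual \<alpha> 0 P P"
proof -
  interpret prob_space P by fact
  show ?thesis
    by (rule renyi_dualI_nn_integral[where f = "\<lambda>_. 1"])
       (use assms in \<open>auto simp: density_1 emeasure_space_1\<close>)
qed

section \<open>Composition with kernels, post-processing and products\<close>

lemma integral_bind_unit_interval:
  fixes h :: "'b \<Rightarrow> real"
  assumes K: "K \<in> P \<rightarrow>\<^sub>M prob_algebra N" and h: "h \<in> borel_measurable N"
    and P: "prob_space P"
    and h1: "\<And>x. x \<in> space N \<Longrightarrow> 0 \<le> h x \<and> h x \<le> 1"
  shows "(\<integral>y. h y \<partial>(P \<bind> K)) = (\<integral>x. (\<integral>y. h y \<partial>K x) \<partial>P)"
proof (rule integral_bind[where K = N and B = 1 and B' = 1])
  interpret prob_space P by fact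
  show "h \<in> borel_measurable N" by fact
  show "K \<in> P \<rightarrow>\<^sub>M subprob_algebra N" using K by (rule measurable_prob_algebraD)
  show "finite_measure P" by unfold_locales
  show "AE x in P. emeasure (K x) (space (K x)) \<le> ennreal 1"
    using measurable_space[OF K] by (auto simp: space_prob_algebra prob_space.emeasure_space_1)
  show "\<bar>h x\<bar> \<le> 1" if "x \<in> space N" for x using h1[OF that] by simp
qed

lemma borel_measurable_integral_kernel:
  fixes h :: "'b \<Rightarrow> real"
  assumes K: "K \<in> Q \<rightarrow>\<^sub>M prob_algebra N" and h: "h \<in> borel_measurable N"
  shows "(\<lambda>x. \<integral>y. h y \<partial>K x) \<in> borel_measurable Q"
  using measurable_compose[OF measurable_prob_algebraD[OF K] integral_measurable_subprob_algebra[OF h]] .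

text \<open>Bounding the inner integral of \<open>h powr \<theta>\<close> leaves a multiple of
  \<open>g powr \<theta>\<close>, where \<open>g x\<close> is the integral of \<open>h\<close> over
  \<open>K' x\<close>. This \<open>g\<close> is again a test function for the outer inequality, with
  the same exponent, and the exponential factors multiply.\<close>

lemma renyi_dual_bind:
  assumes a: "\<alpha> > 1" and d: "renyi_dual \<alpha> \<rho>1 P Q"
    and K: "K \<in> Q \<rightarrow>\<^sub>M prob_algebra N" and K': "K' \<in> Q \<rightarrow>\<^sub>M prob_algebra N"
    and dK: "\<And>x. x \<in> space Q \<Longrightarrow> renyi_dual \<alpha> \<rho>2 (K x) (K' x)"
  shows "renyi_dual \<alpha> (\<rho>1 + \<rho>2) (P \<bind> K) (Q \<bind> K')"
proof -
  note PQ = renyi_dualD[OF d]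
  interpret P: prob_space P by fact
  interpret Q: prob_space Q by fact
  have KP: "K \<in> P \<rightarrow>\<^sub>M prob_algebra N" using K PQ(3) by (simp cong: measurable_cong_sets)
  have sp: "space P = space Q" using PQ(3) by (rule sets_eq_imp_space_eq)
  define \<theta> where "\<theta> = 1 - 1 / \<alpha>"
  have t: "0 < \<theta>" "\<theta> < 1" using a by (auto simp: \<theta>_def field_simps)
  have sK: "space (K x) = space N" "prob_space (K x)" "sets (K x) = sets N" if "x \<in> space Q" for x
    using measurable_space[OF K that] by (auto simp: space_prob_algebra dest: sets_eq_imp_space_eq)
  have sK': "space (K' x) = space N" "prob_space (K' x)" "sets (K' x) = sets N" if "x \<in> space Q" for x
    using measurable_space[OF K' that] by (auto simp: space_prob_algebra dest: sets_eq_imp_space_eq)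
  have 1: "P \<in> space (prob_algebra Q)" "Q \<in> space (prob_algebra Q)"
    using PQ by (auto simp: space_prob_algebra)
  have sets: "sets (P \<bind> K) = sets N" "sets (Q \<bind> K') = sets N"
    using sets_bind'[OF 1(1) K] sets_bind'[OF 1(2) K'] .
  show ?thesis
    unfolding renyi_dual_def
  proof (intro conjI allI impI)
    show "prob_space (P \<bind> K)" "prob_space (Q \<bind> K')"
      using prob_space_bind'[OF 1(1) K] prob_space_bind'[OF 1(2) K'] .
    show "sets (P \<bind> K) = sets (Q \<bind> K')" using sets by simp
    fix h :: "'b \<Rightarrow> real" assume "h \<in> borel_measurable (Q \<bind> K')" and "\<forall>x\<in>space (Q \<bind> K'). 0 \<le> h x \<and> h x \<le> 1"
    then have h [measurable]: "h \<in> borel_measurable N" and h1: "\<And>x. x \<in> space N \<Longrightarrow> 0 \<le> h x \<and> h x \<le> 1"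
      using sets(2) sets_eq_imp_space_eq[OF sets(2)] by (auto cong: measurable_cong_sets)
    have hp1: "0 \<le> h x powr \<theta> \<and> h x powr \<theta> \<le> 1" if "x \<in> space N" for x
      using h1[OF that] t by (metis powr_ge_zero powr_mono2 less_imp_le powr_one_eq_one)
    define g where "g x = (\<integral>y. h y \<partial>K' x)" for x
    have g [measurable]: "g \<in> borel_measurable Q" unfolding g_def
      by (rule borel_measurable_integral_kernel[OF K' h])
    have g1: "0 \<le> g x \<and> g x \<le> 1" if "x \<in> space Q" for x
      unfolding g_def using prob_space.expectation_unit_interval[OF sK'(2)[OF that], of h] h1 sK'(1)[OF that] by auto
    have gp1: "0 \<le> g x powr \<theta> \<and> g x powr \<theta> \<le> 1" if "x \<in> space Q" for x
      using g1[OF that] t by (metis powr_ge_zero powr_mono2 less_imp_le powr_one_eq_one)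
    have "(\<integral>y. h y powr \<theta> \<partial>(P \<bind> K)) = (\<integral>x. (\<integral>y. h y powr \<theta> \<partial>K x) \<partial>P)"
      by (rule integral_bind_unit_interval[OF KP _ PQ(1)]) (use hp1 in auto)
    also have "\<dots> \<le> (\<integral>x. exp ((\<alpha> - 1) * \<rho>2) * g x powr \<theta> \<partial>P)"
    proof (rule integral_mono)
      have mP: "borel_measurable P = borel_measurable Q"
        using PQ(3) by (intro measurable_cong_sets) auto
      show "integrable P (\<lambda>x. \<integral>y. h y powr \<theta> \<partial>K x)"
      proof (rule P.integrable_unit_interval)
        show "(\<lambda>x. \<integral>y. h y powr \<theta> \<partial>K x) \<in> borel_measurable P"
          by (rule borel_measurable_integral_kernel[OF KP]) auto
        fix x assume "x \<in> space P" then have x: "x \<in> space Q" by (simp add: sp)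
        show "0 \<le> (\<integral>y. h y powr \<theta> \<partial>K x) \<and> (\<integral>y. h y powr \<theta> \<partial>K x) \<le> 1"
          using prob_space.expectation_unit_interval[OF sK(2)[OF x], of "\<lambda>y. h y powr \<theta>"] hp1 sK(1)[OF x] by auto
      qed
      show "integrable P (\<lambda>x. exp ((\<alpha> - 1) * \<rho>2) * g x powr \<theta>)"
        by (intro integrable_mult_right P.integrable_unit_interval) (use gp1 sp in \<open>auto simp: mP\<close>)
      fix x assume "x \<in> space P" then have x: "x \<in> space Q" by (simp add: sp)
      have hK: "h \<in> borel_measurable (K' x)"
        using h sK'(3)[OF x] by (simp cong: measurable_cong_sets)
      show "(\<integral>y. h y powr \<theta> \<partial>K x) \<le> exp ((\<alpha> - 1) * \<rho>2) * g x powr \<theta>"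
        using dK[OF x] hK h1 unfolding renyi_dual_def g_def \<theta>_def sK'(1)[OF x] by auto
    qed
    also have "\<dots> = exp ((\<alpha> - 1) * \<rho>2) * (\<integral>x. g x powr \<theta> \<partial>P)" by simp
    also have "\<dots> \<le> exp ((\<alpha> - 1) * \<rho>2) * (exp ((\<alpha> - 1) * \<rho>1) * (\<integral>x. g x \<partial>Q) powr \<theta>)"
      using d g g1 unfolding renyi_dual_def \<theta>_def by (intro mult_left_mono) auto
    also have "(\<integral>x. g x \<partial>Q) = (\<integral>y. h y \<partial>(Q \<bind> K'))"
      unfolding g_def by (rule integral_bind_unit_interval[OF K' h PQ(2) h1, symmetric])
    finally show "(\<integral>y. h y powr (1 - 1 / \<alpha>) \<partial>(P \<bind> K)) \<le>
        exp ((\<alpha> - 1) * (\<rho>1 + \<rho>2)) * (\<integral>y. h y \<partial>(Q \<bind> K')) powr (1 - 1 / \<alpha>)"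
      unfolding \<theta>_def by (simp add: distrib_left exp_add mult_ac)
  qed
qed

text \<open>A deterministic map is the kernel \<open>return N (f x)\<close>; it is the same on both
  sides and adds the budget 0 of \<open>renyi_dual_refl\<close>.\<close>

lemma renyi_dual_distr:
  assumes a: "\<alpha> > 1" and d: "renyi_dual \<alpha> \<rho> P Q" and f: "f \<in> Q \<rightarrow>\<^sub>M N"
  shows "renyi_dual \<alpha> \<rho> (distr P N f) (distr Q N f)"
proof -
  note PQ = renyi_dualD[OF d]
  have fP: "f \<in> P \<rightarrow>\<^sub>M N" using f PQ(3) by (simp cong: measurable_cong_sets)
  have K: "(\<lambda>x. return N (f x)) \<in> Q \<rightarrow>\<^sub>M prob_algebra N"
    using measurable_compose[OF f measurable_return_prob_space] .
  have "renyi_dual \<alpha> (\<rho> + 0) (P \<bind> (\<lambda>x. return N (f x))) (Q \<bind> (\<lambda>x. return N (f x)))"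
    using measurable_space[OF f]
    by (intro renyi_dual_bind[OF a d K K] renyi_dual_refl a prob_space_return)
  then show ?thesis
    using PQ(1,2)[THEN prob_space.not_empty] by (simp add: bind_return_distr'[OF _ fP] bind_return_distr'[OF _ f])
qed

text \<open>A product measure is a composition whose second kernel ignores the first outcome, so the
  budgets add as in \<open>renyi_dual_bind\<close>.\<close>

lemma renyi_dual_pair:
  assumes a: "\<alpha> > 1" and d1: "renyi_dual \<alpha> \<rho>1 P Q" and d2: "renyi_dual \<alpha> \<rho>2 P' Q'"
  shows "renyi_dual \<alpha> (\<rho>1 + \<rho>2) (P \<Otimes>\<^sub>M P') (Q \<Otimes>\<^sub>M Q')"
proof -
  note 1 = renyi_dualD[OF d1] and 2 = renyi_dualD[OF d2]
  interpret P: prob_space P by fact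
  interpret Q: prob_space Q by fact
  interpret P': prob_space P' by fact
  interpret Q': prob_space Q' by fact
  interpret P: pair_prob_space P P' ..
  interpret Q: pair_prob_space Q Q' ..
  let ?N = "Q \<Otimes>\<^sub>M Q'"
  have s: "sets (P \<Otimes>\<^sub>M P') = sets ?N" using 1 2 by (intro sets_pair_measure_cong) auto
  have r: "return (P \<Otimes>\<^sub>M P') = return ?N" by (rule ext, rule return_cong[OF s])
  have bind_distr: "R \<bind> (\<lambda>y. return ?N (x, y)) = distr R ?N (Pair x)"
    if "x \<in> space Q" "prob_space R" "sets R = sets Q'" for x R
  proof (rule bind_return_distr')
    show "Pair x \<in> R \<rightarrow>\<^sub>M ?N" using that measurable_Pair1'[of x Q Q'] by (simp cong: measurable_cong_sets)
    show "space R \<noteq> {}" using that(2) by (rule prob_space.not_empty)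
  qed
  have K: "(\<lambda>x. R \<bind> (\<lambda>y. return ?N (x, y))) \<in> Q \<rightarrow>\<^sub>M prob_algebra ?N"
    if R: "prob_space R" "sets R = sets Q'" for R
  proof (rule measurable_bind_prob_space2[where N = Q'])
    show "(\<lambda>x. R) \<in> Q \<rightarrow>\<^sub>M prob_algebra Q'"
      using R by (intro measurable_const) (auto simp: space_prob_algebra)
    show "(\<lambda>(x, y). return ?N (x, y)) \<in> ?N \<rightarrow>\<^sub>M prob_algebra ?N" by simp
  qed
  have "renyi_dual \<alpha> (\<rho>1 + \<rho>2) (P \<bind> (\<lambda>x. P' \<bind> (\<lambda>y. return ?N (x, y))))
      (Q \<bind> (\<lambda>x. Q' \<bind> (\<lambda>y. return ?N (x, y))))"
  proof (rule renyi_dual_bind[OF a d1 K K])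
    fix x assume x: "x \<in> space Q"
    show "renyi_dual \<alpha> \<rho>2 (P' \<bind> (\<lambda>y. return ?N (x, y))) (Q' \<bind> (\<lambda>y. return ?N (x, y)))"
      unfolding bind_distr[OF x 2(1,3)] bind_distr[OF x 2(2) refl]
      by (rule renyi_dual_distr[OF a d2]) (rule measurable_Pair1'[OF x])
  qed (use 2 in auto)
  then show ?thesis
    using P.pair_measure_eq_bind Q.pair_measure_eq_bind unfolding r by argo
qed

lemma renyi_dual_PiM:
  assumes a: "\<alpha> > 1" and "finite I" and d: "\<And>i. i \<in> I \<Longrightarrow> renyi_dual \<alpha> (\<rho> i) (P i) (Q i)"
  shows "renyi_dual \<alpha> (\<Sum>i\<in>I. \<rho> i) (\<Pi>\<^sub>M i\<in>I. P i) (\<Pi>\<^sub>M i\<in>I. Q i)"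
  using assms(2) d
proof (induction I rule: finite_induct)
  case empty
  have "prob_space (\<Pi>\<^sub>M i\<in>{}. Q i)" by (rule prob_space_PiM) auto
  moreover have "(\<Pi>\<^sub>M i\<in>{}. P i) = (\<Pi>\<^sub>M i\<in>{}. Q i)" by (rule PiM_cong) auto
  ultimately show ?case using renyi_dual_refl[OF a, of "\<Pi>\<^sub>M i\<in>{}. Q i"] by simp
next
  case (insert i I)
  note D = renyi_dualD[OF insert.prems]
  have s: "sets (\<Pi>\<^sub>M j\<in>insert i I. P j) = sets (\<Pi>\<^sub>M j\<in>insert i I. Q j)"
    using D(3) by (intro sets_PiM_cong) auto
  have "renyi_dual \<alpha> (\<rho> i + (\<Sum>i\<in>I. \<rho> i))
     (distr (P i \<Otimes>\<^sub>M (\<Pi>\<^sub>M i\<in>I. P i)) (\<Pi>\<^sub>M j\<in>insert i I. Q j) (\<lambda>(x, X). X(i := x)))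
     (distr (Q i \<Otimes>\<^sub>M (\<Pi>\<^sub>M i\<in>I. Q i)) (\<Pi>\<^sub>M j\<in>insert i I. Q j) (\<lambda>(x, X). X(i := x)))"
    using insert by (intro renyi_dual_distr renyi_dual_pair a) auto
  \<comment> \<open>\<open>distr\<close> depends on its target only through the space and the
    measurable sets, and these agree for the products of the \<open>P j\<close> and of the
    \<open>Q j\<close>. With the target exchanged, the left measure is recognised as the product of
    the \<open>P j\<close>.\<close>
  also have "distr (P i \<Otimes>\<^sub>M (\<Pi>\<^sub>M i\<in>I. P i)) (\<Pi>\<^sub>M j\<in>insert i I. Q j) (\<lambda>(x, X). X(i := x)) =
      distr (P i \<Otimes>\<^sub>M (\<Pi>\<^sub>M i\<in>I. P i)) (\<Pi>\<^sub>M j\<in>insert i I. P j) (\<lambda>(x, X). X(i := x))"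
    using s by (intro distr_cong) auto
  also have "\<dots> = (\<Pi>\<^sub>M j\<in>insert i I. P j)"
    using D by (intro distr_pair_PiM_eq_PiM) auto
  also have "distr (Q i \<Otimes>\<^sub>M (\<Pi>\<^sub>M i\<in>I. Q i)) (\<Pi>\<^sub>M j\<in>insert i I. Q j) (\<lambda>(x, X). X(i := x)) = (\<Pi>\<^sub>M j\<in>insert i I. Q j)"
    using D by (intro distr_pair_PiM_eq_PiM) auto
  finally show ?case using insert by simp
qed

section \<open>From the dual form back to the Renyi divergence\<close>

lemma renyi_divergence_le:
  assumes a: "\<alpha> > 1" and \<rho>: "\<rho> \<ge> 0" and d: "renyi_dual \<alpha> \<rho> P Q"
  shows "renyi_divergence \<alpha> P Q \<le> ereal (\<rho> * \<alpha>)"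
proof -
  note PQ = renyi_dualD[OF d]
  interpret P: prob_space P by fact
  interpret Q: prob_space Q by fact
  have sp: "space P = space Q" using PQ(3) by (rule sets_eq_imp_space_eq)
  define \<theta> where "\<theta> = 1 - 1 / \<alpha>"
  have t: "0 < \<theta>" "\<theta> < 1" "\<alpha> * \<theta> = \<alpha> - 1" "1 - \<theta> = 1 / \<alpha>" using a by (auto simp: \<theta>_def field_simps)
  define b where "b = exp ((\<alpha> - 1) * \<rho>)"
  have b: "b > 0" "b powr \<alpha> = exp (\<alpha> * (\<alpha> - 1) * \<rho>)"
    by (auto simp: b_def powr_def ac_simps)
  have dual: "(\<integral>x. h x powr \<theta> \<partial>P) \<le> b * (\<integral>x. h x \<partial>Q) powr \<theta>"
    if "h \<in> borel_measurable Q" "\<And>x. x \<in> space Q \<Longrightarrow> 0 \<le> h x \<and> h x \<le> 1" for h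
    using d that by (auto simp: renyi_dual_def \<theta>_def b_def)
  \<comment> \<open>The indicator of a \<open>Q\<close>-null set is an admissible test function,
    equals its own \<theta>-th power and makes the right side zero.\<close>
  have ac: "absolutely_continuous Q P"
    unfolding absolutely_continuous_def
  proof
    fix A assume A: "A \<in> null_sets Q"
    then have AQ: "A \<in> sets Q" "emeasure Q A = 0" by auto
    have "(\<integral>x. indicator A x powr \<theta> \<partial>P) \<le> b * (\<integral>x. indicator A x \<partial>Q) powr \<theta>"
      using AQ(1) by (intro dual) (auto simp: indicator_def)
    also have "(\<integral>x. indicator A x \<partial>Q) = (0::real)"
      using AQ by (simp add: Q.emeasure_eq_measure)
    also have "(\<lambda>x. indicator A x powr \<theta>) = (indicator A :: _ \<Rightarrow> real)"
      by (auto simp: indicator_def)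
    finally have "measure P A = 0" using AQ PQ(3) by (simp add: measure_le_0_iff)
    then show "A \<in> null_sets P" using AQ PQ(3) by (auto simp: P.emeasure_eq_measure)
  qed
  define f where "f x = enn2real (RN_deriv Q P x)" for x
  have f [measurable]: "f \<in> borel_measurable Q" unfolding f_def by measurable
  have f0: "f x \<ge> 0" for x by (simp add: f_def)
  have fin: "AE x in Q. RN_deriv Q P x = ennreal (f x)"
    using Q.RN_deriv_finite[OF P.sigma_finite_measure_axioms ac PQ(3)]
    by eventually_elim (auto simp: f_def less_top ennreal_enn2real_if)
  have dens: "P = density Q (\<lambda>x. ennreal (f x))"
    using Q.density_RN_deriv[OF ac PQ(3)] density_cong[OF _ _ fin] by simp
  define I where "I = (\<integral>\<^sup>+x. ennreal (f x powr \<alpha>) \<partial>Q)"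
  \<comment> \<open>The case of equality in Hoelder's inequality suggests the test function
    \<open>f powr \<alpha>\<close>, which may be unbounded. Truncating \<open>f\<close> at
    \<open>n\<close> makes it bounded and gives finite moments, which can be cancelled; monotone
    convergence removes the truncation.\<close>
  define J where "J n = (\<integral>\<^sup>+x. ennreal (min (f x) (real n) powr \<alpha>) \<partial>Q)" for n :: nat
  have J: "J n \<le> ennreal (b powr \<alpha>)" if n: "n > 0" for n
  proof -
    have [measurable]: "(\<lambda>x. min (f x) (real n)) \<in> borel_measurable Q" by measurable
    let ?m = "\<lambda>x. min (f x) (real n)"
    have m: "0 \<le> ?m x" "?m x \<le> n" "?m x \<le> f x" for x using f0[of x] by auto
    have mn: "?m x powr \<alpha> \<le> real n powr \<alpha>" for x using m a by (intro powr_mono2) auto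
    have i1: "integrable Q (\<lambda>x. ?m x powr \<alpha>)"
      using mn by (intro Q.integrable_const_bound[where B = "real n powr \<alpha>"]) auto
    define j where "j = (\<integral>x. ?m x powr \<alpha> \<partial>Q)"
    have j0: "j \<ge> 0" unfolding j_def by (intro Bochner_Integration.integral_nonneg) auto
    have Jj: "J n = ennreal j" unfolding J_def j_def by (rule nn_integral_eq_integral[OF i1]) auto
    have fint: "integrable Q f"
    proof (rule integrableI_bounded)
      have "(\<integral>\<^sup>+x. ennreal (norm (f x)) \<partial>Q) = emeasure (density Q (\<lambda>x. ennreal (f x))) (space Q)"
        using f0 by (subst emeasure_density) (auto intro!: nn_integral_cong)
      also have "\<dots> = emeasure P (space P)" using dens sp by simp
      also have "\<dots> < \<infinity>" by (simp add: P.emeasure_space_1)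
      finally show "(\<integral>\<^sup>+x. ennreal (norm (f x)) \<partial>Q) < \<infinity>" .
    qed simp
    have pm: "?m x powr \<alpha> = ?m x * ?m x powr (\<alpha> - 1)" for x
      using m(1)[of x] a by (cases "?m x = 0") (auto simp: powr_diff)
    have mn1: "?m x powr (\<alpha> - 1) \<le> real n powr (\<alpha> - 1)" for x using m a by (intro powr_mono2) auto
    have "j \<le> (\<integral>x. f x * ?m x powr (\<alpha> - 1) \<partial>Q)"
      unfolding j_def
    proof (rule integral_mono[OF i1])
      show "integrable Q (\<lambda>x. f x * ?m x powr (\<alpha> - 1))"
      proof (rule Bochner_Integration.integrable_bound)
        show "integrable Q (\<lambda>x. f x * real n powr (\<alpha> - 1))" using fint by simp
      qed (use f0 mn1 in \<open>auto intro!: mult_left_mono simp: abs_mult\<close>)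
      show "?m x powr \<alpha> \<le> f x * ?m x powr (\<alpha> - 1)" for x
        unfolding pm using m by (intro mult_right_mono) auto
    qed
    also have "\<dots> = (\<integral>x. ?m x powr (\<alpha> - 1) \<partial>P)"
      unfolding dens using f0 by (subst integral_density) auto
    \<comment> \<open>Division by \<open>real n powr \<alpha>\<close> brings the test function into
      [0, 1]. As \<alpha> \<theta> = \<alpha> - 1, its \<theta>-th power is the truncated density to
      the power \<alpha> - 1, up to the factor taken out.\<close>
    also have "\<dots> = (\<integral>x. real n powr (\<alpha> - 1) * (?m x powr \<alpha> / real n powr \<alpha>) powr \<theta> \<partial>P)"
      using m a n by (intro Bochner_Integration.integral_cong)
        (auto simp: powr_divide powr_powr t(3))
    also have "\<dots> = real n powr (\<alpha> - 1) * (\<integral>x. (?m x powr \<alpha> / real n powr \<alpha>) powr \<theta> \<partial>P)" by simp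
    also have "\<dots> \<le> real n powr (\<alpha> - 1) * (b * (\<integral>x. ?m x powr \<alpha> / real n powr \<alpha> \<partial>Q) powr \<theta>)"
      using mn n by (intro mult_left_mono dual) auto
    also have "(\<integral>x. ?m x powr \<alpha> / real n powr \<alpha> \<partial>Q) = j / real n powr \<alpha>"
      unfolding j_def by simp
    also have "real n powr (\<alpha> - 1) * (b * (j / real n powr \<alpha>) powr \<theta>) = b * j powr \<theta>"
      using j0 n by (simp add: powr_divide powr_powr t(3))
    finally have le: "j \<le> b * j powr \<theta>" .
    \<comment> \<open>Since \<open>j\<close> is a real number, \<open>j powr \<theta>\<close> can be
      cancelled unless it is 0; what remains on the left is
      \<open>j powr (1 / \<alpha>)\<close>.\<close>
    have "j \<le> b powr \<alpha>"
    proof (cases "j = 0")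
      case False
      then have jp: "j > 0" using j0 by simp
      have "j = j powr \<theta> * j powr (1 - \<theta>)" using jp by (simp flip: powr_add)
      with le have "j powr \<theta> * j powr (1 - \<theta>) \<le> j powr \<theta> * b" by (simp add: mult.commute)
      then have "j powr (1 / \<alpha>) \<le> b" using jp unfolding t(4) by (simp add: mult_le_cancel_left)
      then have "(j powr (1 / \<alpha>)) powr \<alpha> \<le> b powr \<alpha>" using a by (intro powr_mono2) auto
      then show ?thesis using a jp by (simp add: powr_powr)
    qed (use b in simp)
    then show ?thesis unfolding Jj by (intro ennreal_leI)
  qed
  have SUPJ: "I = (SUP n. J n)"
  proof -
    have "I = (\<integral>\<^sup>+x. (SUP n. ennreal (min (f x) (real n) powr \<alpha>)) \<partial>Q)"
      unfolding I_def
    proof (intro nn_integral_cong antisym)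
      fix x
      obtain n where n: "f x \<le> real n" using real_arch_simple by blast
      then have "ennreal (f x powr \<alpha>) = ennreal (min (f x) (real n) powr \<alpha>)" by (simp add: min_absorb1)
      also have "\<dots> \<le> (SUP n. ennreal (min (f x) (real n) powr \<alpha>))" by (rule SUP_upper) simp
      finally show "ennreal (f x powr \<alpha>) \<le> (SUP n. ennreal (min (f x) (real n) powr \<alpha>))" .
      show "(SUP n. ennreal (min (f x) (real n) powr \<alpha>)) \<le> ennreal (f x powr \<alpha>)"
        using a f0 by (intro SUP_least ennreal_leI powr_mono2) auto
    qed
    also have "\<dots> = (SUP n. J n)"
      unfolding J_def
    proof (rule nn_integral_monotone_convergence_SUP)
      show "incseq (\<lambda>n x. ennreal (min (f x) (real n) powr \<alpha>))"
        using a f0 by (intro monoI le_funI ennreal_leI powr_mono2) auto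
    qed measurable
    finally show ?thesis .
  qed
  have Ib: "I \<le> ennreal (b powr \<alpha>)"
    unfolding SUPJ
  proof (rule SUP_least)
    fix n :: nat
    show "J n \<le> ennreal (b powr \<alpha>)"
    \<comment> \<open>The fact \<open>J\<close> divides by a power of \<open>n\<close> and covers
      positive \<open>n\<close> only; passing to \<open>Suc n\<close> includes the term for
      0.\<close>
    proof (rule order_trans)
      show "J n \<le> J (Suc n)"
        unfolding J_def using a f0 by (intro nn_integral_mono ennreal_leI powr_mono2) auto
    qed (rule J, simp)
  qed
  have Ieq: "(\<integral>\<^sup>+x. ennreal (enn2real (RN_deriv Q P x) powr \<alpha>) \<partial>Q) = I"
    by (simp add: I_def f_def)
  have Ifin: "I < \<infinity>" using Ib by (auto intro: le_less_trans)
  have "ln (enn2real I) \<le> \<alpha> * (\<alpha> - 1) * \<rho>"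
  \<comment> \<open>The value 0 is settled by the convention \<open>ln 0 = 0\<close>, because \<rho>
    is nonnegative.\<close>
  proof (cases "enn2real I = 0")
    case False
    then have pos: "enn2real I > 0" by (simp add: less_le)
    have "enn2real I \<le> exp (\<alpha> * (\<alpha> - 1) * \<rho>)" using Ib by (simp add: enn2real_leI b(2))
    with pos have "ln (enn2real I) \<le> ln (exp (\<alpha> * (\<alpha> - 1) * \<rho>))"
      by (subst ln_le_cancel_iff) auto
    then show ?thesis by simp
  qed (use a \<rho> in simp)
  then have "1 / (\<alpha> - 1) * ln (enn2real I) \<le> 1 / (\<alpha> - 1) * (\<alpha> * (\<alpha> - 1) * \<rho>)"
    using a by (intro mult_left_mono) auto
  also have "\<dots> = \<rho> * \<alpha>" using a by simp
  finally show ?thesis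
    using Ifin ac PQ(3) by (simp add: renyi_divergence_def Ieq)
qed

section \<open>Gaussian noise and bounded range\<close>

lemma prob_space_gaussian: "\<sigma> \<ge> 0 \<Longrightarrow> prob_space (gaussian \<mu> \<sigma>)"
  unfolding gaussian_def by (auto intro!: prob_space_return prob_space_normal_density)

lemma sets_gaussian [simp, measurable_cong]: "sets (gaussian \<mu> \<sigma>) = sets borel"
  by (simp add: gaussian_def)

text \<open>As \<open>q\<close> is positive, \<open>p / q\<close> is the density of the first
  measure with respect to the second, and its \<alpha>-th moment can be computed over the common
  reference measure \<open>M\<close>.\<close>

lemma renyi_dual_density:
  fixes p q :: "'o \<Rightarrow> real"
  assumes a: "\<alpha> > 1"
    and [measurable]: "p \<in> borel_measurable M" "q \<in> borel_measurable M"
    and pos: "\<And>x. x \<in> space M \<Longrightarrow> p x \<ge> 0" "\<And>x. x \<in> space M \<Longrightarrow> q x > 0"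
    and P: "prob_space (density M (\<lambda>x. ennreal (p x)))" and Q: "prob_space (density M (\<lambda>x. ennreal (q x)))"
    and I: "(\<integral>\<^sup>+x. ennreal (q x * (p x / q x) powr \<alpha>) \<partial>M) \<le> ennreal (exp (\<alpha> * (\<alpha> - 1) * \<rho>))"
  shows "renyi_dual \<alpha> \<rho> (density M (\<lambda>x. ennreal (p x))) (density M (\<lambda>x. ennreal (q x)))"
proof (rule renyi_dualI_nn_integral[OF a Q P, where f = "\<lambda>x. p x / q x"])
  show "density M (\<lambda>x. ennreal (p x)) =
      density (density M (\<lambda>x. ennreal (q x))) (\<lambda>x. ennreal (p x / q x))"
    using pos by (subst density_density_eq)
      (auto intro!: density_cong AE_I2 simp: less_imp_le less_imp_neq[symmetric] simp flip: ennreal_mult)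
  have "(\<integral>\<^sup>+x. ennreal ((p x / q x) powr \<alpha>) \<partial>density M (\<lambda>x. ennreal (q x))) =
      (\<integral>\<^sup>+x. ennreal (q x * (p x / q x) powr \<alpha>) \<partial>M)"
    using pos by (subst nn_integral_density)
      (auto intro!: nn_integral_cong simp: ennreal_mult less_imp_le)
  then show "(\<integral>\<^sup>+x. ennreal ((p x / q x) powr \<alpha>) \<partial>density M (\<lambda>x. ennreal (q x)))
      \<le> ennreal (exp (\<alpha> * (\<alpha> - 1) * \<rho>))"
    using I by simp
qed (use pos in \<open>auto simp: less_imp_le\<close>)

lemma renyi_dual_gaussian:
  assumes a: "\<alpha> > 1" and \<sigma>: "\<sigma> > 0"
  shows "renyi_dual \<alpha> ((\<mu> - \<nu>)\<^sup>2 / (2 * \<sigma>\<^sup>2)) (gaussian \<mu> \<sigma>) (gaussian \<nu> \<sigma>)"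
proof -
  \<comment> \<open>Completing the square: the integrand of the moment is a constant times a normal
    density with mean \<alpha> \<mu> - (\<alpha> - 1) \<nu>. This constant is therefore the moment,
    and it is exactly the required bound.\<close>
  have eq: "normal_density \<nu> \<sigma> x * (normal_density \<mu> \<sigma> x / normal_density \<nu> \<sigma> x) powr \<alpha> =
      exp (\<alpha> * (\<alpha> - 1) * ((\<mu> - \<nu>)\<^sup>2 / (2 * \<sigma>\<^sup>2))) * normal_density (\<alpha> * \<mu> - (\<alpha> - 1) * \<nu>) \<sigma> x" for x
  proof -
    have "(normal_density \<mu> \<sigma> x / normal_density \<nu> \<sigma> x) powr \<alpha> =
        exp (\<alpha> * ((x - \<nu>)\<^sup>2 - (x - \<mu>)\<^sup>2) / (2 * \<sigma>\<^sup>2))"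
    proof -
      have "normal_density \<mu> \<sigma> x / normal_density \<nu> \<sigma> x =
          exp (- (x - \<mu>)\<^sup>2 / (2 * \<sigma>\<^sup>2)) / exp (- (x - \<nu>)\<^sup>2 / (2 * \<sigma>\<^sup>2))"
        using \<sigma> by (simp add: normal_density_def)
      also have "\<dots> = exp (- (x - \<mu>)\<^sup>2 / (2 * \<sigma>\<^sup>2) - - (x - \<nu>)\<^sup>2 / (2 * \<sigma>\<^sup>2))"
        by (rule exp_diff[symmetric])
      also have "- (x - \<mu>)\<^sup>2 / (2 * \<sigma>\<^sup>2) - - (x - \<nu>)\<^sup>2 / (2 * \<sigma>\<^sup>2) = ((x - \<nu>)\<^sup>2 - (x - \<mu>)\<^sup>2) / (2 * \<sigma>\<^sup>2)"
        by (simp add: diff_divide_distrib)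
      finally show ?thesis by (simp only: exp_powr_real) (simp add: mult.commute)
    qed
    moreover have "- (x - \<nu>)\<^sup>2 / (2 * \<sigma>\<^sup>2) + \<alpha> * ((x - \<nu>)\<^sup>2 - (x - \<mu>)\<^sup>2) / (2 * \<sigma>\<^sup>2) =
      \<alpha> * (\<alpha> - 1) * ((\<mu> - \<nu>)\<^sup>2 / (2 * \<sigma>\<^sup>2)) + - (x - (\<alpha> * \<mu> - (\<alpha> - 1) * \<nu>))\<^sup>2 / (2 * \<sigma>\<^sup>2)"
    proof -
      have "- (x - \<nu>)\<^sup>2 + \<alpha> * ((x - \<nu>)\<^sup>2 - (x - \<mu>)\<^sup>2) =
          \<alpha> * (\<alpha> - 1) * (\<mu> - \<nu>)\<^sup>2 - (x - (\<alpha> * \<mu> - (\<alpha> - 1) * \<nu>))\<^sup>2"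
        by (simp add: power2_eq_square algebra_simps)
      then have "(- (x - \<nu>)\<^sup>2 + \<alpha> * ((x - \<nu>)\<^sup>2 - (x - \<mu>)\<^sup>2)) / (2 * \<sigma>\<^sup>2) =
          (\<alpha> * (\<alpha> - 1) * (\<mu> - \<nu>)\<^sup>2 - (x - (\<alpha> * \<mu> - (\<alpha> - 1) * \<nu>))\<^sup>2) / (2 * \<sigma>\<^sup>2)"
        by simp
      then show ?thesis by (simp add: add_divide_distrib diff_divide_distrib)
    qed
    ultimately have "exp (- (x - \<nu>)\<^sup>2 / (2 * \<sigma>\<^sup>2)) * (normal_density \<mu> \<sigma> x / normal_density \<nu> \<sigma> x) powr \<alpha> =
        exp (\<alpha> * (\<alpha> - 1) * ((\<mu> - \<nu>)\<^sup>2 / (2 * \<sigma>\<^sup>2))) * exp (- (x - (\<alpha> * \<mu> - (\<alpha> - 1) * \<nu>))\<^sup>2 / (2 * \<sigma>\<^sup>2))"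
      by (simp only: exp_add[symmetric])
    moreover have "k * A * B = C * (k * D)" if "A * B = C * D" for k A B C D :: real
      using that by (metis mult.assoc mult.left_commute)
    ultimately show ?thesis
      unfolding normal_density_def[of \<nu> \<sigma> x] normal_density_def[of "\<alpha> * \<mu> - (\<alpha> - 1) * \<nu>" \<sigma> x]
      by blast
  qed
  have "(\<integral>\<^sup>+x. ennreal (normal_density \<nu> \<sigma> x * (normal_density \<mu> \<sigma> x / normal_density \<nu> \<sigma> x) powr \<alpha>) \<partial>lborel) =
      ennreal (exp (\<alpha> * (\<alpha> - 1) * ((\<mu> - \<nu>)\<^sup>2 / (2 * \<sigma>\<^sup>2)))) *
      (\<integral>\<^sup>+x. ennreal (normal_density (\<alpha> * \<mu> - (\<alpha> - 1) * \<nu>) \<sigma> x) \<partial>lborel)"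
    unfolding eq by (simp add: ennreal_mult nn_integral_cmult)
  also have "(\<integral>\<^sup>+x. ennreal (normal_density (\<alpha> * \<mu> - (\<alpha> - 1) * \<nu>) \<sigma> x) \<partial>lborel) = 1"
    using prob_space.emeasure_space_1[OF prob_space_normal_density[OF \<sigma>]]
    by (subst (asm) emeasure_density) auto
  finally have I: "(\<integral>\<^sup>+x. ennreal (normal_density \<nu> \<sigma> x * (normal_density \<mu> \<sigma> x / normal_density \<nu> \<sigma> x) powr \<alpha>) \<partial>lborel)
      \<le> ennreal (exp (\<alpha> * (\<alpha> - 1) * ((\<mu> - \<nu>)\<^sup>2 / (2 * \<sigma>\<^sup>2))))" by simp
  show ?thesis
    unfolding gaussian_def using \<sigma>
    by (simp, intro renyi_dual_density a I prob_space_normal_density normal_density_pos) auto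
qed

text \<open>The standard deviation solves \<Delta>^2 / (2 \<sigma>^2) = \<rho>. Sensitivity 0 is
  separate: the noise is then a point mass without a density, but the two means agree.\<close>

lemma renyi_dual_gaussian_sensitivity:
  assumes a: "\<alpha> > 1" and \<Delta>: "\<Delta> \<ge> 0" and \<rho>: "\<rho> > 0" and le: "\<bar>\<mu> - \<nu>\<bar> \<le> \<Delta>"
  shows "renyi_dual \<alpha> \<rho> (gaussian \<mu> (\<Delta> / sqrt (2 * \<rho>))) (gaussian \<nu> (\<Delta> / sqrt (2 * \<rho>)))"
proof (cases "\<Delta> = 0")
  case True
  then have "\<mu> = \<nu>" using le by simp
  moreover have "renyi_dual \<alpha> 0 (gaussian \<nu> (\<Delta> / sqrt (2 * \<rho>))) (gaussian \<nu> (\<Delta> / sqrt (2 * \<rho>)))"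
    using \<Delta> \<rho> by (intro renyi_dual_refl a prob_space_gaussian) auto
  ultimately show ?thesis using renyi_dual_mono[OF _ _ a] \<rho> by (metis less_imp_le)
next
  case False
  then have \<Delta>p: "\<Delta> > 0" using \<Delta> by simp
  define \<sigma> where "\<sigma> = \<Delta> / sqrt (2 * \<rho>)"
  have \<sigma>: "\<sigma> > 0" using \<Delta>p \<rho> by (simp add: \<sigma>_def)
  have "(\<mu> - \<nu>)\<^sup>2 / (2 * \<sigma>\<^sup>2) \<le> \<Delta>\<^sup>2 / (2 * \<sigma>\<^sup>2)"
    using le \<Delta> by (intro divide_right_mono) (auto simp: abs_le_square_iff[symmetric])
  also have "\<dots> = \<rho>" using \<Delta>p \<rho> by (simp add: \<sigma>_def power_divide)
  finally show ?thesis
    unfolding \<sigma>_def[symmetric] using renyi_dual_mono[OF renyi_dual_gaussian[OF a \<sigma>] _ a] by blast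
qed

section \<open>Hoeffding's lemma and privacy losses of bounded range\<close>

lemma (in prob_space) Hoeffding_exp:
  fixes f :: "'a \<Rightarrow> real"
  assumes [measurable]: "f \<in> borel_measurable M"
    and f: "\<And>x. x \<in> space M \<Longrightarrow> a \<le> f x \<and> f x \<le> b" and l: "l > 0"
  shows "(\<integral>\<^sup>+x. ennreal (exp (l * f x)) \<partial>M) \<le> ennreal (exp (l * expectation f + l\<^sup>2 * (b - a)\<^sup>2 / 8))"
proof -
  interpret interval_bounded_random_variable M f a b
    by unfold_locales (use f in auto)
  have "(\<integral>\<^sup>+x. ennreal (exp (l * f x)) \<partial>M) =
      (\<integral>\<^sup>+x. ennreal (exp (l * expectation f)) * ennreal (exp (l * (f x - expectation f))) \<partial>M)"
    by (intro nn_integral_cong) (auto simp: algebra_simps simp flip: ennreal_mult exp_add)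
  also have "\<dots> = ennreal (exp (l * expectation f)) * (\<integral>\<^sup>+x. ennreal (exp (l * (f x - expectation f))) \<partial>M)"
    by (rule nn_integral_cmult) measurable
  also have "\<dots> \<le> ennreal (exp (l * expectation f)) * ennreal (exp (l\<^sup>2 * (b - a)\<^sup>2 / 8))"
    using Hoeffdings_lemma_nn_integral[OF l] by (intro mult_left_mono) auto
  also have "\<dots> = ennreal (exp (l * expectation f + l\<^sup>2 * (b - a)\<^sup>2 / 8))"
    by (simp add: exp_add ennreal_mult)
  finally show ?thesis .
qed

text \<open>The optimal constant for bounded-range mechanisms: Hoeffding's lemma applied to the inverse
  likelihood ratio, whose expectation is 1, bounds the Kullback-Leibler divergence by
  \<open>\<epsilon>\<^sup>2 / 8\<close>, and a second application bounds the exponential moment of the privacy loss.\<close>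

lemma renyi_dual_bounded_range:
  fixes L :: "'o \<Rightarrow> real"
  assumes a: "\<alpha> > 1" and Q: "prob_space Q" and P: "prob_space P"
    and L [measurable]: "L \<in> borel_measurable Q"
    and dens: "P = density Q (\<lambda>x. ennreal (exp (L x)))"
    and range: "\<And>x. x \<in> space Q \<Longrightarrow> c \<le> L x \<and> L x \<le> c + \<epsilon>"
  shows "renyi_dual \<alpha> (\<epsilon>\<^sup>2 / 8) P Q"
proof (rule renyi_dualI_nn_integral[OF a Q P _ _ dens])
  interpret P: prob_space P by fact
  interpret Q: prob_space Q by fact
  have mP: "borel_measurable P = borel_measurable Q" using dens by auto
  have sp: "space P = space Q" by (simp add: dens)
  define K where "K = P.expectation L"
  have "(\<integral>\<^sup>+x. ennreal (exp (1 * - L x)) \<partial>P) \<le>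
      ennreal (exp (1 * P.expectation (\<lambda>x. - L x) + 1\<^sup>2 * (- c - (- c - \<epsilon>))\<^sup>2 / 8))"
  proof (rule P.Hoeffding_exp)
    show "- c - \<epsilon> \<le> - L x \<and> - L x \<le> - c" if "x \<in> space P" for x
      using range[of x] that by (simp add: sp)
  qed (auto simp: mP)
  also have "(\<integral>\<^sup>+x. ennreal (exp (1 * - L x)) \<partial>P) = (\<integral>\<^sup>+x. 1 \<partial>Q)"
    unfolding dens by (subst nn_integral_density)
      (auto intro!: nn_integral_cong simp flip: ennreal_mult exp_add)
  also have "\<dots> = 1" by (simp add: Q.emeasure_space_1)
  finally have "1 \<le> exp (- K + \<epsilon>\<^sup>2 / 8)"
    by (simp add: K_def)
  then have K: "K \<le> \<epsilon>\<^sup>2 / 8" by simp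
  \<comment> \<open>One factor of the density turns the \<alpha>-th moment under \<open>Q\<close>
    into an exponential moment of order \<alpha> - 1 under \<open>P\<close>. The mean contributes
    (\<alpha> - 1) \<epsilon>^2 / 8 and the fluctuation (\<alpha> - 1)^2 \<epsilon>^2 / 8; together
    they are \<alpha> (\<alpha> - 1) \<epsilon>^2 / 8.\<close>
  have "(\<integral>\<^sup>+x. ennreal (exp (L x) powr \<alpha>) \<partial>Q) = (\<integral>\<^sup>+x. ennreal (exp ((\<alpha> - 1) * L x)) \<partial>P)"
    unfolding dens by (subst nn_integral_density)
      (auto intro!: nn_integral_cong simp: powr_def algebra_simps simp flip: ennreal_mult exp_add)
  also have "\<dots> \<le> ennreal (exp ((\<alpha> - 1) * K + (\<alpha> - 1)\<^sup>2 * (c + \<epsilon> - c)\<^sup>2 / 8))"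
    unfolding K_def by (rule P.Hoeffding_exp) (use range a in \<open>auto simp: mP sp\<close>)
  also have "\<dots> \<le> ennreal (exp (\<alpha> * (\<alpha> - 1) * (\<epsilon>\<^sup>2 / 8)))"
  proof -
    have "(\<alpha> - 1) * K \<le> (\<alpha> - 1) * (\<epsilon>\<^sup>2 / 8)" using K a by (intro mult_left_mono) auto
    then show ?thesis by (auto intro!: ennreal_leI simp: power2_eq_square field_simps)
  qed
  finally show "(\<integral>\<^sup>+x. ennreal (exp (L x) powr \<alpha>) \<partial>Q) \<le> ennreal (exp (\<alpha> * (\<alpha> - 1) * (\<epsilon>\<^sup>2 / 8)))" .
qed auto

section \<open>Sensitivity\<close>

lemma abs_num_of_le_agg_max:
  assumes "valid_query S q" "t \<in> tuples S"
  shows "\<bar>num_of S (t (agg_attr q))\<bar> \<le> agg_max S q"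
proof -
  have "t (agg_attr q) \<in> adom S (agg_attr q)"
    using assms by (auto simp: valid_query_def tuples_def)
  moreover obtain a where "\<forall>b\<in>adom S (agg_attr q). \<bar>num_of S b\<bar> \<le> \<bar>num_of S a\<bar>"
    using assms(1) by (auto simp: valid_query_def)
  ultimately show ?thesis
    unfolding agg_max_def by (intro cSup_upper bdd_aboveI2[where M = "\<bar>num_of S a\<bar>"]) auto
qed

lemma agg_max_nonneg: "valid_query S q \<Longrightarrow> agg_max S q \<ge> 0"
  unfolding agg_max_def valid_query_def
  by (elim conjE bexE, rule cSup_upper2) (auto intro!: bdd_aboveI2)

lemma neighboring_cases:
  assumes "neighboring D D'"
  obtains t where "D' = add_mset t D" | t where "D = add_mset t D'"
  using assms by (auto simp: neighboring_def)

text \<open>A numerator growing by at most 1 gives the upper bound over the old denominator. A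
  growing denominator lowers the ratio by at most 1 / (M + 1), because m (M' - M) is at most m, and
  m is at most M.\<close>

lemma ratio_change:
  fixes m m' M M' :: real
  assumes "0 \<le> m" "m \<le> m'" "m' \<le> m + 1" "M \<le> M'" "M' \<le> M + 1" "m \<le> M" "m' \<le> M'"
  shows "\<bar>m' / (M' + 1) - m / (M + 1)\<bar> \<le> 1 / (M + 1)"
proof -
  have "m' / (M' + 1) \<le> (m + 1) / (M + 1)"
    using assms by (intro frac_le) auto
  moreover have "(m - 1) / (M + 1) \<le> m / (M' + 1)"
  proof -
    have "(m - 1) * (M' + 1) \<le> m * (M + 1)"
    proof -
      have "m * (M' - M) \<le> m * 1" using assms by (intro mult_left_mono) auto
      then show ?thesis using assms by (simp add: algebra_simps)
    qed
    then show ?thesis using assms by (simp add: divide_simps)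
  qed
  moreover have "m / (M' + 1) \<le> m' / (M' + 1)"
    using assms by (intro divide_right_mono) auto
  ultimately show ?thesis
    by (simp add: abs_le_iff add_divide_distrib diff_divide_distrib)
qed

text \<open>Product rule: \<open>v\<close> times a factor of at most 1 contributes at most A, and
  \<open>u\<close> times the change of the factor at most 2 A M / (M + 1). The denominator M + 1 is
  what tames \<open>u\<close>, which may grow with the group sizes.\<close>

lemma scaled_influence_change:
  fixes A u v m m' M M' :: real
  assumes "0 \<le> m" "m \<le> m'" "m' \<le> m + 1" "M \<le> M'" "M' \<le> M + 1" "m \<le> M" "m' \<le> M'"
    and "A \<ge> 0" "\<bar>v\<bar> \<le> A" "\<bar>u\<bar> \<le> 2 * A * M"
  shows "\<bar>(u + v) * (m' / (M' + 1)) - u * (m / (M + 1))\<bar> \<le> 4 * A"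
proof -
  have "(u + v) * (m' / (M' + 1)) - u * (m / (M + 1)) =
      v * (m' / (M' + 1)) + u * (m' / (M' + 1) - m / (M + 1))"
    by (simp add: algebra_simps add_divide_distrib)
  moreover have "\<bar>v * (m' / (M' + 1))\<bar> \<le> A * 1"
    unfolding abs_mult using assms by (intro mult_mono) (auto simp: divide_simps)
  moreover have "\<bar>u * (m' / (M' + 1) - m / (M + 1))\<bar> \<le> (2 * A * M) * (1 / (M + 1))"
    unfolding abs_mult using assms ratio_change[of m m' M M'] by (intro mult_mono) auto
  moreover have "(2 * A * M) * (1 / (M + 1)) \<le> 2 * A"
    using assms by (simp add: divide_simps algebra_simps)
  ultimately show ?thesis using assms by linarith
qed

text \<open>Multiplied by the new size, the change of the average is \<open>v\<close> minus the old
  average, and both are at most A in absolute value. For an empty bag the old average is 0 by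
  division by zero.\<close>

lemma average_change:
  fixes A s v :: real and n :: nat
  assumes "A \<ge> 0" "\<bar>v\<bar> \<le> A" "\<bar>s\<bar> \<le> A * n"
  shows "\<bar>(s + v) / (real n + 1) - s / real n\<bar> * (real n + 1) \<le> 2 * A"
proof (cases "n = 0")
  case False
  then have n: "real n > 0" by simp
  have "\<bar>(s + v) / (real n + 1) - s / real n\<bar> * (real n + 1) =
      \<bar>((s + v) / (real n + 1) - s / real n) * (real n + 1)\<bar>"
    by (simp add: abs_mult)
  also have "((s + v) / (real n + 1) - s / real n) * (real n + 1) = v - s / real n"
    using n by (simp add: divide_simps) (simp add: algebra_simps)
  also have "\<bar>v - s / real n\<bar> \<le> A + \<bar>s\<bar> / real n"
    using assms n abs_triangle_ineq4[of v "s / real n"] by simp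
  also have "\<bar>s\<bar> / real n \<le> A"
    using assms n by (simp add: divide_simps mult.commute)
  finally show ?thesis by simp
qed (use assms in simp)

text \<open>Averages over small bags are unstable, but the multiplier m' is at most the sizes n and
  n', so each of the two changes costs at most 2 A. The bound 4 A on \<open>u\<close> comes from the
  four averages it will stand for, and m moves by at most 1.\<close>

lemma average_influence_change:
  fixes A u \<delta>\<^sub>1 \<delta>\<^sub>2 m m' n n' :: real
  assumes "0 \<le> m" "m \<le> m'" "m' \<le> m + 1" "m' \<le> n" "m' \<le> n'" "A \<ge> 0"
    and "\<bar>\<delta>\<^sub>1\<bar> * n \<le> 2 * A" "\<bar>\<delta>\<^sub>2\<bar> * n' \<le> 2 * A" "\<bar>u\<bar> \<le> 4 * A"
  shows "\<bar>(u + \<delta>\<^sub>1 - \<delta>\<^sub>2) * m' - u * m\<bar> \<le> 16 * A"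
proof -
  have "(u + \<delta>\<^sub>1 - \<delta>\<^sub>2) * m' - u * m = \<delta>\<^sub>1 * m' - \<delta>\<^sub>2 * m' + u * (m' - m)"
    by (simp add: algebra_simps)
  moreover have "\<bar>\<delta>\<^sub>1 * m'\<bar> \<le> 2 * A"
    unfolding abs_mult using assms mult_left_mono[of m' n "\<bar>\<delta>\<^sub>1\<bar>"] by auto
  moreover have "\<bar>\<delta>\<^sub>2 * m'\<bar> \<le> 2 * A"
    unfolding abs_mult using assms mult_left_mono[of m' n' "\<bar>\<delta>\<^sub>2\<bar>"] by auto
  moreover have "\<bar>u * (m' - m)\<bar> \<le> (4 * A) * 1"
    unfolding abs_mult using assms by (intro mult_mono) auto
  ultimately show ?thesis using assms by linarith
qed

lemma abs_sum_mset_le: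
  fixes w :: "'b \<Rightarrow> real"
  assumes "\<And>t. t \<in># B \<Longrightarrow> \<bar>w t\<bar> \<le> A"
  shows "\<bar>\<Sum>t\<in>#B. w t\<bar> \<le> A * real (size B)"
  using assms
proof (induction B)
  case (add t B)
  then have "\<bar>w t\<bar> \<le> A" "\<bar>\<Sum>t\<in>#B. w t\<bar> \<le> A * real (size B)" by auto
  then show ?case by (simp add: algebra_simps)
qed simp

text \<open>The difference is a sum over the dropped elements only. This limits the intervention
  change by the group sizes.\<close>

lemma abs_sum_mset_diff_le:
  fixes w :: "'b \<Rightarrow> real"
  assumes w: "\<And>t. t \<in># B \<Longrightarrow> \<bar>w t\<bar> \<le> A" and "A \<ge> 0"
  shows "\<bar>(\<Sum>t\<in>#B. w t) - (\<Sum>t\<in>#filter_mset P B. w t)\<bar> \<le> A * real (size B)"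
proof -
  have "(\<Sum>t\<in>#B. w t) - (\<Sum>t\<in>#filter_mset P B. w t) = (\<Sum>t\<in>#filter_mset (\<lambda>x. \<not> P x) B. w t)"
    by (induction B) auto
  also have "\<bar>\<dots>\<bar> \<le> A * real (size (filter_mset (\<lambda>x. \<not> P x) B))"
    using w by (intro abs_sum_mset_le) auto
  also have "\<dots> \<le> A * real (size B)"
    using assms by (intro mult_left_mono) (auto intro: size_filter_mset_lesseq)
  finally show ?thesis .
qed

lemma abs_divide_size_le:
  assumes "\<bar>s\<bar> \<le> A * real n" "A \<ge> 0"
  shows "\<bar>s / real n\<bar> \<le> A"
  using assms by (cases "n = 0") (auto simp: divide_simps)

lemma group_of_without:
  "group_of q x (without p D) = filter_mset (\<lambda>t. \<not> p t) (group_of q x D)"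
  by (simp add: group_of_def without_def filter_filter_mset conj_commute conj_ac)

text \<open>Antisymmetry lets a tuple added to the second group be treated as one added to the
  first.\<close>

lemma influence_swap: "influence S q agg (y, x) D p = - influence S q agg (x, y) D p"
  by (simp add: influence_def intervention_change_def Let_def min.commute max.commute algebra_simps
      split: aggregate.split)

lemma group_of_add:
  "group_of q x (add_mset t D) =
    (if where_cond q t \<and> t (gb_attr q) = x then add_mset t (group_of q x D) else group_of q x D)"
  by (simp add: group_of_def)

lemma databasesD: "D \<in> databases S \<Longrightarrow> t \<in># D \<Longrightarrow> t \<in> tuples S"
  by (auto simp: databases_def)

text \<open>Counts and sums are additive and share one argument, with tuple weights 1 or attribute
  values; for averages the group-size factor provides the stability. Only the first group changes,
  and its remainder after the intervention changes only if the new tuple violates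
  \<open>p\<close>.\<close>

lemma influence_add_tuple_fst:
  assumes V: "valid_query S q" and D: "add_mset t D \<in> databases S" and xy: "x \<noteq> y"
    and t: "where_cond q t" "t (gb_attr q) = x"
  shows "\<bar>influence S q agg (x, y) (add_mset t D) p - influence S q agg (x, y) D p\<bar>
    \<le> influence_sensitivity S q agg"
proof -
  define A where "A = agg_max S q"
  have A0: "A \<ge> 0" unfolding A_def by (rule agg_max_nonneg[OF V])
  define G where "G = group_of q x D"
  define H where "H = group_of q y D"
  define G' where "G' = filter_mset (\<lambda>t. \<not> p t) G"
  define H' where "H' = filter_mset (\<lambda>t. \<not> p t) H"
  define w where "w t = num_of S (t (agg_attr q))" for t :: "'a \<Rightarrow> 'b"
  have w: "\<bar>w t\<bar> \<le> A" "\<And>t. t \<in># G \<Longrightarrow> \<bar>w t\<bar> \<le> A" "\<And>t. t \<in># H \<Longrightarrow> \<bar>w t\<bar> \<le> A"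
    using abs_num_of_le_agg_max[OF V databasesD[OF D]]
    by (auto simp: w_def A_def G_def H_def group_of_def)
  have g: "group_of q x (add_mset t D) = add_mset t G" "group_of q y (add_mset t D) = H"
    using xy t by (auto simp: group_of_add G_def H_def)
  define e where "e = (if p t then 0 else 1 :: nat)"
  define gp where "gp = filter_mset (\<lambda>t. \<not> p t) (add_mset t G)"
  have gp: "gp = (if p t then G' else add_mset t G')" by (simp add: G'_def gp_def)
  have size_gp: "size gp = size G' + e" by (simp add: gp e_def)
  have le: "size G' \<le> size G" "size H' \<le> size H"
    by (auto simp: G'_def H'_def intro: size_filter_mset_lesseq)
  define m where "m = real (min (size G') (size H'))"
  define m' where "m' = real (min (size gp) (size H'))"
  define M where "M = real (max (size G) (size H))"
  define M' where "M' = real (max (Suc (size G)) (size H))"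
  have mM: "0 \<le> m" "m \<le> m'" "m' \<le> m + 1" "M \<le> M'" "M' \<le> M + 1" "m \<le> M" "m' \<le> M'"
    using le by (auto simp: m_def m'_def M_def M'_def size_gp e_def)
  have infl: "influence S q agg (x, y) (add_mset t D) p =
      ((agg_bag S q agg (add_mset t G) - agg_bag S q agg H) - (agg_bag S q agg gp - agg_bag S q agg H')) *
      (case agg of AVG_agg \<Rightarrow> m' | _ \<Rightarrow> m' / (M' + 1))"
    "influence S q agg (x, y) D p =
      ((agg_bag S q agg G - agg_bag S q agg H) - (agg_bag S q agg G' - agg_bag S q agg H')) *
      (case agg of AVG_agg \<Rightarrow> m | _ \<Rightarrow> m / (M + 1))"
    unfolding influence_def intervention_change_def case_prod_conv Let_def group_of_without g
      G_def[symmetric] H_def[symmetric] G'_def[symmetric] H'_def[symmetric] gp_def[symmetric]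
      m_def m'_def M_def M'_def size_add_mset by simp_all
  have linear: "\<bar>(((\<Sum>t\<in>#add_mset t G. f t) - (\<Sum>t\<in>#H. f t)) - ((\<Sum>t\<in>#gp. f t) - (\<Sum>t\<in>#H'. f t))) * (m' / (M' + 1)) -
      (((\<Sum>t\<in>#G. f t) - (\<Sum>t\<in>#H. f t)) - ((\<Sum>t\<in>#G'. f t) - (\<Sum>t\<in>#H'. f t))) * (m / (M + 1))\<bar> \<le> 4 * B"
    if B: "B \<ge> 0" and f: "\<bar>f t\<bar> \<le> B" "\<And>t. t \<in># G \<Longrightarrow> \<bar>f t\<bar> \<le> B" "\<And>t. t \<in># H \<Longrightarrow> \<bar>f t\<bar> \<le> B" for f B
  proof -
    define u where "u = (((\<Sum>t\<in>#G. f t) - (\<Sum>t\<in>#H. f t)) - ((\<Sum>t\<in>#G'. f t) - (\<Sum>t\<in>#H'. f t)))"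
    \<comment> \<open>A new tuple satisfying \<open>p\<close> enters the full sum but not the
      remaining one and changes the difference by its weight; otherwise it enters both and
      cancels.\<close>
    define v where "v = (if p t then f t else 0)"
    have "B * real (size G) \<le> B * M" "B * real (size H) \<le> B * M"
      using B by (auto intro!: mult_left_mono simp: M_def)
    then have "\<bar>u\<bar> \<le> 2 * B * M"
      using abs_sum_mset_diff_le[of G f B "\<lambda>t. \<not> p t"] abs_sum_mset_diff_le[of H f B "\<lambda>t. \<not> p t"] B f
      unfolding u_def G'_def H'_def by auto
    moreover have "\<bar>v\<bar> \<le> B" using f B by (simp add: v_def)
    ultimately have "\<bar>(u + v) * (m' / (M' + 1)) - u * (m / (M + 1))\<bar> \<le> 4 * B"
      using mM B by (intro scaled_influence_change) auto
    moreover have "((\<Sum>t\<in>#add_mset t G. f t) - (\<Sum>t\<in>#H. f t)) - ((\<Sum>t\<in>#gp. f t) - (\<Sum>t\<in>#H'. f t)) = u + v"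
      by (simp add: gp u_def v_def)
    ultimately show ?thesis unfolding u_def[symmetric] by simp
  qed
  show ?thesis
  proof (cases agg)
    case COUNT_agg
    show ?thesis
      unfolding infl using linear[of 1 "\<lambda>_. 1"] by (simp add: COUNT_agg influence_sensitivity_def)
  next
    case SUM_agg
    show ?thesis
      unfolding infl using linear[of A w] w A0
      by (simp add: SUM_agg influence_sensitivity_def A_def[symmetric] w_def[symmetric])
  next
    case AVG_agg
    define s where "s B = (\<Sum>t\<in>#B. w t)" for B
    have s: "\<bar>s G\<bar> \<le> A * real (size G)" "\<bar>s G'\<bar> \<le> A * real (size G')"
      "\<bar>s H\<bar> \<le> A * real (size H)" "\<bar>s H'\<bar> \<le> A * real (size H')"
      unfolding s_def using w by (auto intro!: abs_sum_mset_le simp: G'_def H'_def)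
    define \<delta>1 where "\<delta>1 = (s G + w t) / (real (size G) + 1) - s G / real (size G)"
    define \<delta>2 where "\<delta>2 = (if p t then 0 else (s G' + w t) / (real (size G') + 1) - s G' / real (size G'))"
    define u where "u = (s G / real (size G) - s H / real (size H)) - (s G' / real (size G') - s H' / real (size H'))"
    have "\<bar>(u + \<delta>1 - \<delta>2) * m' - u * m\<bar> \<le> 16 * A"
    \<comment> \<open>If the new tuple satisfies \<open>p\<close>, the witness for \<open>n'\<close>
      exceeds the size of \<open>gp\<close> by one. This is harmless: \<delta>2 is then 0, and
      \<open>m'\<close> is still at most \<open>n'\<close>.\<close>
    proof (rule average_influence_change[where n = "real (size G) + 1" and n' = "real (size G') + 1"])
      show "\<bar>\<delta>1\<bar> * (real (size G) + 1) \<le> 2 * A"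
        unfolding \<delta>1_def by (rule average_change) (use A0 w s in auto)
      show "\<bar>\<delta>2\<bar> * (real (size G') + 1) \<le> 2 * A"
        using average_change[OF A0 w(1) s(2)] A0 by (simp add: \<delta>2_def)
      show "\<bar>u\<bar> \<le> 4 * A"
        unfolding u_def using s[THEN abs_divide_size_le, OF A0] by linarith
    qed (use mM A0 le in \<open>auto simp: m'_def size_gp e_def\<close>)
    moreover have "(s (add_mset t G) / real (size (add_mset t G)) - s H / real (size H)) -
        (s gp / real (size gp) - s H' / real (size H')) = u + \<delta>1 - \<delta>2"
      by (simp add: gp u_def \<delta>1_def \<delta>2_def s_def add.commute)
    moreover have avg: "agg_bag S q AVG_agg B = s B / real (size B)" for B
      by (simp add: s_def w_def)
    ultimately show ?thesis
      unfolding infl unfolding AVG_agg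
      by (simp only: avg aggregate.case influence_sensitivity_def A_def[symmetric] u_def[symmetric])
  qed
qed

lemma influence_sensitivity_nonneg:
  assumes "valid_query S q" shows "influence_sensitivity S q agg \<ge> 0"
  using agg_max_nonneg[OF assms] by (simp add: influence_sensitivity_def split: aggregate.split)

lemma influence_add_tuple:
  assumes V: "valid_query S q" and D: "add_mset t D \<in> databases S"
  shows "\<bar>influence S q agg (x, y) (add_mset t D) p - influence S q agg (x, y) D p\<bar>
    \<le> influence_sensitivity S q agg"
proof -
  consider "x = y" | "x \<noteq> y" "where_cond q t" "t (gb_attr q) = x" | "x \<noteq> y" "where_cond q t" "t (gb_attr q) = y"
    | "\<not> (where_cond q t \<and> t (gb_attr q) = x)" "\<not> (where_cond q t \<and> t (gb_attr q) = y)"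
    by blast
  then show ?thesis
  proof cases
    case 1
    then show ?thesis
      using influence_sensitivity_nonneg[OF V] by (simp add: influence_def intervention_change_def)
  next
    case 2
    then show ?thesis by (rule influence_add_tuple_fst[OF V D])
  next
    case 3
    have "\<bar>influence S q agg (y, x) (add_mset t D) p - influence S q agg (y, x) D p\<bar>
      \<le> influence_sensitivity S q agg"
      by (rule influence_add_tuple_fst[OF V D]) (use 3 in auto)
    then show ?thesis unfolding influence_swap[of S q agg y x] by simp
  next
    case 4
    then have "group_of q z (add_mset t D) = group_of q z D" if "z = x \<or> z = y" for z
      using that by (auto simp: group_of_add)
    then have "influence S q agg (x, y) (add_mset t D) p = influence S q agg (x, y) D p"
      by (simp add: influence_def intervention_change_def group_of_without)
    then show ?thesis using influence_sensitivity_nonneg[OF V] by simp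
  qed
qed

lemma influence_neighboring:
  assumes V: "valid_query S q" and D: "D \<in> databases S" "D' \<in> databases S" and N: "neighboring D D'"
  shows "\<bar>influence S q agg qn D p - influence S q agg qn D' p\<bar> \<le> influence_sensitivity S q agg"
  using N
proof (cases rule: neighboring_cases)
  case (1 t)
  then show ?thesis
    using influence_add_tuple[OF V, of t D agg "fst qn" "snd qn" p] D by (simp add: abs_minus_commute)
next
  case (2 t)
  then show ?thesis
    using influence_add_tuple[OF V, of t D' agg "fst qn" "snd qn" p] D by simp
qed

section \<open>Sensitivity of the Phase-1 aggregates\<close>

lemma agg_bag_group_of_add:
  assumes V: "valid_query S q" and D: "add_mset t D \<in> databases S" and a: "a \<noteq> AVG_agg"
  shows "\<bar>agg_bag S q a (group_of q x (add_mset t D)) - agg_bag S q a (group_of q x D)\<bar>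
    \<le> (if x = t (gb_attr q) then base_sensitivity S q a else 0)"
  using abs_num_of_le_agg_max[OF V databasesD[OF D], of t] agg_max_nonneg[OF V] a
  by (cases a) (auto simp: group_of_add base_sensitivity_def)

text \<open>The witness \<open>z\<close>, the group value of the added or removed tuple, is common
  to all base queries. It lets Phase 1 be charged for one group instead of all.\<close>

lemma agg_bag_group_of_neighboring:
  assumes V: "valid_query S q" and D: "D \<in> databases S" "D' \<in> databases S" and N: "neighboring D D'"
  obtains z where "\<And>a x. a \<noteq> AVG_agg \<Longrightarrow>
    \<bar>agg_bag S q a (group_of q x D) - agg_bag S q a (group_of q x D')\<bar>
      \<le> (if x = z then base_sensitivity S q a else 0)"
  using N
proof (cases rule: neighboring_cases)
  case (1 t)
  then show ?thesis
    using agg_bag_group_of_add[OF V, of t D] D that[of "t (gb_attr q)"] by (simp add: abs_minus_commute)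
next
  case (2 t)
  then show ?thesis
    using agg_bag_group_of_add[OF V, of t D'] D that[of "t (gb_attr q)"] by simp
qed

section \<open>Stability of the t-th largest score\<close>

lemma set_descending [simp]: "set (descending f ps) = set ps"
  and length_descending [simp]: "length (descending f ps) = length ps"
  and distinct_descending [simp]: "distinct (descending f ps) = distinct ps"
  by (simp_all add: descending_def)

lemma descending_nth_mono:
  assumes "i \<le> j" "j < length ps"
  shows "f (descending f ps ! j) \<le> f (descending f ps ! i)"
proof -
  have "sorted (map (\<lambda>p. - f p) (descending f ps))" by (simp add: descending_def)
  from sorted_nth_mono[OF this, of i j] show ?thesis using assms by simp
qed

text \<open>Pigeonhole: if the claim failed, the t best elements for \<open>f\<close> would all
  score strictly higher under \<open>g\<close> than the t-th element for \<open>g\<close>, and would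
  have to fit into the t - 1 places before it.\<close>

lemma rank_inv_score_le:
  assumes ps: "distinct ps" and t: "1 \<le> t" "t \<le> length ps"
    and le: "\<And>p. p \<in> set ps \<Longrightarrow> f p - \<Delta> \<le> g p"
  shows "f (rank_inv ps f t) - \<Delta> \<le> g (rank_inv ps g t)"
proof (rule ccontr)
  assume neg: "\<not> ?thesis"
  define F where "F = descending f ps"
  define G where "G = descending g ps"
  have F: "length F = length ps" "distinct F" "set F = set ps"
    and G: "length G = length ps" "distinct G" "set G = set ps"
    using ps by (auto simp: F_def G_def)
  have "set (take t F) \<subseteq> set (take (t - 1) G)"
  proof
    fix p assume "p \<in> set (take t F)"
    then obtain i where i: "i < t" "p = F ! i" using t F by (auto simp: in_set_conv_nth)
    have p: "p \<in> set ps" using i t F by (metis nth_mem less_le_trans)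
    have "f (rank_inv ps f t) \<le> f p"
      unfolding i(2) F_def rank_inv_def using i t by (intro descending_nth_mono) auto
    then have gp: "g (rank_inv ps g t) < g p" using neg le[OF p] by simp
    obtain j where j: "j < length G" "p = G ! j" using p G by (metis in_set_conv_nth)
    have "j < t - 1"
    proof (rule ccontr)
      assume "\<not> j < t - 1"
      then have "g p \<le> g (rank_inv ps g t)"
        unfolding j(2) G_def rank_inv_def using j G by (intro descending_nth_mono) auto
      then show False using gp by simp
    qed
    then show "p \<in> set (take (t - 1) G)" using j by (auto simp: in_set_conv_nth)
  qed
  then have "card (set (take t F)) \<le> card (set (take (t - 1) G))" by (intro card_mono) auto
  then show False using F G t by (simp add: distinct_card)
qed

lemma rank_inv_score_change:
  assumes ps: "distinct ps" and t: "1 \<le> t" "t \<le> length ps"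
    and le: "\<And>p. p \<in> set ps \<Longrightarrow> \<bar>f p - g p\<bar> \<le> \<Delta>"
  shows "\<bar>f (rank_inv ps f t) - g (rank_inv ps g t)\<bar> \<le> \<Delta>"
proof -
  have "f p - \<Delta> \<le> g p" "g p - \<Delta> \<le> f p" if "p \<in> set ps" for p using le[OF that] by auto
  then show ?thesis
    using rank_inv_score_le[OF ps t, of f \<Delta> g] rank_inv_score_le[OF ps t, of g \<Delta> f] by simp
qed

section \<open>Gumbel noise and the top-\<open>k\<close> selection\<close>

lemma sets_gumbel [simp, measurable_cong]: "sets (gumbel b) = sets borel"
  by (simp add: gumbel_def)

lemma space_gumbel [simp]: "space (gumbel b) = UNIV"
  by (simp add: gumbel_def)

section \<open>The Gumbel law and its integrals\<close>

lemma nn_integral_exp_Ioi: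
  assumes "\<kappa> > 0"
  shows "(\<integral>\<^sup>+u. ennreal (exp (- \<kappa> * u)) * indicator {c<..} u \<partial>lborel) = ennreal (exp (- \<kappa> * c) / \<kappa>)"
proof -
  have "(\<integral>\<^sup>+u. ennreal (exp (- \<kappa> * u)) * indicator {c<..} u \<partial>lborel) =
      (\<integral>\<^sup>+u. ennreal (exp (- \<kappa> * u)) * indicator {c..} u \<partial>lborel)"
    using AE_lborel_singleton[of c]
    by (intro nn_integral_cong_AE) (auto elim!: eventually_mono simp: indicator_def)
  also have "\<dots> = ennreal (0 - (- exp (- \<kappa> * c) / \<kappa>))"
  proof (rule nn_integral_FTC_atLeast)
    show "((\<lambda>u. - exp (- \<kappa> * u) / \<kappa>) has_real_derivative exp (- \<kappa> * u)) (at u)" for u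
      using assms by (auto intro!: derivative_eq_intros)
    have "filterlim (\<lambda>u. \<kappa> * u) at_top at_top"
      by (rule filterlim_tendsto_pos_mult_at_top[OF tendsto_const assms filterlim_ident])
    then have "filterlim (\<lambda>u. - (\<kappa> * u)) at_bot at_top"
      by (rule filterlim_uminus_at_top[THEN iffD1])
    then have "((\<lambda>u. exp (- \<kappa> * u)) \<longlongrightarrow> 0) at_top"
      by (intro filterlim_compose[OF exp_at_bot]) simp
    then have "((\<lambda>u. - exp (- \<kappa> * u) / \<kappa>) \<longlongrightarrow> - 0 / \<kappa>) at_top"
      using assms by (intro tendsto_intros) auto
    then show "((\<lambda>u. - exp (- \<kappa> * u) / \<kappa>) \<longlongrightarrow> 0) at_top" by simp
  qed auto
  finally show ?thesis by simp
qed

lemma gumbel_cdf_properties: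
  fixes b :: real
  assumes b: "b > 0"
  defines "F \<equiv> \<lambda>z. exp (- exp (- z / b))"
  shows "x \<le> y \<Longrightarrow> F x \<le> F y" "continuous (at_right a) F" "(F \<longlongrightarrow> 0) at_bot" "(F \<longlongrightarrow> 1) at_top"
proof -
  show "x \<le> y \<Longrightarrow> F x \<le> F y" using b by (simp add: F_def divide_right_mono)
  show "continuous (at_right a) F" unfolding F_def using b by (intro continuous_intros) auto
  have 1: "filterlim (\<lambda>z. - z / b) at_bot at_top"
  proof -
    have "filterlim (\<lambda>z. (1 / b) * z) at_top at_top"
      using b by (intro filterlim_tendsto_pos_mult_at_top[OF tendsto_const] filterlim_ident) auto
    then have "filterlim (\<lambda>z. - ((1 / b) * z)) at_bot at_top"
      by (rule filterlim_uminus_at_top[THEN iffD1])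
    then show ?thesis by simp
  qed
  have 2: "filterlim (\<lambda>z. - z / b) at_top at_bot"
  proof -
    have "filterlim (\<lambda>z. (1 / b) * (- z)) at_top at_bot"
      using b by (intro filterlim_tendsto_pos_mult_at_top[OF tendsto_const] filterlim_uminus_at_top_at_bot) auto
    then show ?thesis by simp
  qed
  have "((\<lambda>z. exp (- z / b)) \<longlongrightarrow> 0) at_top" by (rule filterlim_compose[OF exp_at_bot 1])
  then have "(F \<longlongrightarrow> exp (- 0)) at_top" unfolding F_def by (intro tendsto_intros)
  then show "(F \<longlongrightarrow> 1) at_top" by simp
  have "filterlim (\<lambda>z. exp (- z / b)) at_top at_bot" by (rule filterlim_compose[OF exp_at_top 2])
  then have "filterlim (\<lambda>z. - exp (- z / b)) at_bot at_bot" by (simp add: filterlim_uminus_at_bot)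
  then show "(F \<longlongrightarrow> 0) at_bot" unfolding F_def by (rule filterlim_compose[OF exp_at_bot])
qed

lemma gumbel_real_distribution:
  assumes "b > 0"
  shows "real_distribution (gumbel b)"
proof -
  have "gumbel b = interval_measure (\<lambda>z. exp (- exp (- z / b)))" using assms by (simp add: gumbel_def)
  then show ?thesis
    using real_distribution_interval_measure[of "\<lambda>z. exp (- exp (- z / b))"] gumbel_cdf_properties[OF assms]
    by simp
qed

lemma prob_space_gumbel: "b \<ge> 0 \<Longrightarrow> prob_space (gumbel b)"
  using gumbel_real_distribution[of b] real_distribution.axioms(1)
  by (cases "b = 0") (auto simp: gumbel_def intro!: prob_space_return)

text \<open>For a standard exponential \<open>u\<close>, - b ln u \<le> x means u \<ge> exp (- x /
  b), which has probability exp (- exp (- x / b)). In the variable \<open>u\<close> the double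
  exponentials of the Gumbel law become plain ones.\<close>

lemma gumbel_eq_distr_exponential:
  assumes b: "b > 0"
  shows "gumbel b = distr (density lborel (exponential_density 1)) borel (\<lambda>u. - b * ln u)"
proof (rule cdf_unique[OF gumbel_real_distribution[OF b]])
  interpret E: prob_space "density lborel (exponential_density 1)"
    by (rule prob_space_exponential_density) simp
  interpret D: prob_space "distr (density lborel (exponential_density 1)) borel (\<lambda>u. - b * ln u)"
    by (rule E.prob_space_distr) simp
  show "real_distribution (distr (density lborel (exponential_density 1)) borel (\<lambda>u. - b * ln u))"
    by unfold_locales auto
  show "cdf (gumbel b) = cdf (distr (density lborel (exponential_density 1)) borel (\<lambda>u. - b * ln u))"
  proof
    fix x
    have "cdf (gumbel b) x = exp (- exp (- x / b))"
      using b gumbel_cdf_properties[OF b] by (simp add: gumbel_def cdf_interval_measure)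
    moreover have "emeasure (distr (density lborel (exponential_density 1)) borel (\<lambda>u. - b * ln u)) {..x} =
        (\<integral>\<^sup>+u. ennreal (exp (- 1 * u)) * indicator {exp (- x / b)<..} u \<partial>lborel)"
    proof -
      have iff: "- b * ln u \<le> x \<longleftrightarrow> exp (- x / b) \<le> u" if "u > 0" for u
      proof -
        have "- b * ln u \<le> x \<longleftrightarrow> - x / b \<le> ln u" using b by (auto simp: field_simps)
        also have "\<dots> \<longleftrightarrow> exp (- x / b) \<le> u" using that by (simp add: ln_ge_iff)
        finally show ?thesis .
      qed
      have "emeasure (distr (density lborel (exponential_density 1)) borel (\<lambda>u. - b * ln u)) {..x} =
          (\<integral>\<^sup>+u. ennreal (exponential_density 1 u) * indicator ((\<lambda>u. - b * ln u) -` {..x}) u \<partial>lborel)"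
        using measurable_sets[of "\<lambda>u. - b * ln u" borel borel "{..x}"]
        by (subst emeasure_distr) (auto simp: emeasure_density)
      also have "\<dots> = (\<integral>\<^sup>+u. ennreal (exp (- 1 * u)) * indicator {exp (- x / b)<..} u \<partial>lborel)"
      proof (intro nn_integral_cong_AE)
        show "AE u in lborel. ennreal (exponential_density 1 u) * indicator ((\<lambda>u. - b * ln u) -` {..x}) u =
            ennreal (exp (- 1 * u)) * indicator {exp (- x / b)<..} u"
          \<comment> \<open>Two points are removed: at \<open>exp (- x / b)\<close> the strict and
            the weak inequality differ, and at 0 the density is 1 while the logarithm is a default
            value.\<close>
          using AE_lborel_singleton[of 0] AE_lborel_singleton[of "exp (- x / b)"]
        proof eventually_elim
          case (elim u)
          show ?case
          proof (cases "u > 0")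
            case True
            then show ?thesis using iff[OF True] elim by (auto simp: exponential_density_def indicator_def)
          next
            case False
            then have "u < 0" using elim by simp
            moreover have "\<not> exp (- x / b) < u" using \<open>u < 0\<close> by (meson exp_gt_zero less_trans not_less_iff_gr_or_eq)
            ultimately show ?thesis by (simp add: exponential_density_def)
          qed
        qed
      qed
      finally show ?thesis .
    qed
    then have "emeasure (distr (density lborel (exponential_density 1)) borel (\<lambda>u. - b * ln u)) {..x} =
        ennreal (exp (- exp (- x / b)))"
      using nn_integral_exp_Ioi[of 1 "exp (- x / b)"] by simp
    then have "cdf (distr (density lborel (exponential_density 1)) borel (\<lambda>u. - b * ln u)) x = exp (- exp (- x / b))"
      by (simp add: cdf_def measure_def)
    ultimately show "cdf (gumbel b) x = cdf (distr (density lborel (exponential_density 1)) borel (\<lambda>u. - b * ln u)) x"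
      by simp
  qed
qed

lemma nn_integral_gumbel:
  assumes b: "b > 0" and [measurable]: "g \<in> borel_measurable borel"
  shows "(\<integral>\<^sup>+z. g z \<partial>gumbel b) = (\<integral>\<^sup>+u. ennreal (exp (- u)) * indicator {0<..} u * g (- b * ln u) \<partial>lborel)"
proof -
  have "(\<integral>\<^sup>+z. g z \<partial>gumbel b) = (\<integral>\<^sup>+u. ennreal (exponential_density 1 u) * g (- b * ln u) \<partial>lborel)"
    unfolding gumbel_eq_distr_exponential[OF b]
    by (simp add: nn_integral_distr nn_integral_density)
  also have "\<dots> = (\<integral>\<^sup>+u. ennreal (exp (- u)) * indicator {0<..} u * g (- b * ln u) \<partial>lborel)"
    using AE_lborel_singleton[of 0]
    by (intro nn_integral_cong_AE) (auto elim!: eventually_mono simp: exponential_density_def indicator_def)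
  finally show ?thesis .
qed

text \<open>In the exponential variable \<open>u\<close>, exp (- (s + z) / b) is u / w, so the
  integrand becomes exp (- \<kappa> u) on u > c. \<Lambda> will be the total weight of the items
  ranked below this one; the result is the chance w / (w + \<Lambda>) of coming first, times the
  probability that all scores are below T.\<close>

lemma nn_integral_gumbel_below:
  fixes s b T \<Lambda> :: real
  assumes b: "b > 0" and \<Lambda>: "\<Lambda> \<ge> 0"
  defines "w \<equiv> exp (s / b)"
  shows "(\<integral>\<^sup>+z. indicator {..<T} (s + z) * ennreal (exp (- \<Lambda> * exp (- (s + z) / b))) \<partial>gumbel b) =
    ennreal (w / (w + \<Lambda>) * exp (- (w + \<Lambda>) * exp (- T / b)))"
proof -
  define c where "c = w * exp (- T / b)"
  define \<kappa> where "\<kappa> = (w + \<Lambda>) / w"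
  have w: "w > 0" and \<kappa>: "\<kappa> > 0" using \<Lambda> by (auto simp: w_def \<kappa>_def add_pos_nonneg)
  have c: "c > 0" using w by (simp add: c_def)
  have "(\<integral>\<^sup>+z. indicator {..<T} (s + z) * ennreal (exp (- \<Lambda> * exp (- (s + z) / b))) \<partial>gumbel b) =
      (\<integral>\<^sup>+u. ennreal (exp (- u)) * indicator {0<..} u *
        (indicator {..<T} (s + - b * ln u) * ennreal (exp (- \<Lambda> * exp (- (s + - b * ln u) / b)))) \<partial>lborel)"
    by (rule nn_integral_gumbel[OF b]) measurable
  also have "\<dots> = (\<integral>\<^sup>+u. ennreal (exp (- \<kappa> * u)) * indicator {c<..} u \<partial>lborel)"
  proof (intro nn_integral_cong)
    fix u :: real
    show "ennreal (exp (- u)) * indicator {0<..} u *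
        (indicator {..<T} (s + - b * ln u) * ennreal (exp (- \<Lambda> * exp (- (s + - b * ln u) / b)))) =
        ennreal (exp (- \<kappa> * u)) * indicator {c<..} u"
    proof (cases "u > 0")
      case True
      have "s + - b * ln u < T \<longleftrightarrow> (s - T) / b < ln u" using b by (simp add: field_simps)
      also have "\<dots> \<longleftrightarrow> exp ((s - T) / b) < u" using True by (metis exp_less_cancel_iff exp_ln)
      also have "exp ((s - T) / b) = c" by (simp add: c_def w_def exp_add[symmetric] diff_divide_distrib)
      finally have iff: "s + - b * ln u < T \<longleftrightarrow> c < u" .
      have "- (s + - b * ln u) / b = - (s / b) + ln u" using b by (simp add: field_simps)
      then have "exp (- (s + - b * ln u) / b) = u / w"
        using True by (simp only: exp_add exp_minus exp_ln) (simp add: w_def field_simps)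
      then have "exp (- u) * exp (- \<Lambda> * exp (- (s + - b * ln u) / b)) = exp (- u + - \<Lambda> * (u / w))"
        by (simp only: exp_add)
      also have "- u + - \<Lambda> * (u / w) = - \<kappa> * u" using w by (simp add: \<kappa>_def field_simps)
      finally have "ennreal (exp (- u)) * ennreal (exp (- \<Lambda> * exp (- (s + - b * ln u) / b))) = ennreal (exp (- \<kappa> * u))"
        by (simp flip: ennreal_mult)
      then show ?thesis using True iff by (simp add: indicator_def)
    qed (use c in auto)
  qed
  also have "\<dots> = ennreal (exp (- \<kappa> * c) / \<kappa>)" by (rule nn_integral_exp_Ioi[OF \<kappa>])
  also have "exp (- \<kappa> * c) / \<kappa> = w / (w + \<Lambda>) * exp (- (w + \<Lambda>) * exp (- T / b))"
  proof -
    have "\<kappa> * c = (w + \<Lambda>) * exp (- T / b)" using w by (simp add: \<kappa>_def c_def)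
    moreover have "1 / \<kappa> = w / (w + \<Lambda>)" by (simp add: \<kappa>_def)
    moreover have "exp (- \<kappa> * c) / \<kappa> = 1 / \<kappa> * exp (- (\<kappa> * c))" by simp
    ultimately show ?thesis by (simp only: mult_minus_left)
  qed
  finally show ?thesis .
qed

section \<open>Ordered selection and its Plackett-Luce probabilities\<close>

fun topk_event :: "('p \<Rightarrow> real) \<Rightarrow> 'p list \<Rightarrow> 'p set \<Rightarrow> real \<Rightarrow> ('p \<Rightarrow> real) \<Rightarrow> bool" where
  "topk_event s [] A T z \<longleftrightarrow> (\<forall>p\<in>A. s p + z p < T)"
| "topk_event s (x # xs) A T z \<longleftrightarrow> s x + z x < T \<and> topk_event s xs (A - {x}) (s x + z x) z"

text \<open>The Plackett-Luce law: successive draws without replacement, with chances proportional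
  to the weights of the remaining items.\<close>

fun pl_prob :: "('p \<Rightarrow> real) \<Rightarrow> 'p list \<Rightarrow> 'p set \<Rightarrow> real" where
  "pl_prob w [] A = 1"
| "pl_prob w (x # xs) A = w x / sum w A * pl_prob w xs (A - {x})"

lemma pl_prob_nonneg: "(\<And>p. w p > 0) \<Longrightarrow> pl_prob w xs A \<ge> 0"
proof (induction xs arbitrary: A)
  case (Cons x xs)
  then show ?case
    unfolding pl_prob.simps
    by (intro mult_nonneg_nonneg divide_nonneg_nonneg sum_nonneg Cons.IH) (auto intro: less_imp_le)
qed simp

lemma topk_event_cong:
  "(\<And>p. p \<in> A \<union> set xs \<Longrightarrow> z p = z' p) \<Longrightarrow> topk_event s xs A T z = topk_event s xs A T z'"
proof (induction xs arbitrary: A T)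
  case (Cons x xs)
  have "z x = z' x" by (rule Cons.prems) simp
  moreover have "topk_event s xs (A - {x}) (s x + z' x) z = topk_event s xs (A - {x}) (s x + z' x) z'"
    by (rule Cons.IH) (use Cons.prems in auto)
  ultimately show ?case by simp
qed auto

text \<open>The threshold is a function of the noise, since one step of the recursion replaces it by
  the noisy score of the item just listed.\<close>

lemma measurable_topk_event:
  assumes "finite A" "A \<subseteq> I" "set xs \<subseteq> I" "T \<in> borel_measurable (\<Pi>\<^sub>M _\<in>I. borel)"
  shows "Measurable.pred (\<Pi>\<^sub>M _\<in>I. borel) (\<lambda>z. topk_event s xs A (T z) z)"
  using assms
proof (induction xs arbitrary: A T)
  case Nil
  note [measurable] = Nil(4)
  have [measurable]: "p \<in> A \<Longrightarrow> (\<lambda>z. z p) \<in> borel_measurable (\<Pi>\<^sub>M _\<in>I. borel)" for p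
    using Nil by (intro measurable_component_singleton) auto
  show ?case
    unfolding topk_event.simps by (intro pred_intros_finite Nil(1)) measurable
next
  case (Cons x xs)
  note [measurable] = Cons(5)
  have [measurable]: "(\<lambda>z. z x) \<in> borel_measurable (\<Pi>\<^sub>M _\<in>I. borel)"
    using Cons by (intro measurable_component_singleton) auto
  have [measurable]: "Measurable.pred (\<Pi>\<^sub>M _\<in>I. borel) (\<lambda>z. topk_event s xs (A - {x}) (s x + z x) z)"
    using Cons.prems by (intro Cons.IH) auto
  show ?case by simp
qed

lemma sets_PiM_gumbel: "sets (\<Pi>\<^sub>M _\<in>I. gumbel b) = sets (\<Pi>\<^sub>M _\<in>I. borel)"
  by (intro sets_PiM_cong) auto

text \<open>The threshold \<open>T\<close> makes the induction possible: given the score of the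
  first item, the rest is the same event with that score as threshold. The probability factorises
  into the chance of the order and the probability that all scores are below \<open>T\<close>; the
  second factor has the shape that \<open>nn_integral_gumbel_below\<close> integrates.\<close>

lemma emeasure_topk_event:
  fixes s :: "'p \<Rightarrow> real"
  assumes b: "b > 0" and "finite A" "distinct xs" "set xs \<subseteq> A"
  defines "w \<equiv> \<lambda>p. exp (s p / b)"
  shows "emeasure (\<Pi>\<^sub>M _\<in>A. gumbel b) {z \<in> space (\<Pi>\<^sub>M _\<in>A. gumbel b). topk_event s xs A T z} =
    ennreal (pl_prob w xs A * exp (- sum w A * exp (- T / b)))"
  using assms(2-4)
proof (induction xs arbitrary: A T)
  case Nil
  interpret G: prob_space "gumbel b" using b by (intro prob_space_gumbel) simp
  interpret product_prob_space "\<lambda>_. gumbel b" A ..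
  have "{z \<in> space (\<Pi>\<^sub>M _\<in>A. gumbel b). topk_event s [] A T z} =
      {z \<in> space (\<Pi>\<^sub>M _\<in>A. gumbel b). \<forall>p\<in>A. z p \<in> {..<T - s p}}"
    by (auto simp: algebra_simps)
  also have "emeasure (\<Pi>\<^sub>M _\<in>A. gumbel b) \<dots> = (\<Prod>p\<in>A. emeasure (gumbel b) {..<T - s p})"
    using Nil by (intro emeasure_PiM_Collect) auto
  also have "\<dots> = (\<Prod>p\<in>A. ennreal (exp (- w p * exp (- T / b))))"
  proof (rule prod.cong)
    fix p
    have "emeasure (gumbel b) {..<T - s p} = (\<integral>\<^sup>+z. indicator {..<T - s p} z \<partial>gumbel b)" by simp
    \<comment> \<open>The case \<Lambda> = 0 recovers the distribution function.\<close>
    also have "\<dots> = (\<integral>\<^sup>+z. indicator {..<T} (s p + z) * ennreal (exp (- 0 * exp (- (s p + z) / b))) \<partial>gumbel b)"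
      by (intro nn_integral_cong) (auto simp: indicator_def)
    also have "\<dots> = ennreal (exp (- w p * exp (- T / b)))"
      by (subst nn_integral_gumbel_below[OF b]) (auto simp: w_def)
    finally show "emeasure (gumbel b) {..<T - s p} = ennreal (exp (- w p * exp (- T / b)))" .
  qed simp
  also have "\<dots> = ennreal (\<Prod>p\<in>A. exp (- w p * exp (- T / b)))"
    by (rule prod_ennreal) auto
  also have "(\<Prod>p\<in>A. exp (- w p * exp (- T / b))) = exp (- sum w A * exp (- T / b))"
    using Nil by (simp add: exp_sum[symmetric] sum_negf sum_distrib_right)
  finally show ?case by simp
next
  case (Cons x xs)
  define B where "B = A - {x}"
  have A: "A = insert x B" "x \<notin> B" "finite B" using Cons.prems by (auto simp: B_def)
  have xs: "distinct xs" "set xs \<subseteq> B" using Cons.prems by (auto simp: B_def)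
  interpret G: prob_space "gumbel b" using b by (intro prob_space_gumbel) simp
  interpret product_prob_space "\<lambda>_. gumbel b" A ..
  let ?P = "\<lambda>I. \<Pi>\<^sub>M _\<in>I. gumbel b"
  have ev: "{z \<in> space (?P A). topk_event s (x # xs) A T z} \<in> sets (?P A)"
  proof -
    have "Measurable.pred (\<Pi>\<^sub>M _\<in>A. borel) (\<lambda>z. topk_event s (x # xs) A T z)"
      using Cons.prems by (intro measurable_topk_event) auto
    then show ?thesis
      using sets_PiM_gumbel[of A b] sets_eq_imp_space_eq[OF sets_PiM_gumbel[of A b]]
      by (auto simp: pred_def)
  qed
  let ?f = "indicator {z \<in> space (?P A). topk_event s (x # xs) A T z} :: _ \<Rightarrow> ennreal"
  have "emeasure (?P A) {z \<in> space (?P A). topk_event s (x # xs) A T z} = (\<integral>\<^sup>+z. ?f z \<partial>?P (insert x B))"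
    using ev unfolding A(1)[symmetric] by (simp add: nn_integral_indicator)
  \<comment> \<open>Fubini with the noise of the first item outermost, as its score is the threshold
    for all others.\<close>
  also have "\<dots> = (\<integral>\<^sup>+y. (\<integral>\<^sup>+z. ?f (z(x := y)) \<partial>?P B) \<partial>gumbel b)"
    using A ev by (intro product_nn_integral_insert_rev) (auto simp flip: A(1))
  also have "\<dots> = (\<integral>\<^sup>+y. ennreal (pl_prob w xs B) * (indicator {..<T} (s x + y) * ennreal (exp (- sum w B * exp (- (s x + y) / b)))) \<partial>gumbel b)"
  proof (intro nn_integral_cong)
    fix y
    have "(\<integral>\<^sup>+z. ?f (z(x := y)) \<partial>?P B) =
        (\<integral>\<^sup>+z. indicator {..<T} (s x + y) * indicator {z \<in> space (?P B). topk_event s xs B (s x + y) z} z \<partial>?P B)"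
    proof (intro nn_integral_cong)
      fix z assume z: "z \<in> space (?P B)"
      have "z(x := y) \<in> space (?P A)" using z A by (auto simp: space_PiM PiE_iff extensional_def)
      moreover have "topk_event s xs B (s x + y) (z(x := y)) = topk_event s xs B (s x + y) z"
        using A xs by (intro topk_event_cong) auto
      ultimately show "?f (z(x := y)) =
          indicator {..<T} (s x + y) * indicator {z \<in> space (?P B). topk_event s xs B (s x + y) z} z"
        using z by (auto simp: indicator_def B_def[symmetric])
    qed
    also have "\<dots> = indicator {..<T} (s x + y) * emeasure (?P B) {z \<in> space (?P B). topk_event s xs B (s x + y) z}"
    proof -
      have "Measurable.pred (\<Pi>\<^sub>M _\<in>B. borel) (\<lambda>z. topk_event s xs B (s x + y) z)"
        using xs A by (intro measurable_topk_event) auto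
      then have "{z \<in> space (?P B). topk_event s xs B (s x + y) z} \<in> sets (?P B)"
        using sets_PiM_gumbel[of B b] sets_eq_imp_space_eq[OF sets_PiM_gumbel[of B b]]
        by (auto simp: pred_def)
      then show ?thesis by (subst nn_integral_cmult) auto
    qed
    also have "\<dots> = indicator {..<T} (s x + y) * (ennreal (pl_prob w xs B * exp (- sum w B * exp (- (s x + y) / b))))"
      using Cons.IH[OF A(3) xs, of "s x + y"] by simp
    also have "\<dots> = ennreal (pl_prob w xs B) * (indicator {..<T} (s x + y) * ennreal (exp (- sum w B * exp (- (s x + y) / b))))"
      using pl_prob_nonneg[of w xs B] by (simp add: w_def ennreal_mult mult_ac)
    finally show "(\<integral>\<^sup>+z. ?f (z(x := y)) \<partial>?P B) = \<dots>" .
  qed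
  also have "\<dots> = ennreal (pl_prob w xs B) *
      (\<integral>\<^sup>+y. indicator {..<T} (s x + y) * ennreal (exp (- sum w B * exp (- (s x + y) / b))) \<partial>gumbel b)"
    by (intro nn_integral_cmult) measurable
  also have "\<dots> = ennreal (pl_prob w xs B) * ennreal (w x / (w x + sum w B) * exp (- (w x + sum w B) * exp (- T / b)))"
    unfolding w_def by (subst nn_integral_gumbel_below[OF b]) (auto intro!: sum_nonneg)
  also have "\<dots> = ennreal (pl_prob w (x # xs) A * exp (- sum w A * exp (- T / b)))"
  proof -
    have "pl_prob w (x # xs) A * exp (- sum w A * exp (- T / b)) =
        pl_prob w xs B * (w x / (w x + sum w B) * exp (- (w x + sum w B) * exp (- T / b)))"
    proof -
      have "sum w A = w x + sum w B" using A by (metis sum.insert)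
      then show ?thesis by (simp only: pl_prob.simps B_def[symmetric] mult_ac)
    qed
    then show ?thesis
      using pl_prob_nonneg[of w xs B] by (simp only: ennreal_mult' w_def exp_gt_zero)
  qed
  finally show ?case .
qed

section \<open>Stable sorting and measurability of the selection\<close>

lemma descending_strict_max:
  assumes x: "x \<in> set ps" "distinct ps" and max: "\<And>p. p \<in> set ps \<Longrightarrow> p \<noteq> x \<Longrightarrow> f p < f x"
  shows "descending f ps = x # descending f (remove1 x ps)"
  unfolding descending_def
proof (rule properties_for_sort_key)
  let ?r = "sort_key (\<lambda>p. - f p) (remove1 x ps)"
  have set_r: "set ?r = set ps - {x}" using x by (simp add: set_remove1_eq)
  show "mset (x # ?r) = mset ps" using x by simp
  show "filter (\<lambda>p. - f k = - f p) (x # ?r) = filter (\<lambda>p. - f k = - f p) ps"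
    if k: "k \<in> set (x # ?r)" for k
  proof -
    have r: "filter (\<lambda>p. - f k = - f p) ?r = filter (\<lambda>p. - f k = - f p) (remove1 x ps)"
      using sort_key_stable[of "\<lambda>p. - f p" "- f k" "remove1 x ps"] by (simp add: eq_commute)
    show ?thesis
    proof (cases "k = x")
      case True
      have ne: "f x \<noteq> f p" if "p \<in> set ps" "p \<noteq> x" for p using max[OF that] by simp
      have "filter (\<lambda>p. - f k = - f p) (remove1 x ps) = []"
        using x unfolding True filter_empty_conv by (simp add: set_remove1_eq) (use ne in blast)
      moreover have "filter (\<lambda>p. - f k = - f p) ps = filter (\<lambda>p. p = x) ps"
        unfolding True by (intro filter_cong) (use ne in auto)
      moreover have "filter (\<lambda>p. p = x) ps = [x]"
        using x by (induction ps) (auto simp: filter_empty_conv)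
      ultimately show ?thesis unfolding filter.simps r using True by simp
    next
      case False
      then have "k \<in> set ps" using k set_r by auto
      then have ne: "f k \<noteq> f x" using max[of k] False by auto
      then have "filter (\<lambda>p. - f k = - f p) (remove1 x ps) = filter (\<lambda>p. - f k = - f p) ps"
        by (induction ps) auto
      then show ?thesis unfolding filter.simps r using ne by simp
    qed
  qed
  show "sorted (map (\<lambda>p. - f p) (x # ?r))"
    using max set_r by (auto intro: less_imp_le)
qed

lemma topk_event_below:
  "topk_event s xs A T z \<Longrightarrow> p \<in> A \<union> set xs \<Longrightarrow> s p + z p < T"
proof (induction xs arbitrary: A T)
  case (Cons x xs)
  then show ?case by (cases "p = x") (auto intro: less_trans)
qed auto

text \<open>All inequalities of the event are strict, so each listed item is the unique maximum of
  what remains and the sort has no choice.\<close>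

lemma topk_event_imp_take:
  assumes "topk_event s xs (set ps) T z" "distinct ps" "distinct xs" "set xs \<subseteq> set ps"
  shows "take (length xs) (descending (\<lambda>p. s p + z p) ps) = xs"
  using assms
proof (induction xs arbitrary: ps T)
  case (Cons x xs)
  let ?f = "\<lambda>p. s p + z p"
  have ev: "topk_event s xs (set (remove1 x ps)) (?f x) z"
    using Cons.prems by (simp add: set_remove1_eq)
  have "descending ?f ps = x # descending ?f (remove1 x ps)"
    using Cons.prems topk_event_below[OF ev] by (intro descending_strict_max) (auto simp: set_remove1_eq)
  moreover have "take (length xs) (descending ?f (remove1 x ps)) = xs"
    using Cons.prems by (intro Cons.IH[OF ev]) (auto simp: set_remove1_eq)
  ultimately show ?case by simp
qed simp

text \<open>A stable sort sees scores through their comparisons alone. This reduces measurability of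
  the selection to finitely many comparison patterns.\<close>

lemma descending_cong:
  assumes "\<And>p q. p \<in> set ps \<Longrightarrow> q \<in> set ps \<Longrightarrow> f p \<le> f q \<longleftrightarrow> g p \<le> g q"
  shows "descending f ps = descending g ps"
proof -
  have eq: "(- f p = - f q) = (- g p = - g q)" if "p \<in> set ps" "q \<in> set ps" for p q
    using assms[OF that] assms[OF that(2,1)] by (simp add: order_eq_iff)
  show ?thesis
    unfolding descending_def
  proof (rule properties_for_sort_key)
    let ?r = "sort_key (\<lambda>p. - g p) ps"
    show "mset ?r = mset ps" by simp
    show "filter (\<lambda>p. - f k = - f p) ?r = filter (\<lambda>p. - f k = - f p) ps" if "k \<in> set ?r" for k
    proof -
      have "filter (\<lambda>p. - f k = - f p) ?r = filter (\<lambda>p. - g p = - g k) ?r"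
        using that eq by (intro filter_cong) auto
      also have "\<dots> = filter (\<lambda>p. - g p = - g k) ps" by (rule sort_key_stable)
      also have "\<dots> = filter (\<lambda>p. - f k = - f p) ps"
        using that eq by (intro filter_cong) auto
      finally show ?thesis .
    qed
    have "sorted (map (\<lambda>p. - g p) ?r)" by simp
    then show "sorted (map (\<lambda>p. - f p) ?r)"
      unfolding sorted_map by (rule sorted_wrt_mono_rel[rotated]) (use assms in auto)
  qed
qed

text \<open>The selected list is a function of the comparison pattern \<open>R z\<close>, which
  takes finitely many values, each cut out by finitely many measurable conditions on the
  noise.\<close>

lemma measurable_topk:
  fixes s :: "'p \<Rightarrow> real"
  assumes "k \<le> length ps"
  shows "(\<lambda>z. take k (descending (\<lambda>p. s p + z p) ps)) \<in> (\<Pi>\<^sub>M _\<in>set ps. borel) \<rightarrow>\<^sub>M topk_space k ps"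
proof -
  let ?M = "\<Pi>\<^sub>M _\<in>set ps. (borel :: real measure)"
  let ?I = "set ps \<times> set ps"
  define R where "R z = {(p, q) \<in> ?I. s p + z p \<le> s q + z q}" for z
  \<comment> \<open>A pattern is evaluated at an arbitrary noise vector producing it; by
    \<open>descending_cong\<close> the choice does not matter.\<close>
  define h where "h r = take k (descending (\<lambda>p. s p + (SOME z. R z = r) p) ps)" for r
  have h: "take k (descending (\<lambda>p. s p + z p) ps) = h (R z)" for z
  proof -
    define z' where "z' = (SOME z'. R z' = R z)"
    have z': "R z' = R z" unfolding z'_def by (rule someI[of "\<lambda>z'. R z' = R z" z]) (rule refl)
    have "s p + z p \<le> s q + z q \<longleftrightarrow> s p + z' p \<le> s q + z' q" if "p \<in> set ps" "q \<in> set ps" for p q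
    proof -
      have "(p, q) \<in> R z \<longleftrightarrow> (p, q) \<in> R z'" unfolding z' ..
      then show ?thesis using that by (simp add: R_def)
    qed
    then show ?thesis
      unfolding h_def z'_def[symmetric] by (intro arg_cong[where f = "take k"] descending_cong)
  qed
  have R: "R \<in> ?M \<rightarrow>\<^sub>M count_space (Pow ?I)"
  proof (rule measurable_count_space_eq2[THEN iffD2])
    show "finite (Pow ?I)" by simp
    show "R \<in> space ?M \<rightarrow> Pow ?I \<and> (\<forall>r\<in>Pow ?I. R -` {r} \<inter> space ?M \<in> sets ?M)"
    proof (intro conjI ballI)
      show "R \<in> space ?M \<rightarrow> Pow ?I" by (auto simp: R_def)
      fix r assume r: "r \<in> Pow ?I"
      have mem: "pq \<in> R z \<longleftrightarrow> pq \<in> ?I \<and> s (fst pq) + z (fst pq) \<le> s (snd pq) + z (snd pq)" for pq z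
        by (cases pq) (simp add: R_def)
      have "R z = r \<longleftrightarrow> (\<forall>pq\<in>?I. (s (fst pq) + z (fst pq) \<le> s (snd pq) + z (snd pq)) = (pq \<in> r))" for z
        unfolding set_eq_iff mem using r by blast
      then have "R -` {r} \<inter> space ?M =
          {z \<in> space ?M. \<forall>pq\<in>?I. (s (fst pq) + z (fst pq) \<le> s (snd pq) + z (snd pq)) = (pq \<in> r)}"
        by blast
      also have "\<dots> \<in> sets ?M"
        unfolding pred_def[symmetric]
      proof (intro pred_intros_finite(3))
        fix pq assume "pq \<in> ?I"
        then obtain p q where pq: "pq = (p, q)" "p \<in> set ps" "q \<in> set ps" by auto
        have m: "(\<lambda>z. z p) \<in> borel_measurable ?M" "(\<lambda>z. z q) \<in> borel_measurable ?M"
          using pq by (auto intro!: measurable_component_singleton)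
        have le: "Measurable.pred ?M (\<lambda>z. s p + z p \<le> s q + z q)"
          unfolding pred_def by (intro borel_measurable_le borel_measurable_add m borel_measurable_const)
        show "Measurable.pred ?M (\<lambda>z. (s (fst pq) + z (fst pq) \<le> s (snd pq) + z (snd pq)) = (pq \<in> r))"
          using le pred_intros_logic(2)[OF le] by (cases "pq \<in> r") (simp_all only: pq fst_conv snd_conv simp_thms)
      qed simp
      finally show "R -` {r} \<inter> space ?M \<in> sets ?M" .
    qed
  qed
  have "(\<lambda>z. h (R z)) \<in> ?M \<rightarrow>\<^sub>M count_space UNIV"
    by (rule measurable_compose[OF R measurable_count_space])
  then have "(\<lambda>z. take k (descending (\<lambda>p. s p + z p) ps)) \<in> ?M \<rightarrow>\<^sub>M count_space UNIV"
    unfolding h .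
  then have "(\<lambda>z. take k (descending (\<lambda>p. s p + z p) ps)) \<in>
      ?M \<rightarrow>\<^sub>M restrict_space (count_space UNIV) {xs. length xs = k \<and> set xs \<subseteq> set ps}"
    using assms by (intro measurable_restrict_space2) (auto dest: in_set_takeD)
  then show ?thesis by (simp add: topk_space_def restrict_count_space)
qed

section \<open>The exponential mechanism and its repetition without replacement\<close>

definition exp_mech :: "('p \<Rightarrow> real) \<Rightarrow> 'p set \<Rightarrow> 'p pmf" where
  "exp_mech w A = embed_pmf (\<lambda>p. if p \<in> A then w p / sum w A else 0)"

lemma pmf_exp_mech:
  assumes A: "finite A" "A \<noteq> {}" and w: "\<And>p. w p > 0"
  shows "pmf (exp_mech w A) p = (if p \<in> A then w p / sum w A else 0)"
  unfolding exp_mech_def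
proof (rule pmf_embed_pmf)
  have S: "sum w A > 0" using A w by (intro sum_pos) auto
  show "0 \<le> (if p \<in> A then w p / sum w A else 0)" for p
    using w[of p] S by (simp add: less_imp_le)
  have "(\<integral>\<^sup>+p. ennreal (if p \<in> A then w p / sum w A else 0) \<partial>count_space UNIV) =
      (\<Sum>p\<in>A. ennreal (if p \<in> A then w p / sum w A else 0))"
    using A by (intro nn_integral_count_space') auto
  also have "\<dots> = ennreal (\<Sum>p\<in>A. w p / sum w A)"
    using w S by (subst sum_ennreal[symmetric]) (auto simp: less_imp_le)
  also have "(\<Sum>p\<in>A. w p / sum w A) = 1" using S by (simp flip: sum_divide_distrib)
  finally show "(\<integral>\<^sup>+p. ennreal (if p \<in> A then w p / sum w A else 0) \<partial>count_space UNIV) = 1" by simp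
qed

lemma set_exp_mech:
  assumes "finite A" "A \<noteq> {}" "\<And>p. w p > 0"
  shows "set_pmf (exp_mech w A) \<subseteq> A"
proof
  fix x assume "x \<in> set_pmf (exp_mech w A)"
  then show "x \<in> A"
    using pmf_exp_mech[OF assms, where p = x] by (simp add: set_pmf_iff split: if_splits)
qed

text \<open>The privacy loss is (s - s') / b plus the logarithm of the ratio of the normalising
  constants. The second term is the same for all outcomes, so it shifts the interval of losses
  without widening it beyond 2 \<Delta> / b.\<close>

lemma renyi_dual_exp_mech:
  fixes s s' :: "'p \<Rightarrow> real"
  assumes a: "\<alpha> > 1" and A: "finite A" "A \<noteq> {}" and b: "b > 0"
    and le: "\<And>p. p \<in> A \<Longrightarrow> \<bar>s p - s' p\<bar> \<le> \<Delta>"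
  shows "renyi_dual \<alpha> ((2 * \<Delta> / b)\<^sup>2 / 8) (measure_pmf (exp_mech (\<lambda>p. exp (s p / b)) A))
    (measure_pmf (exp_mech (\<lambda>p. exp (s' p / b)) A))"
proof -
  define w where "w p = exp (s p / b)" for p
  define w' where "w' p = exp (s' p / b)" for p
  have S: "sum w A > 0" "sum w' A > 0" using A by (auto intro!: sum_pos simp: w_def w'_def)
  define c where "c = ln (sum w' A / sum w A) - \<Delta> / b"
  \<comment> \<open>Outside \<open>A\<close> both masses are 0; the value \<open>c\<close> keeps
    \<open>L\<close> within its range there.\<close>
  define L where "L p = (if p \<in> A then (s p - s' p) / b + ln (sum w' A / sum w A) else c)" for p
  have "0 \<le> \<Delta>" using A le by (meson abs_ge_zero all_not_in_conv order_trans)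
  show ?thesis
    unfolding w_def[symmetric, abs_def] w'_def[symmetric, abs_def]
  proof (rule renyi_dual_bounded_range[OF a _ _, where L = L and c = c])
    show "measure_pmf (exp_mech w A) = density (measure_pmf (exp_mech w' A)) (\<lambda>x. ennreal (exp (L x)))"
      unfolding measure_pmf_eq_density
    proof (subst density_density_eq)
      have "pmf (exp_mech w A) p = pmf (exp_mech w' A) p * exp (L p)" for p
      proof (cases "p \<in> A")
        case True
        have "exp (L p) = w p / w' p * (sum w' A / sum w A)"
          using True S by (simp add: L_def exp_add diff_divide_distrib exp_diff w_def w'_def)
        moreover have "w' p > 0" "w p > 0" by (simp_all add: w_def w'_def)
        ultimately show ?thesis
          using True S A by (simp add: pmf_exp_mech w_def w'_def field_simps)
      qed (use A in \<open>simp add: pmf_exp_mech w_def w'_def\<close>)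
      then show "density (count_space UNIV) (\<lambda>x. ennreal (pmf (exp_mech w A) x)) =
          density (count_space UNIV) (\<lambda>x. ennreal (pmf (exp_mech w' A) x) * ennreal (exp (L x)))"
        by (simp add: ennreal_mult')
    qed auto
    fix x
    show "c \<le> L x \<and> L x \<le> c + 2 * \<Delta> / b"
    proof (cases "x \<in> A")
      case True
      have "(s x - s' x) / b \<le> \<Delta> / b" "- \<Delta> / b \<le> (s x - s' x) / b"
        using le[OF True] b by (intro divide_right_mono; simp)+
      then show ?thesis using True by (simp add: L_def c_def)
    qed (use \<open>0 \<le> \<Delta>\<close> b in \<open>simp add: L_def\<close>)
  qed (auto simp: measure_pmf.prob_space_axioms)
qed

fun pl_pmf :: "('p \<Rightarrow> real) \<Rightarrow> nat \<Rightarrow> 'p set \<Rightarrow> 'p list pmf" where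
  "pl_pmf w 0 A = return_pmf []"
| "pl_pmf w (Suc k) A = bind_pmf (exp_mech w A) (\<lambda>x. map_pmf (Cons x) (pl_pmf w k (A - {x})))"

lemma card_Diff_singleton_ge: "finite A \<Longrightarrow> Suc k \<le> card A \<Longrightarrow> k \<le> card (A - {x})"
  by (cases "x \<in> A") auto

text \<open>Each round is an exponential mechanism on the items left over. That set depends on
  earlier outcomes, which adaptive composition allows, and the k rounds cost the same.\<close>

lemma renyi_dual_pl_pmf:
  fixes s s' :: "'p \<Rightarrow> real"
  assumes a: "\<alpha> > 1" and b: "b > 0" and "finite A" "k \<le> card A"
    and "\<And>p. p \<in> A \<Longrightarrow> \<bar>s p - s' p\<bar> \<le> \<Delta>"
  shows "renyi_dual \<alpha> (real k * ((2 * \<Delta> / b)\<^sup>2 / 8)) (measure_pmf (pl_pmf (\<lambda>p. exp (s p / b)) k A))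
    (measure_pmf (pl_pmf (\<lambda>p. exp (s' p / b)) k A))"
  using assms(3-5)
proof (induction k arbitrary: A)
  case 0
  then show ?case using renyi_dual_refl[OF a measure_pmf.prob_space_axioms, of "return_pmf []"] by simp
next
  case (Suc k)
  define w where "w p = exp (s p / b)" for p
  define w' where "w' p = exp (s' p / b)" for p
  have "A \<noteq> {}" using Suc.prems by auto
  have step: "renyi_dual \<alpha> (real k * ((2 * \<Delta> / b)\<^sup>2 / 8)) (measure_pmf (map_pmf (Cons x) (pl_pmf w k (A - {x}))))
      (measure_pmf (map_pmf (Cons x) (pl_pmf w' k (A - {x}))))" for x
    unfolding map_pmf_rep_eq w_def[abs_def] w'_def[abs_def]
    using Suc.prems card_Diff_singleton_ge by (intro renyi_dual_distr[OF a Suc.IH]) auto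
  have "renyi_dual \<alpha> ((2 * \<Delta> / b)\<^sup>2 / 8 + real k * ((2 * \<Delta> / b)\<^sup>2 / 8))
      (measure_pmf (exp_mech w A) \<bind> (\<lambda>x. measure_pmf (map_pmf (Cons x) (pl_pmf w k (A - {x})))))
      (measure_pmf (exp_mech w' A) \<bind> (\<lambda>x. measure_pmf (map_pmf (Cons x) (pl_pmf w' k (A - {x})))))"
  proof (rule renyi_dual_bind[OF a _ _ _ step])
    show "renyi_dual \<alpha> ((2 * \<Delta> / b)\<^sup>2 / 8) (measure_pmf (exp_mech w A)) (measure_pmf (exp_mech w' A))"
      unfolding w_def[abs_def] w'_def[abs_def]
      using Suc.prems \<open>A \<noteq> {}\<close> by (intro renyi_dual_exp_mech[OF a _ _ b]) auto
  qed (auto simp: space_prob_algebra measure_pmf.prob_space_axioms)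
  moreover have "real (Suc k) * ((2 * \<Delta> / b)\<^sup>2 / 8) = (2 * \<Delta> / b)\<^sup>2 / 8 + real k * ((2 * \<Delta> / b)\<^sup>2 / 8)"
    by (simp only: of_nat_Suc distrib_right mult_1_left)
  ultimately show ?case
    unfolding pl_pmf.simps measure_pmf_bind w_def[abs_def] w'_def[abs_def] by (simp only:)
qed

lemma set_pl_pmf:
  assumes "finite A" "k \<le> card A" "\<And>p. w p > 0"
  shows "xs \<in> set_pmf (pl_pmf w k A) \<Longrightarrow> length xs = k \<and> distinct xs \<and> set xs \<subseteq> A"
  using assms
proof (induction k arbitrary: A xs)
  case (Suc k)
  have "A \<noteq> {}" using Suc.prems by auto
  obtain x ys where xs: "xs = x # ys" "x \<in> set_pmf (exp_mech w A)" "ys \<in> set_pmf (pl_pmf w k (A - {x}))"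
    using Suc.prems by auto
  have "x \<in> A" using set_exp_mech[of A w] xs Suc.prems \<open>A \<noteq> {}\<close> by auto
  moreover have "length ys = k \<and> distinct ys \<and> set ys \<subseteq> A - {x}"
    using Suc.prems card_Diff_singleton_ge by (intro Suc.IH[OF xs(3)]) auto
  ultimately show ?case using xs by auto
qed simp

lemma pmf_pl_pmf:
  assumes "finite A" "\<And>p. w p > 0" "distinct xs" "set xs \<subseteq> A"
  shows "pmf (pl_pmf w (length xs) A) xs = pl_prob w xs A"
  using assms
proof (induction xs arbitrary: A)
  case (Cons x xs)
  have "A \<noteq> {}" using Cons.prems by auto
  have IH: "pmf (pl_pmf w (length xs) (A - {x})) xs = pl_prob w xs (A - {x})"
    using Cons.prems by (intro Cons.IH) auto
  have pt: "pmf (map_pmf (Cons y) (pl_pmf w (length xs) (A - {y}))) (x # xs) =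
      (if y = x then pl_prob w xs (A - {x}) else 0)" for y
  proof (cases "y = x")
    case True
    have "pmf (map_pmf (Cons x) (pl_pmf w (length xs) (A - {x}))) (x # xs) = pmf (pl_pmf w (length xs) (A - {x})) xs"
      by (rule pmf_map_inj') simp
    then show ?thesis using True IH by simp
  next
    case False
    then have "x # xs \<notin> set_pmf (map_pmf (Cons y) (pl_pmf w (length xs) (A - {y})))" by auto
    then have "pmf (map_pmf (Cons y) (pl_pmf w (length xs) (A - {y}))) (x # xs) = 0"
      unfolding set_pmf_iff by (simp only: not_not)
    then show ?thesis using False by simp
  qed
  have "pmf (pl_pmf w (length (x # xs)) A) (x # xs) =
      (\<integral>y. (if y = x then pl_prob w xs (A - {x}) else 0) \<partial>measure_pmf (exp_mech w A))"
    by (simp add: pmf_bind pt)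
  also have "\<dots> = (\<Sum>y\<in>{x}. pmf (exp_mech w A) y *\<^sub>R (if y = x then pl_prob w xs (A - {x}) else 0))"
    by (rule integral_measure_pmf) (auto split: if_splits)
  also have "\<dots> = pl_prob w (x # xs) A"
    using Cons.prems \<open>A \<noteq> {}\<close> by (simp add: pmf_exp_mech)
  finally show ?case .
qed simp

text \<open>The Gumbel-max trick. Ranking without ties bounds each output probability from below by its
  Plackett-Luce probability; both families sum to 1, so they agree and ties need not be
  discussed.\<close>

lemma topk_mechanism_eq_pl_pmf:
  fixes s :: "'p \<Rightarrow> real"
  assumes ps: "distinct ps" and k: "k \<le> length ps"
    and b: "2 * \<Delta> * sqrt (real k / (8 * \<rho>)) > 0"
  defines "\<Omega> \<equiv> {xs. length xs = k \<and> set xs \<subseteq> set ps}"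
  shows "topk_mechanism k ps \<Delta> \<rho> s =
    distr (measure_pmf (pl_pmf (\<lambda>p. exp (s p / (2 * \<Delta> * sqrt (real k / (8 * \<rho>))))) k (set ps)))
      (topk_space k ps) (\<lambda>xs. if xs \<in> \<Omega> then xs else take k ps)"
proof -
  define b where "b = 2 * \<Delta> * sqrt (real k / (8 * \<rho>))"
  have b: "b > 0" using assms by (simp add: b_def)
  define w where "w p = exp (s p / b)" for p
  let ?P = "\<Pi>\<^sub>M _\<in>set ps. gumbel b"
  let ?t = "\<lambda>z. take k (descending (\<lambda>p. s p + z p) ps)"
  let ?M = "distr ?P (topk_space k ps) ?t"
  \<comment> \<open>\<open>pl_pmf\<close> lives on all lists; lists outside \<Omega>, which have
    mass 0, are sent to a default member of \<Omega> to obtain a map into the output space.\<close>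
  let ?g = "\<lambda>xs. if xs \<in> \<Omega> then xs else take k ps"
  let ?N = "distr (measure_pmf (pl_pmf w k (set ps))) (topk_space k ps) ?g"
  have \<Omega>: "finite \<Omega>" "take k ps \<in> \<Omega>"
    using k finite_lists_length_eq[of "set ps" k] by (auto simp: \<Omega>_def conj_commute dest: in_set_takeD)
  have space: "topk_space k ps = count_space \<Omega>" by (simp add: topk_space_def \<Omega>_def)
  have card: "k \<le> card (set ps)" using ps k by (simp add: distinct_card)
  have wpos: "w p > 0" for p by (simp add: w_def)
  have t: "?t \<in> ?P \<rightarrow>\<^sub>M topk_space k ps"
    using measurable_topk[OF k] by (simp cong: measurable_cong_sets add: measurable_cong_sets[OF sets_PiM_gumbel refl])
  have g: "?g \<in> measure_pmf (pl_pmf w k (set ps)) \<rightarrow>\<^sub>M topk_space k ps"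
    using \<Omega> by (simp add: space)
  interpret P: prob_space ?P using b by (intro prob_space_PiM prob_space_gumbel) simp
  interpret M: prob_space ?M by (rule P.prob_space_distr[OF t])
  interpret N: prob_space ?N by (rule measure_pmf.prob_space_distr[OF g])
  have sets: "sets ?M = Pow \<Omega>" "sets ?N = Pow \<Omega>" by (auto simp: space)
  have le: "measure ?N {xs} \<le> measure ?M {xs}" if xs: "xs \<in> \<Omega>" for xs
  proof -
    have "measure ?N {xs} = measure (measure_pmf (pl_pmf w k (set ps))) (?g -` {xs})"
      using xs by (subst measure_distr[OF g]) (auto simp: space)
    also have "\<dots> = measure (measure_pmf (pl_pmf w k (set ps))) {xs}"
      using set_pl_pmf[OF _ card wpos] xs
      by (intro measure_pmf.finite_measure_eq_AE) (auto simp: AE_measure_pmf_iff \<Omega>_def)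
    also have "\<dots> = pmf (pl_pmf w k (set ps)) xs" by (rule measure_pmf_single)
    also have "\<dots> \<le> measure ?M {xs}"
    proof (cases "distinct xs")
      case False
      then have "xs \<notin> set_pmf (pl_pmf w k (set ps))" using set_pl_pmf[OF _ card wpos] by auto
      then show ?thesis by (simp add: set_pmf_iff)
    next
      case True
      have xk: "length xs = k" "set xs \<subseteq> set ps" using xs by (auto simp: \<Omega>_def)
      have pl: "pmf (pl_pmf w k (set ps)) xs = pl_prob w xs (set ps)"
        using pmf_pl_pmf[of "set ps" w xs] wpos True xk by simp
      \<comment> \<open>The event with threshold \<open>T\<close> forces the output
        \<open>xs\<close>. Letting \<open>T\<close> tend to infinity removes the exponential
        factor.\<close>
      have bound: "pl_prob w xs (set ps) * exp (- sum w (set ps) * exp (- T / b)) \<le> measure ?M {xs}" for T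
      proof -
        let ?E = "{z \<in> space ?P. topk_event s xs (set ps) T z}"
        have "ennreal (pl_prob w xs (set ps) * exp (- sum w (set ps) * exp (- T / b))) = emeasure ?P ?E"
          unfolding w_def[abs_def] using True xk by (intro emeasure_topk_event[OF b, symmetric]) auto
        also have "\<dots> \<le> emeasure ?P (?t -` {xs} \<inter> space ?P)"
        proof (rule emeasure_mono)
          show "?E \<subseteq> ?t -` {xs} \<inter> space ?P"
            using topk_event_imp_take[OF _ ps True xk(2)] xk(1) by auto
          show "?t -` {xs} \<inter> space ?P \<in> sets ?P"
            using t by (rule measurable_sets) (use xs in \<open>simp add: space\<close>)
        qed
        also have "\<dots> = emeasure ?M {xs}"
          using xs by (subst emeasure_distr[OF t]) (auto simp: space)
        finally show ?thesis by (simp add: M.emeasure_eq_measure)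
      qed
      have "((\<lambda>T. exp (- T / b)) \<longlongrightarrow> 0) at_top"
      proof (rule filterlim_compose[OF exp_at_bot])
        have "filterlim (\<lambda>T. (1 / b) * T) at_top at_top"
          using b by (intro filterlim_tendsto_pos_mult_at_top[OF tendsto_const] filterlim_ident) auto
        then have "filterlim (\<lambda>T. - ((1 / b) * T)) at_bot at_top"
          by (rule filterlim_uminus_at_top[THEN iffD1])
        then show "filterlim (\<lambda>T. - T / b) at_bot at_top" by simp
      qed
      then have "((\<lambda>T. pl_prob w xs (set ps) * exp (- sum w (set ps) * exp (- T / b))) \<longlongrightarrow>
          pl_prob w xs (set ps) * exp (- sum w (set ps) * 0)) at_top"
        by (intro tendsto_intros)
      then have "pl_prob w xs (set ps) * exp (- sum w (set ps) * 0) \<le> measure ?M {xs}"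
        by (rule tendsto_upperbound) (use bound in auto)
      then show ?thesis by (simp add: pl)
    qed
    finally show ?thesis .
  qed
  have "(\<Sum>xs\<in>\<Omega>. measure ?N {xs}) = measure ?N \<Omega>" "(\<Sum>xs\<in>\<Omega>. measure ?M {xs}) = measure ?M \<Omega>"
    using \<Omega> sets by (auto intro!: N.finite_measure_eq_sum_singleton[symmetric] M.finite_measure_eq_sum_singleton[symmetric])
  moreover have "measure ?N \<Omega> = 1" "measure ?M \<Omega> = 1"
    using N.prob_space M.prob_space by (simp_all add: space)
  ultimately have sums: "(\<Sum>xs\<in>\<Omega>. measure ?N {xs}) = (\<Sum>xs\<in>\<Omega>. measure ?M {xs})" by simp
  have "measure ?N {xs} = measure ?M {xs}" if xs: "xs \<in> \<Omega>" for xs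
    by (rule sum_mono_inv[of "\<lambda>xs. measure ?N {xs}" \<Omega> "\<lambda>xs. measure ?M {xs}" xs, OF sums le xs \<Omega>(1)])
  then have "?M = ?N"
    by (intro measure_eqI_finite[OF sets \<Omega>(1)]) (simp add: M.emeasure_eq_measure N.emeasure_eq_measure)
  then show ?thesis by (simp add: topk_mechanism_def b_def w_def[abs_def])
qed

lemma topk_mechanism_in_prob_algebra:
  assumes "k \<le> length ps" "\<Delta> \<ge> 0" "\<rho> > 0"
  shows "topk_mechanism k ps \<Delta> \<rho> s \<in> space (prob_algebra (topk_space k ps))"
proof -
  let ?b = "2 * \<Delta> * sqrt (real k / (8 * \<rho>))"
  interpret prob_space "\<Pi>\<^sub>M _\<in>set ps. gumbel ?b"
    using assms by (intro prob_space_PiM prob_space_gumbel) simp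
  have "(\<lambda>z. take k (descending (\<lambda>p. s p + z p) ps)) \<in> (\<Pi>\<^sub>M _\<in>set ps. gumbel ?b) \<rightarrow>\<^sub>M topk_space k ps"
    using measurable_topk[OF assms(1)] by (simp add: measurable_cong_sets[OF sets_PiM_gumbel refl])
  then show ?thesis
    unfolding topk_mechanism_def space_prob_algebra by (auto intro: prob_space_distr)
qed

text \<open>The scale \<open>b\<close> gives (2 \<Delta> / b)^2 / 8 = \<rho> / k, the share of one
  of k rounds. For \<Delta> = 0 the noise is a point mass and the two score functions agree on
  \<open>ps\<close>.\<close>

lemma renyi_dual_topk_mechanism:
  fixes s s' :: "'p \<Rightarrow> real"
  assumes a: "\<alpha> > 1" and ps: "distinct ps" and k: "1 \<le> k" "k \<le> length ps"
    and \<Delta>: "\<Delta> \<ge> 0" and \<rho>: "\<rho> > 0"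
    and le: "\<And>p. p \<in> set ps \<Longrightarrow> \<bar>s p - s' p\<bar> \<le> \<Delta>"
  shows "renyi_dual \<alpha> \<rho> (topk_mechanism k ps \<Delta> \<rho> s) (topk_mechanism k ps \<Delta> \<rho> s')"
proof (cases "\<Delta> = 0")
  case True
  then have eq: "s p = s' p" if "p \<in> set ps" for p using le[OF that] by simp
  have "topk_mechanism k ps \<Delta> \<rho> s = topk_mechanism k ps \<Delta> \<rho> s'"
    unfolding topk_mechanism_def using eq
    by (intro distr_cong refl arg_cong[where f = "take k"] descending_cong) auto
  moreover have "renyi_dual \<alpha> 0 (topk_mechanism k ps \<Delta> \<rho> s') (topk_mechanism k ps \<Delta> \<rho> s')"
    using topk_mechanism_in_prob_algebra[OF k(2) \<Delta> \<rho>] by (intro renyi_dual_refl a) (auto simp: space_prob_algebra)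
  ultimately show ?thesis using renyi_dual_mono[OF _ _ a] \<rho> by (metis less_imp_le)
next
  case False
  define b where "b = 2 * \<Delta> * sqrt (real k / (8 * \<rho>))"
  have b: "b > 0" using False \<Delta> k \<rho> by (auto simp: b_def)
  have "(2 * \<Delta> / b)\<^sup>2 = 8 * \<rho> / real k"
    using False k \<rho> by (simp add: b_def power_divide power_mult_distrib)
  then have \<rho>_eq: "real k * ((2 * \<Delta> / b)\<^sup>2 / 8) = \<rho>" using k by simp
  have "renyi_dual \<alpha> (real k * ((2 * \<Delta> / b)\<^sup>2 / 8)) (measure_pmf (pl_pmf (\<lambda>p. exp (s p / b)) k (set ps)))
      (measure_pmf (pl_pmf (\<lambda>p. exp (s' p / b)) k (set ps)))"
    using k ps le by (intro renyi_dual_pl_pmf[OF a b]) (auto simp: distinct_card)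
  then have "renyi_dual \<alpha> \<rho> (measure_pmf (pl_pmf (\<lambda>p. exp (s p / b)) k (set ps)))
      (measure_pmf (pl_pmf (\<lambda>p. exp (s' p / b)) k (set ps)))"
    unfolding \<rho>_eq .
  then show ?thesis
    unfolding topk_mechanism_eq_pl_pmf[OF ps k(2) b[unfolded b_def]] b_def
    using k(2) by (intro renyi_dual_distr[OF a]) (auto simp: topk_space_def dest: in_set_takeD split: if_splits)
qed

section \<open>The rank search and Phase 3\<close>

lemma gaussian_in_prob_algebra: "\<sigma> \<ge> 0 \<Longrightarrow> gaussian \<mu> \<sigma> \<in> space (prob_algebra borel)"
  by (simp add: space_prob_algebra prob_space_gaussian)

lemma rank_loop_in_prob_algebra:
  assumes "\<sigma> \<ge> 0"
  shows "rank_loop ps s p \<sigma> \<xi> low high \<in> space (prob_algebra (count_space UNIV))"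
  using assms
proof (induction ps s p \<sigma> \<xi> low high rule: rank_loop.induct)
  case (1 ps s p \<sigma> \<xi> low high)
  show ?case
  proof (cases "low < high \<and> 1 \<le> low \<and> high \<le> length ps")
    case True
    define t where "t = (low + high) div 2"
    define G where "G = gaussian (s p - s (rank_inv ps s t)) \<sigma>"
    define K where "K = (\<lambda>x. if x \<ge> \<xi> then rank_loop ps s p \<sigma> \<xi> low (max (t - 1) 1)
        else rank_loop ps s p \<sigma> \<xi> (min (t + 1) (length ps)) high)"
    have K: "K \<in> borel \<rightarrow>\<^sub>M prob_algebra (count_space UNIV)"
      unfolding K_def
    proof (intro measurable_If measurable_const)
      \<comment> \<open>The induction hypotheses are guarded by the outcome of the comparison; the
        samples \<xi> and \<xi> - 1 are witnesses for the two branches.\<close>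
      show "rank_loop ps s p \<sigma> \<xi> low (max (t - 1) 1) \<in> space (prob_algebra (count_space UNIV))"
        by (rule "1.IH"(1)[OF True t_def, of \<xi>]) (use 1 in auto)
      show "rank_loop ps s p \<sigma> \<xi> (min (t + 1) (length ps)) high \<in> space (prob_algebra (count_space UNIV))"
        by (rule "1.IH"(2)[OF True t_def, of "\<xi> - 1"]) (use 1 in auto)
    qed auto
    have G: "G \<in> space (prob_algebra borel)" unfolding G_def using 1 by (intro gaussian_in_prob_algebra) auto
    have "rank_loop ps s p \<sigma> \<xi> low high = G \<bind> K"
      unfolding G_def K_def t_def by (subst rank_loop.simps) (simp only: True Let_def if_True simp_thms)
    then show ?thesis using prob_space_bind'[OF G K] sets_bind'[OF G K] by (simp add: space_prob_algebra)
  next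
    case False
    then show ?thesis
      by (subst rank_loop.simps) (auto simp: space_prob_algebra intro!: prob_space_return)
  qed
qed

text \<open>Each iteration at least halves the length of the search interval, so an interval of length
  less than \<open>2 ^ (n + 1)\<close> is searched in at most \<open>n\<close> iterations.\<close>

lemma renyi_dual_rank_loop:
  assumes a: "\<alpha> > 1" and \<sigma>: "\<sigma> \<ge> 0" and c: "c \<ge> 0"
    and d: "\<And>t. 1 \<le> t \<Longrightarrow> t \<le> length ps \<Longrightarrow>
      renyi_dual \<alpha> c (gaussian (s p - s (rank_inv ps s t)) \<sigma>) (gaussian (s' p - s' (rank_inv ps s' t)) \<sigma>)"
  shows "high + 1 - low < 2 ^ (n + 1) \<Longrightarrow>
    renyi_dual \<alpha> (real n * c) (rank_loop ps s p \<sigma> \<xi> low high) (rank_loop ps s' p \<sigma> \<xi> low high)"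
proof (induction n arbitrary: low high)
  case 0
  then have "\<not> low < high" by simp
  then have "rank_loop ps f p \<sigma> \<xi> low high = return (count_space UNIV) high" for f
    by (subst rank_loop.simps) simp
  then show ?case by (simp add: renyi_dual_refl[OF a] prob_space_return)
next
  case (Suc n)
  show ?case
  proof (cases "low < high \<and> 1 \<le> low \<and> high \<le> length ps")
    case False
    then have "rank_loop ps f p \<sigma> \<xi> low high = return (count_space UNIV) high" for f
      by (subst rank_loop.simps) auto
    moreover have "renyi_dual \<alpha> 0 (return (count_space UNIV) high) (return (count_space UNIV) high)"
      by (intro renyi_dual_refl a prob_space_return) simp
    ultimately show ?thesis using renyi_dual_mono[OF _ _ a] c by (metis mult_nonneg_nonneg of_nat_0_le_iff)
  next
    case True
    define t where "t = (low + high) div 2"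
    have t: "1 \<le> t" "t \<le> length ps" "low \<le> t" "t < high" "1 \<le> low" using True by (auto simp: t_def)
    have size: "high + 1 - low < 2 * 2 ^ (n + 1)" using Suc.prems by simp
    \<comment> \<open>The midpoint itself leaves the interval, so neither half exceeds half the old
      length. The exception is t = 1, where the new state is (1, 1), of length 1 rather than
      0.\<close>
    have left: "max (t - 1) 1 + 1 - low < 2 ^ (n + 1)"
    proof (cases "t = 1")
      case False
      then have "max (t - 1) 1 + 1 - low = t - low" using t by simp
      then show ?thesis using size True by (simp add: t_def)
    next
      case True
      then have eq: "max (t - 1) 1 + 1 - low = 1" using t by simp
      have "(1::nat) < 2 ^ (n + 1)" by (rule one_less_power) auto
      then show ?thesis unfolding eq .
    qed
    have right: "high + 1 - min (t + 1) (length ps) < 2 ^ (n + 1)"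
      using size True t by (simp add: t_def)
    define K where "K f = (\<lambda>x. if x \<ge> \<xi> then rank_loop ps f p \<sigma> \<xi> low (max (t - 1) 1)
        else rank_loop ps f p \<sigma> \<xi> (min (t + 1) (length ps)) high)" for f
    have eq: "rank_loop ps f p \<sigma> \<xi> low high = gaussian (f p - f (rank_inv ps f t)) \<sigma> \<bind> K f" for f
      unfolding K_def t_def by (subst rank_loop.simps) (simp only: True Let_def if_True simp_thms)
    have K: "K f \<in> gaussian (s' p - s' (rank_inv ps s' t)) \<sigma> \<rightarrow>\<^sub>M prob_algebra (count_space UNIV)" for f
      unfolding K_def by (intro measurable_If measurable_const rank_loop_in_prob_algebra \<sigma>) auto
    have "renyi_dual \<alpha> (c + real n * c) (rank_loop ps s p \<sigma> \<xi> low high) (rank_loop ps s' p \<sigma> \<xi> low high)"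
      unfolding eq
    proof (rule renyi_dual_bind[OF a d[OF t(1,2)] K K])
      show "renyi_dual \<alpha> (real n * c) (K s x) (K s' x)" for x
        unfolding K_def using Suc.IH[OF left] Suc.IH[OF right] by auto
    qed
    moreover have "real (Suc n) * c = c + real n * c" by (simp add: distrib_right)
    ultimately show ?thesis by (simp only:)
  qed
qed

lemma rank_bound_in_prob_algebra:
  assumes "\<Delta> \<ge> 0" "\<rho> > 0"
  shows "rank_bound ps \<Delta> s p \<rho> \<beta> dir \<in> space (prob_algebra (count_space UNIV))"
proof (cases "length ps = 0")
  case True
  have "rank_loop ps s p \<sigma> \<xi> 1 (length ps) = return (count_space UNIV) (length ps)" for \<sigma> \<xi>
    using True by (subst rank_loop.simps) auto
  then show ?thesis by (simp add: rank_bound_def Let_def space_prob_algebra prob_space_return)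
next
  case False
  have "0 \<le> log 2 (real (length ps))" using False by (simp add: Suc_le_eq)
  then have "0 \<le> real_of_int \<lceil>log 2 (real (length ps))\<rceil>" by linarith
  then show ?thesis
    unfolding rank_bound_def Let_def using assms
    by (intro rank_loop_in_prob_algebra divide_nonneg_nonneg real_sqrt_ge_zero mult_nonneg_nonneg) auto
qed

text \<open>A comparison concerns the difference of two scores, each stable up to \<Delta>, hence
  the sensitivity 2 \<Delta>. With N the rounded-up binary logarithm, the length of
  \<open>ps\<close> is at most 2^N, so there are at most N comparisons at the price \<rho> / N each.
  The threshold does not depend on the scores.\<close>

lemma renyi_dual_rank_bound:
  assumes a: "\<alpha> > 1" and ps: "distinct ps" and p: "p \<in> set ps" and \<Delta>: "\<Delta> \<ge> 0" and \<rho>: "\<rho> > 0"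
    and le: "\<And>p. p \<in> set ps \<Longrightarrow> \<bar>s p - s' p\<bar> \<le> \<Delta>"
  shows "renyi_dual \<alpha> \<rho> (rank_bound ps \<Delta> s p \<rho> \<beta> dir) (rank_bound ps \<Delta> s' p \<rho> \<beta> dir)"
proof (cases "length ps = 1")
  \<comment> \<open>Here N = 0 and the formula for the noise level divides by zero, but the loop
    returns at once.\<close>
  case True
  have "rank_loop ps f p \<sigma> \<xi> 1 (length ps) = return (count_space UNIV) (length ps)" for f \<sigma> \<xi>
    using True by (subst rank_loop.simps) auto
  then have "rank_bound ps \<Delta> s p \<rho> \<beta> dir = rank_bound ps \<Delta> s' p \<rho> \<beta> dir"
    by (simp add: rank_bound_def Let_def)
  moreover have "renyi_dual \<alpha> 0 (rank_bound ps \<Delta> s' p \<rho> \<beta> dir) (rank_bound ps \<Delta> s' p \<rho> \<beta> dir)"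
    using rank_bound_in_prob_algebra[OF \<Delta> \<rho>, of ps s' p \<beta> dir] by (intro renyi_dual_refl a) (auto simp: space_prob_algebra)
  ultimately show ?thesis using renyi_dual_mono[OF _ _ a] \<rho> by (metis less_imp_le)
next
  case False
  have len: "2 \<le> length ps" using False p by (cases ps) (auto simp: Suc_le_eq)
  define n where "n = nat \<lceil>log 2 (real (length ps))\<rceil>"
  have "1 \<le> log 2 (real (length ps))" using len by (subst le_log_iff) auto
  then have N: "real_of_int \<lceil>log 2 (real (length ps))\<rceil> = real n" "n > 0" "log 2 (real (length ps)) \<le> real n"
    unfolding n_def by linarith+
  have "real (length ps) \<le> 2 powr real n" using N(3) len by (subst (asm) log_le_iff) auto
  then have "real (length ps) \<le> real (2 ^ n)" by (simp add: powr_realpow)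
  then have "length ps \<le> 2 ^ n" by (simp only: of_nat_le_iff)
  then have size: "length ps + 1 - 1 < 2 ^ (n + 1)" using len by (simp add: le_less_trans)
  have "renyi_dual \<alpha> (real n * (\<rho> / real n))
      (rank_loop ps s p (2 * \<Delta> / sqrt (2 * (\<rho> / real n))) \<xi> 1 (length ps))
      (rank_loop ps s' p (2 * \<Delta> / sqrt (2 * (\<rho> / real n))) \<xi> 1 (length ps))" for \<xi>
  proof (rule renyi_dual_rank_loop[OF a _ _ _ size])
    fix t assume t: "1 \<le> t" "t \<le> length ps"
    show "renyi_dual \<alpha> (\<rho> / real n) (gaussian (s p - s (rank_inv ps s t)) (2 * \<Delta> / sqrt (2 * (\<rho> / real n))))
        (gaussian (s' p - s' (rank_inv ps s' t)) (2 * \<Delta> / sqrt (2 * (\<rho> / real n))))"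
    proof (rule renyi_dual_gaussian_sensitivity[OF a])
      show "\<bar>s p - s (rank_inv ps s t) - (s' p - s' (rank_inv ps s' t))\<bar> \<le> 2 * \<Delta>"
        using rank_inv_score_change[OF ps t le] le[OF p] by fastforce
    qed (use \<Delta> \<rho> N in auto)
  qed (use \<Delta> \<rho> N in auto)
  moreover have "real n * (\<rho> / real n) = \<rho>" using N by simp
  ultimately show ?thesis unfolding rank_bound_def Let_def N(1) by (simp only:)
qed

lemma rank_interval_in_prob_algebra:
  assumes "\<Delta> \<ge> 0" "\<rho> > 0" "0 < \<eta>" "\<eta> < 1"
  shows "rank_interval ps \<Delta> s \<rho> \<eta> \<gamma> p \<in> space (prob_algebra (count_space UNIV \<Otimes>\<^sub>M count_space UNIV))"
proof -
  have "rank_bound ps \<Delta> s p (\<eta> * \<rho>) \<beta> dir \<in> space (prob_algebra (count_space UNIV))"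
    "rank_bound ps \<Delta> s p ((1 - \<eta>) * \<rho>) \<beta> dir \<in> space (prob_algebra (count_space UNIV))" for \<beta> dir
    using assms by (auto intro!: rank_bound_in_prob_algebra)
  then show ?thesis
    unfolding rank_interval_def space_prob_algebra
    by (auto intro!: prob_space_pair sets_pair_measure_cong)
qed

lemma renyi_dual_rank_interval:
  assumes a: "\<alpha> > 1" and ps: "distinct ps" and p: "p \<in> set ps" and \<Delta>: "\<Delta> \<ge> 0" and \<rho>: "\<rho> > 0"
    and \<eta>: "0 < \<eta>" "\<eta> < 1" and le: "\<And>p. p \<in> set ps \<Longrightarrow> \<bar>s p - s' p\<bar> \<le> \<Delta>"
  shows "renyi_dual \<alpha> \<rho> (rank_interval ps \<Delta> s \<rho> \<eta> \<gamma> p) (rank_interval ps \<Delta> s' \<rho> \<eta> \<gamma> p)"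
proof -
  have "renyi_dual \<alpha> (\<eta> * \<rho> + (1 - \<eta>) * \<rho>) (rank_interval ps \<Delta> s \<rho> \<eta> \<gamma> p) (rank_interval ps \<Delta> s' \<rho> \<eta> \<gamma> p)"
    unfolding rank_interval_def using \<rho> \<eta> le by (intro renyi_dual_pair renyi_dual_rank_bound a ps p \<Delta>) auto
  then show ?thesis by (simp add: algebra_simps)
qed

section \<open>Phase 3 as an adaptive composition\<close>

lemma renyi_dual_bind_pair:
  assumes a: "\<alpha> > 1" and d1: "renyi_dual \<alpha> \<rho>1 P Q" and d2: "renyi_dual \<alpha> \<rho>2 P' Q'"
    and F: "(\<lambda>(x, y). F x y) \<in> Q \<Otimes>\<^sub>M Q' \<rightarrow>\<^sub>M prob_algebra N"
  shows "renyi_dual \<alpha> (\<rho>1 + \<rho>2) (P \<bind> (\<lambda>x. P' \<bind> F x)) (Q \<bind> (\<lambda>x. Q' \<bind> F x))"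
proof -
  note 1 = renyi_dualD[OF d1] and 2 = renyi_dualD[OF d2]
  have K: "(\<lambda>x. R \<bind> F x) \<in> Q \<rightarrow>\<^sub>M prob_algebra N" if "prob_space R" "sets R = sets Q'" for R
    using that by (intro measurable_bind_prob_space2[where N = Q', OF _ F] measurable_const)
      (auto simp: space_prob_algebra)
  show ?thesis
  \<comment> \<open>The second draw ignores the first outcome, so its cost is \<rho>2 for every
    \<open>x\<close>; the common kernel \<open>F\<close>, which sees both outcomes, is
    post-processing.\<close>
  proof (rule renyi_dual_bind[OF a d1 K[OF 2(1,3)] K[OF 2(2) refl]])
    fix x assume x: "x \<in> space Q"
    have Fx: "F x \<in> Q' \<rightarrow>\<^sub>M prob_algebra N"
      using measurable_compose[OF measurable_Pair1'[OF x] F] by simp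
    have "renyi_dual \<alpha> (\<rho>2 + 0) (P' \<bind> F x) (Q' \<bind> F x)"
      using measurable_space[OF Fx] by (intro renyi_dual_bind[OF a d2 Fx Fx] renyi_dual_refl a)
        (auto simp: space_prob_algebra)
    then show "renyi_dual \<alpha> \<rho>2 (P' \<bind> F x) (Q' \<bind> F x)" by simp
  qed
qed

lemma valid_configD:
  assumes "valid_config C"
  shows "distinct (preds C)" "1 \<le> top_size C" "top_size C \<le> length (preds C)"
    "0 < split_ratio C" "split_ratio C < 1" "rho_q C > 0" "rho_topk C > 0" "rho_influ C > 0" "rho_rank C > 0"
  using assms by (auto simp: valid_config_def)

text \<open>Given the list of selected predicates, the noisy influences and the rank intervals are
  two independent families of k mechanisms, each member spending a k-th part of the budget of its
  family.\<close>

lemma renyi_dual_phase3_draws: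
  assumes a: "\<alpha> > 1" and V: "valid_query S q" and C: "valid_config C"
    and le: "\<And>p. \<bar>influence S q agg qn D p - influence S q agg qn D' p\<bar> \<le> influence_sensitivity S q agg"
  shows "renyi_dual \<alpha> (rho_topk C + rho_influ C + rho_rank C) (phase3_draws S q agg C qn D) (phase3_draws S q agg C qn D')"
    and "phase3_draws S q agg C qn D \<in> space (prob_algebra (draws_space (top_size C) (preds C)))"
proof -
  note C = valid_configD[OF C]
  define ps where "ps = preds C"
  define k where "k = top_size C"
  define \<Delta> where "\<Delta> = influence_sensitivity S q agg"
  define s where "s = influence S q agg qn"
  have \<Delta>: "\<Delta> \<ge> 0" unfolding \<Delta>_def by (rule influence_sensitivity_nonneg[OF V])
  have k: "1 \<le> k" "k \<le> length ps" using C by (auto simp: k_def ps_def)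
  have ps: "distinct ps" using C by (simp add: ps_def)
  have le: "\<bar>s D p - s D' p\<bar> \<le> \<Delta>" for p using le by (simp add: s_def \<Delta>_def)
  define \<rho>i where "\<rho>i = rho_influ C / real k"
  define \<rho>r where "\<rho>r = rho_rank C / real k"
  have \<rho>: "\<rho>i > 0" "\<rho>r > 0" using C k by (auto simp: \<rho>i_def \<rho>r_def)
  have sigma: "influ_sigma S q agg C = \<Delta> / sqrt (2 * \<rho>i)"
    by (simp add: influ_sigma_def \<Delta>_def \<rho>i_def k_def)
  define top where "top E = topk_mechanism k ps \<Delta> (rho_topk C) (s E)" for E
  define infs where "infs E l = (\<Pi>\<^sub>M u\<in>{..<k}. gaussian (s E (l ! u)) (\<Delta> / sqrt (2 * \<rho>i)))" for E l
  define ranks where "ranks E l = (\<Pi>\<^sub>M u\<in>{..<k}. rank_interval ps \<Delta> (s E) \<rho>r (split_ratio C) (conf C) (l ! u))" for E l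
  let ?O = "draws_space k ps"
  let ?K = "\<lambda>E l. infs E l \<bind> (\<lambda>i. ranks E l \<bind> (\<lambda>r. return ?O (l, i, r)))"
  have draws: "phase3_draws S q agg C qn E = top E \<bind> ?K E" for E
    unfolding phase3_draws_def Let_def sigma[unfolded \<Delta>_def] top_def infs_def ranks_def s_def \<rho>r_def ps_def k_def \<Delta>_def ..
  have top: "top E \<in> space (prob_algebra (topk_space k ps))" for E
    unfolding top_def using C by (intro topk_mechanism_in_prob_algebra k \<Delta>) auto
  have sets_infs: "sets (infs E l) = sets (\<Pi>\<^sub>M _\<in>{..<k}. borel)" for E l
    unfolding infs_def by (intro sets_PiM_cong) auto
  have sets_ranks: "sets (ranks E l) = sets (\<Pi>\<^sub>M _\<in>{..<k}. count_space UNIV \<Otimes>\<^sub>M count_space UNIV)" for E l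
    unfolding ranks_def
    using rank_interval_in_prob_algebra[OF \<Delta> \<rho>(2) C(4,5), of ps "s E" "conf C"]
    by (intro sets_PiM_cong) (simp_all add: space_prob_algebra)
  have ret: "(\<lambda>(i, r). return ?O (l, i, r)) \<in> infs E l \<Otimes>\<^sub>M ranks E l \<rightarrow>\<^sub>M prob_algebra ?O"
    if l: "l \<in> space (topk_space k ps)" for l E
  proof -
    have "(\<lambda>(i, r). (l, i, r)) \<in> infs E l \<Otimes>\<^sub>M ranks E l \<rightarrow>\<^sub>M ?O"
      unfolding draws_space_def measurable_cong_sets[OF sets_pair_measure_cong[OF sets_infs sets_ranks] refl]
      using l by measurable
    from measurable_compose[OF this measurable_return_prob_space] show ?thesis by (simp add: case_prod_unfold)
  qed
  \<comment> \<open>Stated for arbitrary \<open>E\<close> and \<open>E'\<close>: the case E = E'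
    also shows that the kernels consist of probability measures.\<close>
  have dual: "renyi_dual \<alpha> (rho_influ C + rho_rank C) (?K E l) (?K E' l)"
    if l: "l \<in> space (topk_space k ps)" and le: "\<And>p. \<bar>s E p - s E' p\<bar> \<le> \<Delta>" for l E E'
  proof (rule renyi_dual_bind_pair[OF a _ _ ret[OF l]])
    have "renyi_dual \<alpha> (\<Sum>u<k. \<rho>i) (infs E l) (infs E' l)"
      unfolding infs_def using le by (intro renyi_dual_PiM renyi_dual_gaussian_sensitivity a \<Delta> \<rho>) auto
    then show "renyi_dual \<alpha> (rho_influ C) (infs E l) (infs E' l)" using k by (simp add: \<rho>i_def)
    have "l ! u \<in> set ps" if "u < k" for u
      using l that by (auto simp: topk_space_def)
    then have "renyi_dual \<alpha> (\<Sum>u<k. \<rho>r) (ranks E l) (ranks E' l)"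
      unfolding ranks_def using le C by (intro renyi_dual_PiM renyi_dual_rank_interval a ps \<Delta> \<rho>) auto
    then show "renyi_dual \<alpha> (rho_rank C) (ranks E l) (ranks E' l)" using k by (simp add: \<rho>r_def)
  qed
  have sets_K: "sets (?K E l) = sets ?O" if l: "l \<in> space (topk_space k ps)" for E l
  proof -
    have self: "\<bar>s E p - s E p\<bar> \<le> \<Delta>" for p using \<Delta> by simp
    have "renyi_dual \<alpha> (\<Sum>u<k. \<rho>i) (infs E l) (infs E l)"
      unfolding infs_def using self by (intro renyi_dual_PiM renyi_dual_gaussian_sensitivity a \<Delta> \<rho>) auto
    then have "prob_space (infs E l)" by (rule renyi_dualD)
    moreover have "l ! u \<in> set ps" if "u < k" for u
      using l that by (auto simp: topk_space_def)
    then have "renyi_dual \<alpha> (\<Sum>u<k. \<rho>r) (ranks E l) (ranks E l)"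
      unfolding ranks_def using self C by (intro renyi_dual_PiM renyi_dual_rank_interval a ps \<Delta> \<rho>) auto
    then have "prob_space (ranks E l)" by (rule renyi_dualD)
    ultimately have P: "infs E l \<in> space (prob_algebra (infs E l))" "ranks E l \<in> space (prob_algebra (ranks E l))"
      by (auto simp: space_prob_algebra)
    show ?thesis
      by (rule sets_bind'[OF P(1) measurable_bind_prob_space2[OF measurable_const[OF P(2)] ret[OF l]]])
  qed
  have self: "\<bar>s E p - s E p\<bar> \<le> \<Delta>" for p E using \<Delta> by simp
  \<comment> \<open>\<open>topk_space\<close> is a count space, so a kernel on it only needs its
    values in the right space.\<close>
  have K_top: "?K E \<in> topk_space k ps \<rightarrow>\<^sub>M prob_algebra ?O" for E
  proof -
    have "?K E l \<in> space (prob_algebra ?O)" if l: "l \<in> space (topk_space k ps)" for l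
      using sets_K[OF l] renyi_dualD(1)[OF dual[OF l self]] by (simp add: space_prob_algebra)
    then show ?thesis unfolding topk_space_def by simp
  qed
  have K: "?K E \<in> top E' \<rightarrow>\<^sub>M prob_algebra ?O" for E E'
    using K_top top[of E'] by (simp add: space_prob_algebra cong: measurable_cong_sets)
  have dtop: "renyi_dual \<alpha> (rho_topk C) (top D) (top D')"
    unfolding top_def using C le by (intro renyi_dual_topk_mechanism a ps k \<Delta>) auto
  have "renyi_dual \<alpha> (rho_topk C + (rho_influ C + rho_rank C)) (top D \<bind> ?K D) (top D' \<bind> ?K D')"
  proof (rule renyi_dual_bind[OF a dtop K K])
    fix l assume "l \<in> space (top D')"
    then have "l \<in> space (topk_space k ps)"
      using top[of D'] by (auto simp: space_prob_algebra dest: sets_eq_imp_space_eq)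
    then show "renyi_dual \<alpha> (rho_influ C + rho_rank C) (?K D l) (?K D' l)" by (rule dual[OF _ le])
  qed
  then show "renyi_dual \<alpha> (rho_topk C + rho_influ C + rho_rank C) (phase3_draws S q agg C qn D) (phase3_draws S q agg C qn D')"
    by (simp add: draws add.assoc)
  show "phase3_draws S q agg C qn D \<in> space (prob_algebra (draws_space (top_size C) (preds C)))"
    using prob_space_bind'[OF top K_top] sets_bind'[OF top K_top]
    by (simp add: draws space_prob_algebra k_def ps_def)
qed

section \<open>Composition of the phases\<close>

lemma base_queries_props:
  "finite (base_queries agg)" "a \<in> base_queries agg \<Longrightarrow> a \<noteq> AVG_agg"
  "real (card (base_queries agg)) * base_budget agg \<rho> = \<rho>"
  by (cases agg; auto simp: base_queries_def base_budget_def)+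

text \<open>Budgets of independent coordinates add, but a coordinate is charged only if it belongs
  to the one group \<open>z\<close> that can differ. The sum thus runs over the base queries, whose
  shares add up to \<rho>.\<close>

lemma renyi_dual_phase1:
  assumes a: "\<alpha> > 1" and V: "valid_query S q" and \<rho>: "\<rho> > 0"
    and D: "D \<in> databases S" "D' \<in> databases S" and N: "neighboring D D'"
  shows "renyi_dual \<alpha> \<rho> (phase1 S q agg \<rho> D) (phase1 S q agg \<rho> D')"
proof -
  obtain z where z: "\<And>a x. a \<noteq> AVG_agg \<Longrightarrow>
      \<bar>agg_bag S q a (group_of q x D) - agg_bag S q a (group_of q x D')\<bar>
        \<le> (if x = z then base_sensitivity S q a else 0)"
    using agg_bag_group_of_neighboring[OF V D N] by blast
  define B where "B = base_budget agg \<rho>"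
  have B: "B > 0" using \<rho> by (auto simp: B_def base_budget_def split: aggregate.split)
  have fin: "finite (groups S q)" using V by (simp add: valid_query_def)
  have sens: "base_sensitivity S q a \<ge> 0" for a
    using agg_max_nonneg[OF V] by (simp add: base_sensitivity_def split: aggregate.split)
  have "renyi_dual \<alpha> (\<Sum>(a, x)\<in>base_queries agg \<times> groups S q. if x = z then B else 0)
      (phase1 S q agg \<rho> D) (phase1 S q agg \<rho> D')"
    unfolding phase1_def B_def[symmetric]
  proof (rule renyi_dual_PiM[OF a])
    fix i assume i: "i \<in> base_queries agg \<times> groups S q"
    obtain c x where ax: "i = (c, x)" "c \<noteq> AVG_agg" using i base_queries_props(2) by (cases i) auto
    let ?G = "\<lambda>D. gaussian (agg_bag S q c (group_of q x D)) (base_sensitivity S q c / sqrt (2 * B))"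
    have "renyi_dual \<alpha> (if x = z then B else 0) (?G D) (?G D')"
    proof (cases "x = z")
      case True
      then show ?thesis using z[OF ax(2), of x] sens B by (auto intro!: renyi_dual_gaussian_sensitivity a)
    next
      case False
      then have "agg_bag S q c (group_of q x D) = agg_bag S q c (group_of q x D')"
        using z[OF ax(2), of x] by simp
      then show ?thesis using False sens B by (auto intro!: renyi_dual_refl a prob_space_gaussian)
    qed
    then show "renyi_dual \<alpha> (case i of (a, x) \<Rightarrow> if x = z then B else 0)
        (case i of (a, x) \<Rightarrow> gaussian (agg_bag S q a (group_of q x D)) (base_sensitivity S q a / sqrt (2 * B)))
        (case i of (a, x) \<Rightarrow> gaussian (agg_bag S q a (group_of q x D')) (base_sensitivity S q a / sqrt (2 * B)))"
      by (simp add: ax)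
  qed (use fin base_queries_props(1) in auto)
  moreover have "(\<Sum>(a, x)\<in>base_queries agg \<times> groups S q. if x = z then B else 0) \<le> \<rho>"
  proof -
    have "(\<Sum>(a, x)\<in>base_queries agg \<times> groups S q. if x = z then B else 0) =
        real (card (base_queries agg)) * (if z \<in> groups S q then B else 0)"
      using fin by (simp add: sum.cartesian_product[symmetric])
    also have "\<dots> \<le> real (card (base_queries agg)) * B" using B by (intro mult_left_mono) auto
    finally show ?thesis unfolding B_def base_queries_props(3) .
  qed
  ultimately show ?thesis using renyi_dual_mono[OF _ _ a] by blast
qed

lemma phase1_in_prob_algebra:
  assumes V: "valid_query S q" and \<rho>: "\<rho> > 0"
  shows "phase1 S q agg \<rho> D \<in> space (prob_algebra (stored_space S q agg))"
proof -
  have "base_sensitivity S q a \<ge> 0" for a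
    using agg_max_nonneg[OF V] by (simp add: base_sensitivity_def split: aggregate.split)
  moreover have "base_budget agg \<rho> > 0" using \<rho> by (auto simp: base_budget_def split: aggregate.split)
  ultimately show ?thesis
    unfolding phase1_def stored_space_def space_prob_algebra
    by (auto intro!: prob_space_PiM prob_space_gaussian sets_PiM_cong)
qed

section \<open>Measurability of the public values and the table\<close>

lemma measurable_stored:
  "a \<in> base_queries agg \<Longrightarrow> x \<in> groups S q \<Longrightarrow> (\<lambda>w. w (a, x)) \<in> borel_measurable (stored_space S q agg)"
  unfolding stored_space_def by (intro measurable_component_singleton) auto

lemma measurable_released_answer:
  assumes "x \<in> groups S q"
  shows "(\<lambda>w. released_answers S q agg w x) \<in> borel_measurable (stored_space S q agg)"
proof (cases agg)
  case AVG_agg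
  have "(\<lambda>w. w (SUM_agg, x) / w (COUNT_agg, x)) \<in> borel_measurable (stored_space S q AVG_agg)"
    using assms by (intro borel_measurable_divide measurable_stored) (auto simp: base_queries_def)
  then show ?thesis using assms AVG_agg by (simp add: released_answers_def)
qed (use assms measurable_stored[of agg agg x S q] in \<open>auto simp: released_answers_def base_queries_def\<close>)

lemma measurable_released_answers:
  "released_answers S q agg \<in> stored_space S q agg \<rightarrow>\<^sub>M answer_space S q"
proof -
  have "(\<lambda>w. \<lambda>x\<in>groups S q. released_answers S q agg w x) \<in> stored_space S q agg \<rightarrow>\<^sub>M answer_space S q"
    unfolding answer_space_def by (intro measurable_restrict measurable_released_answer)
  moreover have "(\<lambda>x\<in>groups S q. released_answers S q agg w x) = released_answers S q agg w" for w
    by (auto simp: released_answers_def)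
  ultimately show ?thesis by simp
qed

lemma measurable_rescaling:
  assumes "x \<in> groups S q" "y \<in> groups S q"
  shows "(\<lambda>w. rescaling S q agg w (x, y)) \<in> borel_measurable (stored_space S q agg)"
proof -
  note m = measurable_released_answer[OF assms(1), of agg] measurable_released_answer[OF assms(2), of agg]
  have d: "(\<lambda>w. \<bar>released_answers S q agg w x - released_answers S q agg w y\<bar>) \<in> borel_measurable (stored_space S q agg)"
    by (intro borel_measurable_abs borel_measurable_diff m)
  show ?thesis
  proof (cases agg)
    case AVG_agg
    have "(\<lambda>w. \<bar>min (w (COUNT_agg, x)) (w (COUNT_agg, y))\<bar>) \<in> borel_measurable (stored_space S q agg)"
      using assms by (intro borel_measurable_abs borel_measurable_min measurable_stored) (auto simp: AVG_agg base_queries_def)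
    from borel_measurable_times[OF d this] show ?thesis by (simp add: rescaling_def AVG_agg Let_def)
  qed (use d in \<open>simp_all add: rescaling_def Let_def\<close>)
qed

lemma measurable_table_of:
  assumes "x \<in> groups S q" "y \<in> groups S q"
  shows "(\<lambda>(w, z). table_of S q agg C w (x, y) z) \<in>
    stored_space S q agg \<Otimes>\<^sub>M draws_space (top_size C) (preds C) \<rightarrow>\<^sub>M table_space (top_size C) (preds C)"
proof -
  let ?k = "top_size C" and ?M = "stored_space S q agg \<Otimes>\<^sub>M draws_space (top_size C) (preds C)"
  define h where "h = sqrt 2 * influ_sigma S q agg C * erf_inv (conf C)"
  have r: "(\<lambda>v. rescaling S q agg (fst v) (x, y)) \<in> borel_measurable ?M"
    by (rule measurable_compose[OF measurable_fst measurable_rescaling[OF assms]])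
  have snd: "(\<lambda>v. snd v) \<in> ?M \<rightarrow>\<^sub>M topk_space ?k (preds C) \<Otimes>\<^sub>M (\<Pi>\<^sub>M _\<in>{..<?k}. borel) \<Otimes>\<^sub>M
      (\<Pi>\<^sub>M _\<in>{..<?k}. count_space UNIV \<Otimes>\<^sub>M count_space UNIV)"
    unfolding draws_space_def by (rule measurable_snd)
  note top = measurable_compose[OF snd measurable_fst]
  note infs = measurable_compose[OF measurable_compose[OF snd measurable_snd] measurable_fst]
  note ranks = measurable_compose[OF measurable_compose[OF snd measurable_snd] measurable_snd]
  have "(\<lambda>v. \<lambda>u\<in>{..<?k}. (fst (snd v) ! u, fst (snd (snd v)) u,
      ((fst (snd (snd v)) u - h) / rescaling S q agg (fst v) (x, y),
       (fst (snd (snd v)) u + h) / rescaling S q agg (fst v) (x, y)), snd (snd (snd v)) u)) \<in>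
      ?M \<rightarrow>\<^sub>M table_space ?k (preds C)"
    unfolding table_space_def
  proof (rule measurable_restrict)
    fix u assume u: "u \<in> {..<?k}"
    have 1: "(\<lambda>v. fst (snd v) ! u) \<in> ?M \<rightarrow>\<^sub>M count_space (set (preds C))"
      using u by (intro measurable_compose[OF top]) (auto simp: topk_space_def)
    have 2: "(\<lambda>v. fst (snd (snd v)) u) \<in> borel_measurable ?M"
      using u by (intro measurable_compose[OF infs]) measurable
    have 3: "(\<lambda>v. snd (snd (snd v)) u) \<in> ?M \<rightarrow>\<^sub>M count_space UNIV \<Otimes>\<^sub>M count_space UNIV"
      using u by (intro measurable_compose[OF ranks] measurable_component_singleton)
    show "(\<lambda>v. (fst (snd v) ! u, fst (snd (snd v)) u,
      ((fst (snd (snd v)) u - h) / rescaling S q agg (fst v) (x, y),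
       (fst (snd (snd v)) u + h) / rescaling S q agg (fst v) (x, y)), snd (snd (snd v)) u)) \<in>
      ?M \<rightarrow>\<^sub>M count_space (set (preds C)) \<Otimes>\<^sub>M borel \<Otimes>\<^sub>M (borel \<Otimes>\<^sub>M borel) \<Otimes>\<^sub>M
        (count_space UNIV \<Otimes>\<^sub>M count_space UNIV)"
      by (intro measurable_Pair 1 2 3 borel_measurable_divide borel_measurable_diff borel_measurable_add r
          borel_measurable_const)
  qed
  then show ?thesis
    by (simp add: table_of_def h_def Let_def case_prod_unfold)
qed

text \<open>For a fixed question, everything shown is a function of the stored values and the draws;
  the database no longer occurs.\<close>

lemma measurable_output:
  assumes ci: "answer_interval S q agg ci" and srt: "table_sorter S q C srt"
    and qn: "qn \<in> groups S q \<times> groups S q"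
  shows "(\<lambda>(w, z). let pub = (released_answers S q agg w, qn, ci qn w) in (pub, srt pub (table_of S q agg C w qn z)))
    \<in> stored_space S q agg \<Otimes>\<^sub>M draws_space (top_size C) (preds C) \<rightarrow>\<^sub>M output_space S q C"
proof -
  let ?M = "stored_space S q agg \<Otimes>\<^sub>M draws_space (top_size C) (preds C)"
  have "ci qn \<in> stored_space S q agg \<rightarrow>\<^sub>M borel \<Otimes>\<^sub>M borel" using ci qn by (auto simp: answer_interval_def)
  then have pub: "(\<lambda>v. (released_answers S q agg (fst v), qn, ci qn (fst v))) \<in> ?M \<rightarrow>\<^sub>M public_space S q"
    unfolding public_space_def
    using qn by (intro measurable_Pair measurable_compose[OF measurable_fst] measurable_released_answers measurable_const)
      (auto simp: question_space_def)
  have tab: "(\<lambda>v. table_of S q agg C (fst v) qn (snd v)) \<in> ?M \<rightarrow>\<^sub>M table_space (top_size C) (preds C)"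
    using measurable_table_of[of "fst qn" S q "snd qn" agg C] qn by (auto simp: case_prod_unfold)
  have "case_prod srt \<in> output_space S q C \<rightarrow>\<^sub>M table_space (top_size C) (preds C)"
    using srt by (simp add: table_sorter_def)
  then have "case_prod srt \<in> public_space S q \<Otimes>\<^sub>M table_space (top_size C) (preds C) \<rightarrow>\<^sub>M table_space (top_size C) (preds C)"
    by (simp add: output_space_def)
  from measurable_Pair[OF pub measurable_compose[OF measurable_Pair[OF pub tab] this]]
  show ?thesis by (simp add: output_space_def Let_def case_prod_unfold)
qed

section \<open>Adaptive composition of the three phases\<close>

theorem theorem4p12:
  fixes S :: "('a, 'v) schema" and q :: "('a, 'v) gb_query" and agg :: aggregate
    and C :: "('a, 'v) config"
    and user :: "('v \<Rightarrow> real) \<Rightarrow> 'v question measure"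
    and ci :: "'v question \<Rightarrow> 'v stored \<Rightarrow> real \<times> real"
    and srt :: "'v public \<Rightarrow> (nat \<Rightarrow> (('a, 'v) tup \<Rightarrow> bool) row) \<Rightarrow>
                  nat \<Rightarrow> (('a, 'v) tup \<Rightarrow> bool) row"
  assumes "valid_query S q"
    and "valid_config C"
    and "user_strategy S q user"
    and "answer_interval S q agg ci"
    and "table_sorter S q C srt"
  shows "zCDP (databases S) (output_space S q C) (dpxplain S q agg C user ci srt)
           (rho_q C + rho_topk C + rho_influ C + rho_rank C)"
proof -
  note V = assms(1) and C = assms(2)
  note \<rho> = valid_configD(6-9)[OF C]
  let ?St = "stored_space S q agg" and ?Q = "question_space S q"
    and ?Dr = "draws_space (top_size C) (preds C)" and ?O = "output_space S q C"
  define out where "out w qn z = (let pub = (released_answers S q agg w, qn, ci qn w)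
      in (pub, srt pub (table_of S q agg C w qn z)))" for w qn z
  define K3 where "K3 D w qn = phase3_draws S q agg C qn D \<bind> (\<lambda>z. return ?O (out w qn z))" for D w qn
  \<comment> \<open>The kernels condition on the full stored vector \<open>w\<close>, not just on
    what the user sees. Given \<open>w\<close> and the question, the database enters through
    \<open>phase3_draws\<close> alone.\<close>
  define K where "K D w = user (released_answers S q agg w) \<bind> K3 D w" for D w
  have M: "dpxplain S q agg C user ci srt D = phase1 S q agg (rho_q C) D \<bind> K D" for D
    unfolding dpxplain_def K_def K3_def out_def Let_def ..
  have user: "(\<lambda>w. user (released_answers S q agg w)) \<in> ?St \<rightarrow>\<^sub>M prob_algebra ?Q"
    using measurable_compose[OF measurable_released_answers] assms(3) by (simp add: user_strategy_def)
  have out: "(\<lambda>(w, z). out w qn z) \<in> ?St \<Otimes>\<^sub>M ?Dr \<rightarrow>\<^sub>M ?O" if "qn \<in> groups S q \<times> groups S q" for qn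
    unfolding out_def by (rule measurable_output[OF assms(4,5) that])
  have out_w: "out w qn \<in> ?Dr \<rightarrow>\<^sub>M ?O" if "w \<in> space ?St" "qn \<in> groups S q \<times> groups S q" for w qn
    using measurable_compose[OF measurable_Pair1'[OF that(1)] out[OF that(2)]] by simp
  have p3: "phase3_draws S q agg C qn D \<in> space (prob_algebra ?Dr)" for qn D
    \<comment> \<open>The fact extracted concerns a single database and no order; the order 2 and
      \<open>D' = D\<close> satisfy the premises.\<close>
    using influence_sensitivity_nonneg[OF V] by (intro renyi_dual_phase3_draws(2)[of 2, OF _ V C, where D' = D]) simp_all
  have K3: "(\<lambda>(w, qn). K3 D w qn) \<in> ?St \<Otimes>\<^sub>M ?Q \<rightarrow>\<^sub>M prob_algebra ?O" for D
  proof -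
    have "(\<lambda>v. K3 D (fst v) (snd v)) \<in> ?St \<Otimes>\<^sub>M ?Q \<rightarrow>\<^sub>M prob_algebra ?O"
      unfolding K3_def
    proof (rule measurable_bind_prob_space2[where N = ?Dr])
      have "(\<lambda>qn. phase3_draws S q agg C qn D) \<in> ?Q \<rightarrow>\<^sub>M prob_algebra ?Dr"
        using p3 by (simp add: question_space_def)
      from measurable_compose[OF measurable_snd this]
      show "(\<lambda>v. phase3_draws S q agg C (snd v) D) \<in> ?St \<Otimes>\<^sub>M ?Q \<rightarrow>\<^sub>M prob_algebra ?Dr" .
      have "(\<lambda>v. out (fst (fst v)) (snd (fst v)) (snd v)) \<in> (?St \<Otimes>\<^sub>M ?Q) \<Otimes>\<^sub>M ?Dr \<rightarrow>\<^sub>M ?O"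
      \<comment> \<open>Measurability of the output is known for each fixed question; as there are
        finitely many questions, joint measurability follows.\<close>
      proof (rule measurable_compose_countable'[where I = "groups S q \<times> groups S q" and g = "\<lambda>v. snd (fst v)"])
        show "(\<lambda>v. snd (fst v)) \<in> (?St \<Otimes>\<^sub>M ?Q) \<Otimes>\<^sub>M ?Dr \<rightarrow>\<^sub>M count_space (groups S q \<times> groups S q)"
          unfolding question_space_def by measurable
        show "countable (groups S q \<times> groups S q)"
          using V by (intro countable_finite) (simp add: valid_query_def)
        fix qn assume qn: "qn \<in> groups S q \<times> groups S q"
        have "(\<lambda>v. (fst (fst v), snd v)) \<in> (?St \<Otimes>\<^sub>M ?Q) \<Otimes>\<^sub>M ?Dr \<rightarrow>\<^sub>M ?St \<Otimes>\<^sub>M ?Dr"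
          by measurable
        from measurable_compose[OF this out[OF qn]]
        show "(\<lambda>v. out (fst (fst v)) qn (snd v)) \<in> (?St \<Otimes>\<^sub>M ?Q) \<Otimes>\<^sub>M ?Dr \<rightarrow>\<^sub>M ?O" by simp
      qed
      from measurable_compose[OF this measurable_return_prob_space]
      show "(\<lambda>(v, z). return ?O (out (fst v) (snd v) z)) \<in> (?St \<Otimes>\<^sub>M ?Q) \<Otimes>\<^sub>M ?Dr \<rightarrow>\<^sub>M prob_algebra ?O"
        by (simp add: case_prod_unfold)
    qed
    then show ?thesis by (simp add: case_prod_unfold)
  qed
  have K3_w: "K3 D w \<in> ?Q \<rightarrow>\<^sub>M prob_algebra ?O" if "w \<in> space ?St" for D w
    using measurable_compose[OF measurable_Pair1'[OF that] K3] by simp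
  have K: "K D \<in> ?St \<rightarrow>\<^sub>M prob_algebra ?O" for D
    unfolding K_def by (rule measurable_bind_prob_space2[OF user K3])
  note p1 = phase1_in_prob_algebra[OF V \<rho>(1), of agg]
  show ?thesis
    unfolding zCDP_def randomized_mechanism_def
  proof (intro conjI ballI impI allI)
    fix D
    show "prob_space (dpxplain S q agg C user ci srt D)"
      unfolding M by (rule prob_space_bind'[OF p1 K])
    show "sets (dpxplain S q agg C user ci srt D) = sets ?O"
      unfolding M by (rule sets_bind'[OF p1 K])
  next
    fix D D' \<alpha> assume D: "D \<in> databases S" "D' \<in> databases S" and N: "neighboring D D'" and a: "\<alpha> > (1::real)"
    let ?\<rho>3 = "rho_topk C + rho_influ C + rho_rank C"
    have sets1: "sets (phase1 S q agg (rho_q C) D') = sets ?St" using p1[of D'] by (simp add: space_prob_algebra)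
    have space1: "space (phase1 S q agg (rho_q C) D') = space ?St" using sets1 by (rule sets_eq_imp_space_eq)
    have K1: "K E \<in> phase1 S q agg (rho_q C) D' \<rightarrow>\<^sub>M prob_algebra ?O" for E
      using K sets1 by (simp cong: measurable_cong_sets)
    have d3: "renyi_dual \<alpha> ?\<rho>3 (K3 D w qn) (K3 D' w qn)"
      if w: "w \<in> space ?St" and qn: "qn \<in> groups S q \<times> groups S q" for w qn
    proof -
      have d: "renyi_dual \<alpha> ?\<rho>3 (phase3_draws S q agg C qn D) (phase3_draws S q agg C qn D')"
        by (rule renyi_dual_phase3_draws(1)[OF a V C]) (rule influence_neighboring[OF V D N])
      have ret: "(\<lambda>z. return ?O (out w qn z)) \<in> phase3_draws S q agg C qn D' \<rightarrow>\<^sub>M prob_algebra ?O"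
        using measurable_compose[OF out_w[OF w qn] measurable_return_prob_space] p3[of qn D']
        by (simp add: space_prob_algebra cong: measurable_cong_sets)
      have "renyi_dual \<alpha> (?\<rho>3 + 0) (K3 D w qn) (K3 D' w qn)"
        unfolding K3_def using measurable_space[OF ret]
        by (intro renyi_dual_bind[OF a d ret ret] renyi_dual_refl a) (simp add: space_prob_algebra)
      then show ?thesis by simp
    qed
    have dK: "renyi_dual \<alpha> ?\<rho>3 (K D w) (K D' w)" if w: "w \<in> space ?St" for w
    proof -
      have u: "user (released_answers S q agg w) \<in> space (prob_algebra ?Q)"
        using measurable_space[OF user w] .
      then have us: "sets (user (released_answers S q agg w)) = sets ?Q" "prob_space (user (released_answers S q agg w))"
        by (auto simp: space_prob_algebra)
      have Ku: "K3 E w \<in> user (released_answers S q agg w) \<rightarrow>\<^sub>M prob_algebra ?O" for E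
        using K3_w[OF w] us by (simp cong: measurable_cong_sets)
      \<comment> \<open>Given \<open>w\<close>, the strategy draws the question from the same
        measure for both databases, because it sees the released answers only; it costs
        nothing.\<close>
      have "renyi_dual \<alpha> (0 + ?\<rho>3) (K D w) (K D' w)"
        unfolding K_def
      proof (rule renyi_dual_bind[OF a renyi_dual_refl[OF a us(2)] Ku Ku])
        fix qn assume "qn \<in> space (user (released_answers S q agg w))"
        then have "qn \<in> groups S q \<times> groups S q"
          using sets_eq_imp_space_eq[OF us(1)] by (simp add: question_space_def)
        then show "renyi_dual \<alpha> ?\<rho>3 (K3 D w qn) (K3 D' w qn)" by (rule d3[OF w])
      qed
      then show ?thesis by simp
    qed
    have "renyi_dual \<alpha> (rho_q C + ?\<rho>3) (dpxplain S q agg C user ci srt D) (dpxplain S q agg C user ci srt D')"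
      unfolding M using dK space1
      by (intro renyi_dual_bind[OF a renyi_dual_phase1[OF a V \<rho>(1) D N] K1 K1]) auto
    from renyi_divergence_le[OF a _ this] \<rho>
    show "renyi_divergence \<alpha> (dpxplain S q agg C user ci srt D) (dpxplain S q agg C user ci srt D')
        \<le> ereal ((rho_q C + rho_topk C + rho_influ C + rho_rank C) * \<alpha>)"
      by (simp add: add.assoc)
  qed
qed

end
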